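(* Let $A=\mathbb Z[x]/(x^2)$, concentrated in degree $0$, be the symmetric Frobenius algebra with coproduct $\nu(1)=1\otimes x+x\otimes1$, $\nu(x)=x\otimes x$. For each $g\ge1$, the class $\mu_g\in\mathcal{SD}((g+1,0),(1,0))$ induces a non-trivial map $HH_0(A,A)^{\otimes g+1}\to HH_{2g+1}(A,A)$.
   Context: Reduced Hochschild complex of $A$: $C_n(A,A)=A\otimes(A/\mathbb Z1)^{\otimes n}$, $n\ge0$, with the usual Hochschild differential; $HH_*(A,A)$ is its homology. Black and white graphs: fat graphs (cyclic ordering of the half-edges at each vertex) with black vertices of valence $\ge3$, white vertices of any valence $\ge1$ each with a chosen start half-edge, and labelled leaves (an unlabelled leaf is allowed only as start half-edge of a white vertex). Boundary cycles are the boundary components of the ribbon surface not surrounding white vertices. An orientation is a unit vector in $\det(\mathbb R(V\sqcup H))$ ($V$ vertices, $H$ half-edges; reversing it multiplies by $-1$); the degree is $\sum_{\text{black}}(|v|-3)+\sum_{\text{white}}(|v|-1)$; the differential is the sum of all blow-ups (graphs with an edge whose collapse gives back the graph), a white vertex blowing up into a white and a black vertex. $\mathcal{SD}((n_1,0),(1,0))$, the complex of Sullivan diagrams with one white vertex (the outgoing circle) and $n_1$ leaves, each being the only labelled leaf in its boundary cycle (the incoming circles), is the quotient of the complex of such black and white graphs by the graphs having a black vertex of valence $\ge4$ and their boundaries. Action: $H_0(\mathcal O)$ is the prop whose morphisms $n\to m$ are freely generated by topological types of cobordisms from $n$ to $m$ intervals ($H_0$ of complexes of fat graphs with $n+m$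 labelled leaves); its algebras are exactly symmetric Frobenius algebras. Cutting around the white vertex writes a Sullivan diagram $G$ with white vertex of valence $k$ as a morphism $\Gamma\in H_0(\mathcal O)(n_1,k)$ whose $k$ outputs are attached, in order from the start half-edge, to the white vertex. Sullivan diagrams act by a chain map $F:\mathcal{SD}((n_1,0),(1,0))\otimes C_*(A,A)^{\otimes n_1}\to C_*(A,A)$ given on $C_{j_1-1}(A,A)\otimes\dots\otimes C_{j_{n_1}-1}(A,A)$ as follows: sum over all diagrams obtained from $G$ by attaching $j_i-1$ further labelled leaves, in cyclic order after the $i$th leaf, at corners of the vertices of the $i$th incoming boundary cycle (for each $i$); then cut around the white vertex and apply the resulting morphism of $H_0(\mathcal O)$ to the tensor factors, reading the resulting element of $A^{\otimes k}$ as a Hochschild chain in $C_{k-1}(A,A)$. On $C_0(A,A)^{\otimes n_1}=A^{\otimes n_1}$ this is $F(G\otimes a)=\Gamma(a)\in A^{\otimes k}$, viewed in $C_{k-1}(A,A)$. A cycle $G$ of degree $d$ induces maps $HH_0(A,A)^{\otimes n_1}\to HH_{d}(A,A)$. The diagram $\mu_g$: a white vertex with half-edges $h_1,\dots,h_{2g+2}$ in cyclic order, $h_1$ the start half-edge, where the odd half-edges $h_1,h_3,\dots,h_{2g+1}$ are connected by a trivalent tree embedded so that the graph is planar (for $g=1$, an edge joining $h_1$ and $h_3$), and the even half-edges $h_2,h_4,\dots,h_{2g+2}$ are leaves labelled $1,\dots,g+1$ in their cyclic order, each considered as marking an incoming closed boundary component. $\mu_g$ is a cycle of degree $2g+1$;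 its underlying cobordism has genus $0$ with $g+1$ incoming circles and one outgoing circle. *)

theory Defs
  imports
    "HOL-Algebra.Free_Abelian_Groups"
    "HOL-Algebra.Coset"
    "HOL-Combinatorics.Orbits"
    "HOL-Combinatorics.Cycles"
begin

section \<open>Abelian groups by generators and relations\<close>

definition frag_span :: "('a \<Rightarrow>\<^sub>0 int) set \<Rightarrow> ('a \<Rightarrow>\<^sub>0 int) set" where
  "frag_span S = frag_extend (\<lambda>x. x) ` carrier (free_Abelian_group S)"

definition multilinear_relations :: "('a, 'm) monoid_scheme \<Rightarrow> nat \<Rightarrow> ('a list \<Rightarrow>\<^sub>0 int) set" where
  "multilinear_relations M n =
     frag_span {frag_of (xs[i := x \<otimes>\<^bsub>M\<^esub> y]) - frag_of (xs[i := x]) - frag_of (xs[i := y]) | xs i x y.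
        length xs = n \<and> set xs \<subseteq> carrier M \<and> i < n \<and> x \<in> carrier M \<and> y \<in> carrier M}"

definition tensor_power :: "('a, 'm) monoid_scheme \<Rightarrow> nat \<Rightarrow> ('a list \<Rightarrow>\<^sub>0 int) set monoid" where
  "tensor_power M n =
     free_Abelian_group {xs. length xs = n \<and> set xs \<subseteq> carrier M} Mod multilinear_relations M n"

definition pure_tensor :: "('a, 'm) monoid_scheme \<Rightarrow> 'a list \<Rightarrow> ('a list \<Rightarrow>\<^sub>0 int) set" where
  "pure_tensor M xs =
     multilinear_relations M (length xs)
     #>\<^bsub>free_Abelian_group {ys. length ys = length xs \<and> set ys \<subseteq> carrier M}\<^esub> frag_of xs"


section \<open>Symmetric Frobenius algebras with a finite basis\<close>

text \<open>
  An algebra over the integers, concentrated in degree 0, that is free on the finite type \<open>'b\<close>,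
  given by its structure maps on basis elements.
\<close>

record 'b frob =
  fmul :: "'b \<Rightarrow> 'b \<Rightarrow> 'b \<Rightarrow>\<^sub>0 int"
  funit :: "'b \<Rightarrow>\<^sub>0 int"
  fcomul :: "'b \<Rightarrow> ('b \<times> 'b) \<Rightarrow>\<^sub>0 int"
  fcounit :: "'b \<Rightarrow> int"

definition counit_ext :: "('b, 'm) frob_scheme \<Rightarrow> ('b \<Rightarrow>\<^sub>0 int) \<Rightarrow> int" where
  "counit_ext P a = (\<Sum>b\<in>Poly_Mapping.keys a. Poly_Mapping.lookup a b * fcounit P b)"

definition symmetric_frobenius :: "('b::finite, 'm) frob_scheme \<Rightarrow> bool" where
  "symmetric_frobenius P \<longleftrightarrow>
     (\<forall>a b c. frag_extend (\<lambda>d. fmul P d c) (fmul P a b) = frag_extend (\<lambda>d. fmul P a d) (fmul P b c)) \<and>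
     (\<forall>a. frag_extend (\<lambda>d. fmul P d a) (funit P) = frag_of a) \<and>
     (\<forall>a. frag_extend (\<lambda>d. fmul P a d) (funit P) = frag_of a) \<and>
     (\<forall>a. frag_extend (\<lambda>(c, d). frag_extend (\<lambda>(e, f). frag_of (e, f, d)) (fcomul P c)) (fcomul P a) =
          frag_extend (\<lambda>(c, d). frag_extend (\<lambda>(e, f). frag_of (c, e, f)) (fcomul P d)) (fcomul P a)) \<and>
     (\<forall>a. frag_extend (\<lambda>(c, d). frag_cmul (fcounit P c) (frag_of d)) (fcomul P a) = frag_of a) \<and>
     (\<forall>a. frag_extend (\<lambda>(c, d). frag_cmul (fcounit P d) (frag_of c)) (fcomul P a) = frag_of a) \<and>
     (\<forall>a b. frag_extend (fcomul P) (fmul P a b) =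
            frag_extend (\<lambda>(c, d). frag_extend (\<lambda>e. frag_of (e, d)) (fmul P a c)) (fcomul P b)) \<and>
     (\<forall>a b. frag_extend (fcomul P) (fmul P a b) =
            frag_extend (\<lambda>(c, d). frag_extend (\<lambda>e. frag_of (c, e)) (fmul P d b)) (fcomul P a)) \<and>
     (\<forall>a b. counit_ext P (fmul P a b) = counit_ext P (fmul P b a))"

text \<open>The \<open>k\<close>-th tensor power of the algebra is free on the words of length \<open>k\<close> in the basis.\<close>

definition words :: "nat \<Rightarrow> ('b list \<Rightarrow>\<^sub>0 int) monoid" where
  "words k = free_Abelian_group {u. length u = k}"

definition unit_word :: "('b, 'm) frob_scheme \<Rightarrow> 'b list \<Rightarrow>\<^sub>0 int" where
  "unit_word P = frag_extend (\<lambda>e. frag_of [e]) (funit P)"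

fun tensor :: "('b list \<Rightarrow>\<^sub>0 int) list \<Rightarrow> 'b list \<Rightarrow>\<^sub>0 int" where
  "tensor [] = frag_of []"
| "tensor (a # as) = frag_extend (\<lambda>u. frag_extend (\<lambda>v. frag_of (u @ v)) (tensor as)) a"


section \<open>Reduced Hochschild homology\<close>

definition hoch_word :: "('b, 'm) frob_scheme \<Rightarrow> 'b list \<Rightarrow> 'b list \<Rightarrow>\<^sub>0 int" where
  "hoch_word P u =
     (\<Sum>i<length u - 1. frag_cmul ((-1) ^ i)
        (frag_extend (\<lambda>c. frag_of (take i u @ c # drop (i + 2) u)) (fmul P (u ! i) (u ! Suc i)))) +
     frag_cmul ((-1) ^ (length u - 1))
        (frag_extend (\<lambda>c. frag_of (c # tl (butlast u))) (fmul P (last u) (hd u)))"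

definition degen :: "('b, 'm) frob_scheme \<Rightarrow> nat \<Rightarrow> ('b list \<Rightarrow>\<^sub>0 int) set" where
  "degen P n = frag_span {tensor as | as j. length as = n + 1 \<and> set as \<subseteq> carrier (words 1) \<and>
     1 \<le> j \<and> j \<le> n \<and> as ! j = unit_word P}"

definition hoch :: "('b, 'm) frob_scheme \<Rightarrow> nat \<Rightarrow> ('b list \<Rightarrow>\<^sub>0 int) set monoid" where
  "hoch P n = words (n + 1) Mod degen P n"

text \<open>The differential from degree \<open>n\<close> to degree \<open>n - 1\<close>, for \<open>n \<ge> 1\<close>.\<close>

definition hoch_bd :: "('b, 'm) frob_scheme \<Rightarrow> nat \<Rightarrow> ('b list \<Rightarrow>\<^sub>0 int) set \<Rightarrow> ('b list \<Rightarrow>\<^sub>0 int) set" where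
  "hoch_bd P n X = (\<Union>x\<in>X. degen P (n - 1) #>\<^bsub>words n\<^esub> frag_extend (hoch_word P) x)"

definition hoch_cycles :: "('b, 'm) frob_scheme \<Rightarrow> nat \<Rightarrow> ('b list \<Rightarrow>\<^sub>0 int) set monoid" where
  "hoch_cycles P n =
     hoch P n \<lparr>carrier := {X \<in> carrier (hoch P n). n = 0 \<or> hoch_bd P n X = \<one>\<^bsub>hoch P (n - 1)\<^esub>}\<rparr>"

definition hoch_boundaries :: "('b, 'm) frob_scheme \<Rightarrow> nat \<Rightarrow> ('b list \<Rightarrow>\<^sub>0 int) set set" where
  "hoch_boundaries P n = hoch_bd P (n + 1) ` carrier (hoch P (n + 1))"

definition HH :: "('b, 'm) frob_scheme \<Rightarrow> nat \<Rightarrow> ('b list \<Rightarrow>\<^sub>0 int) set set monoid" where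
  "HH P n = hoch_cycles P n Mod hoch_boundaries P n"

definition HH_class :: "('b, 'm) frob_scheme \<Rightarrow> nat \<Rightarrow> ('b list \<Rightarrow>\<^sub>0 int) \<Rightarrow> ('b list \<Rightarrow>\<^sub>0 int) set set" where
  "HH_class P n c =
     hoch_boundaries P n #>\<^bsub>hoch_cycles P n\<^esub> (degen P n #>\<^bsub>words (n + 1)\<^esub> c)"


section \<open>Black and white graphs with one white vertex\<close>

text \<open>
  Half-edges are natural numbers. The vertices are the orbits of \<open>nxt\<close>, which is the cyclic ordering
  at every vertex; the edges are the 2-element orbits of the involution \<open>opp\<close>, its fixed points are
  the leaves. The white vertex is the orbit of its start half-edge; the entry at index \<open>i\<close> of
  \<open>labelled\<close> is the leaf with label \<open>i + 1\<close>. Both permutations are the identity outside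
  \<open>halves\<close>.
\<close>

record bw_graph =
  halves :: "nat set"
  nxt :: "nat \<Rightarrow> nat"
  opp :: "nat \<Rightarrow> nat"
  start :: nat
  labelled :: "nat list"

definition vertices :: "bw_graph \<Rightarrow> nat set set" where
  "vertices G = orbit (nxt G) ` halves G"

definition white :: "bw_graph \<Rightarrow> nat set" where
  "white G = orbit (nxt G) (start G)"

definition blacks :: "bw_graph \<Rightarrow> nat set set" where
  "blacks G = vertices G - {white G}"

definition white_list :: "bw_graph \<Rightarrow> nat list" where
  "white_list G = map (\<lambda>i. (nxt G ^^ i) (start G)) [0..<card (white G)]"

text \<open>
  Going out along \<open>h\<close> one returns along \<open>opp h\<close> and leaves again along \<open>nxt (opp h)\<close>. So the orbits
  of \<open>nxt \<circ> opp\<close> are the boundary components of the ribbon surface in which the white vertex is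
  thickened to a disc like the black ones, i.e. the boundary cycles; a leaf lies in exactly one of them.
\<close>

definition boundary_cycle :: "bw_graph \<Rightarrow> nat \<Rightarrow> nat set" where
  "boundary_cycle G h = orbit (nxt G \<circ> opp G) h"

definition sullivan_graph :: "nat \<Rightarrow> bw_graph \<Rightarrow> bool" where
  "sullivan_graph n G \<longleftrightarrow>
     finite (halves G) \<and> nxt G permutes halves G \<and> opp G permutes halves G \<and> opp G \<circ> opp G = id \<and>
     start G \<in> halves G \<and>
     length (labelled G) = n \<and> distinct (labelled G) \<and>
     set (labelled G) \<subseteq> {h \<in> halves G. opp G h = h} \<and>
     {h \<in> halves G. opp G h = h} \<subseteq> insert (start G) (set (labelled G)) \<and>
     (\<forall>v\<in>blacks G. 3 \<le> card v) \<and>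
     (\<forall>h\<in>set (labelled G). \<forall>h'\<in>set (labelled G). h' \<in> boundary_cycle G h \<longrightarrow> h' = h)"

definition degree :: "bw_graph \<Rightarrow> nat" where
  "degree G = (\<Sum>v\<in>blacks G. card v - 3) + (card (white G) - 1)"

text \<open>
  An enumeration of the vertices and half-edges stands for the wedge product of its entries, a unit
  vector in the determinant line.
\<close>

type_synonym orient = "(nat set + nat) list"

definition orientation :: "bw_graph \<Rightarrow> orient \<Rightarrow> bool" where
  "orientation G \<omega> \<longleftrightarrow> distinct \<omega> \<and> set \<omega> = Inl ` vertices G \<union> Inr ` halves G"

definition relabel :: "(nat \<Rightarrow> nat) \<Rightarrow> bw_graph \<times> orient \<Rightarrow> bw_graph \<times> orient" where
  "relabel \<phi> = (\<lambda>(G, \<omega>).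
     (\<lparr>halves = \<phi> ` halves G, nxt = \<phi> \<circ> nxt G \<circ> inv_into UNIV \<phi>, opp = \<phi> \<circ> opp G \<circ> inv_into UNIV \<phi>,
       start = \<phi> (start G), labelled = map \<phi> (labelled G)\<rparr>,
      map (map_sum ((`) \<phi>) \<phi>) \<omega>))"


subsection \<open>Blow-ups\<close>

definition arc :: "bw_graph \<Rightarrow> nat \<Rightarrow> nat \<Rightarrow> nat set" where
  "arc G a b = (\<lambda>i. (nxt G ^^ i) a) ` {..funpow_dist (nxt G) a b}"

text \<open>
  The half-edges \<open>a, \<dots>, b\<close> are moved from their vertex \<open>v\<close> to a new black vertex, joined to what
  remains of \<open>v\<close> by a new edge \<open>{p, q}\<close>, with \<open>p\<close> at the new black vertex. If the start half-edge
  moves, \<open>q\<close> becomes the start half-edge.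

  Orientation: if \<open>v\<close> splits into \<open>v1 \<ni> q\<close> and \<open>v2 \<ni> p\<close>, then
  \<open>v \<and> x\<close> becomes \<open>v1 \<and> q \<and> v2 \<and> p \<and> x\<close>. Since \<open>v1 \<and> q \<and> v2 \<and> p = v2 \<and> q \<and> p \<and> v1\<close>, this is
  the same as replacing \<open>v\<close> by \<open>v1\<close> wherever it stands and putting \<open>v2 \<and> q \<and> p\<close> in front. The
  rule is symmetric under exchanging \<open>(v1, q)\<close> and \<open>(v2, p)\<close>.
\<close>

definition blow_up :: "nat \<Rightarrow> nat \<Rightarrow> bw_graph \<times> orient \<Rightarrow> bw_graph \<times> orient" where
  "blow_up a b = (\<lambda>(G, \<omega>).
     let p = Suc (Max (halves G)); q = Suc p;
         v = orbit (nxt G) a; v1 = insert q (v - arc G a b); v2 = insert p (arc G a b)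
     in (\<lparr>halves = insert p (insert q (halves G)),
          nxt = (\<lambda>h. if h = p then a else if h = b then p
                     else if h = q then (if nxt G b = a then q else nxt G b)
                     else if nxt G h = a then q else nxt G h),
          opp = (opp G)(p := q, q := p),
          start = (if start G \<in> arc G a b then q else start G),
          labelled = labelled G\<rparr>,
         Inl v2 # Inr q # Inr p # map (\<lambda>z. if z = Inl v then Inl v1 else z) \<omega>))"

text \<open>
  An unlabelled leaf stands for the unit of the algebra. A blow-up of the white vertex that puts it at
  a black vertex of valence 3 is read as multiplication by the unit: leaf and black vertex
  are erased and the third half-edge \<open>h\<close> becomes the start half-edge. At a black vertex of higher
  valence it gives zero.
\<close>

definition unit_leaf :: "bw_graph \<Rightarrow> bool" where
  "unit_leaf G \<longleftrightarrow> opp G (start G) = start G \<and> start G \<notin> set (labelled G)"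

definition drop_unit :: "nat \<Rightarrow> bw_graph \<times> orient \<Rightarrow> bw_graph \<times> orient" where
  "drop_unit h = (\<lambda>(G, \<omega>).
     let s = start G
     in (G\<lparr>halves := halves G - {s},
           nxt := (\<lambda>x. if x = s then s else if nxt G x = s then nxt G s else nxt G x),
           start := h\<rparr>,
         map (\<lambda>z. if z = Inl (white G) then Inl (white G - {s}) else z) (removeAll (Inr s) \<omega>)))"

text \<open>
  Sign of the unit terms: blowing up \<open>w \<and> s \<and> h \<and> x\<close>, where \<open>w\<close> is the white vertex and \<open>s\<close> the
  unlabelled leaf, gives \<open>w' \<and> q \<and> (v \<and> p) \<and> s \<and> h \<and> x\<close>, and erasing the black vertex \<open>v\<close> in its
  cyclic orientation, \<open>v \<and> p \<and> s \<and> h\<close> or \<open>v \<and> p \<and> h \<and> s\<close>, leaves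
  \<open>w' \<and> h \<and> x\<close> with sign \<open>+\<close> or \<open>-\<close> (with \<open>q\<close> renamed to \<open>h\<close>). With \<open>s\<close> at index \<open>j\<close>,
  erasing it from an orientation after moving it right behind \<open>w\<close> costs \<open>(-1) ^ (j + 1)\<close>.
\<close>

definition white_term :: "nat \<Rightarrow> nat \<Rightarrow> bw_graph \<times> orient \<Rightarrow> (bw_graph \<times> orient) \<Rightarrow>\<^sub>0 int" where
  "white_term a b = (\<lambda>(G, \<omega>).
     let s = start G; j = length (takeWhile (\<lambda>z. z \<noteq> Inr s) \<omega>)
     in if unit_leaf G \<and> s \<in> arc G a b then
          (if a = s \<and> b = nxt G s then frag_cmul (- ((-1) ^ j)) (frag_of (drop_unit b (G, \<omega>)))
           else if b = s \<and> nxt G a = s then frag_cmul ((-1) ^ j) (frag_of (drop_unit a (G, \<omega>)))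
           else 0)
        else frag_of (blow_up a b (G, \<omega>)))"

definition white_splits :: "bw_graph \<Rightarrow> (nat \<times> nat) set" where
  "white_splits G = {(a, b). a \<in> white G \<and> b \<in> white G \<and> a \<noteq> b}"

text \<open>
  The two complementary arcs of a black vertex define isomorphic oriented blow-ups; only the arc
  that does not contain the least half-edge of the vertex is listed.
\<close>

definition black_splits :: "bw_graph \<Rightarrow> (nat \<times> nat) set" where
  "black_splits G = {(a, b). \<exists>v\<in>blacks G. a \<in> v \<and> b \<in> v \<and>
     2 \<le> card (arc G a b) \<and> 2 \<le> card (v - arc G a b) \<and> Min v \<notin> arc G a b}"

definition graph_bd :: "bw_graph \<times> orient \<Rightarrow> (bw_graph \<times> orient) \<Rightarrow>\<^sub>0 int" where
  "graph_bd X = (\<Sum>(a, b)\<in>white_splits (fst X). white_term a b X) +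
                (\<Sum>(a, b)\<in>black_splits (fst X). frag_of (blow_up a b X))"


section \<open>Sullivan diagrams\<close>

definition oriented_graphs :: "nat \<Rightarrow> nat \<Rightarrow> (bw_graph \<times> orient) set" where
  "oriented_graphs n d = {(G, \<omega>). sullivan_graph n G \<and> degree G = d \<and> orientation G \<omega>}"

definition high_valence :: "bw_graph \<Rightarrow> bool" where
  "high_valence G \<longleftrightarrow> (\<exists>v\<in>blacks G. 4 \<le> card v)"

text \<open>
  The relations: reordering an orientation, isomorphism of graphs, vanishing of the graphs with a
  black vertex of valence at least 4 and of their boundaries. (Every isomorphism between graphs on
  finite sets of natural numbers extends to a bijection of the natural numbers.)
\<close>

definition SD_relations :: "nat \<Rightarrow> nat \<Rightarrow> ((bw_graph \<times> orient) \<Rightarrow>\<^sub>0 int) set" where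
  "SD_relations n d = frag_span
     ({frag_of (G, map \<pi> \<omega>) - frag_cmul (sign \<pi>) (frag_of (G, \<omega>)) | G \<omega> \<pi>.
         (G, \<omega>) \<in> oriented_graphs n d \<and> \<pi> permutes set \<omega>} \<union>
      {frag_of (relabel \<phi> X) - frag_of X | \<phi> X. X \<in> oriented_graphs n d \<and> bij \<phi>} \<union>
      {frag_of X | X. X \<in> oriented_graphs n d \<and> high_valence (fst X)} \<union>
      {graph_bd X | X. X \<in> oriented_graphs n (d + 1) \<and> high_valence (fst X)})"

text \<open>\<open>SD n d\<close> is the degree \<open>d\<close> part of the complex of Sullivan diagrams for \<open>((n, 0), (1, 0))\<close>.\<close>

definition SD :: "nat \<Rightarrow> nat \<Rightarrow> ((bw_graph \<times> orient) \<Rightarrow>\<^sub>0 int) set monoid" where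
  "SD n d = free_Abelian_group (oriented_graphs n d) Mod SD_relations n d"

definition SD_class :: "nat \<Rightarrow> nat \<Rightarrow> bw_graph \<times> orient \<Rightarrow> ((bw_graph \<times> orient) \<Rightarrow>\<^sub>0 int) set" where
  "SD_class n d X = SD_relations n d #>\<^bsub>free_Abelian_group (oriented_graphs n d)\<^esub> frag_of X"


subsection \<open>The action on Hochschild chains\<close>

text \<open>
  Cutting around the white vertex leaves a fat graph with the labelled leaves as inputs and the
  half-edges of the white vertex as outputs. A trivalent such graph represents a cobordism type, which
  acts on a symmetric Frobenius algebra by composing structure maps: every black vertex is the cyclic
  trilinear form \<open>a \<otimes> b \<otimes> c \<mapsto> \<epsilon>(abc)\<close>, every edge is the copairing \<open>\<nabla>(1)\<close>, an input at the white
  vertex is an identity, and an unlabelled leaf is the unit. In the basis, this composite is a sum over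
  all colourings of the half-edges by basis elements.
\<close>

definition tri_form :: "('b, 'm) frob_scheme \<Rightarrow> 'b \<Rightarrow> 'b \<Rightarrow> 'b \<Rightarrow> int" where
  "tri_form P a b c = counit_ext P (frag_extend (\<lambda>d. fmul P d c) (fmul P a b))"

definition copairing :: "('b, 'm) frob_scheme \<Rightarrow> 'b \<Rightarrow> 'b \<Rightarrow> int" where
  "copairing P a b = Poly_Mapping.lookup (frag_extend (fcomul P) (funit P)) (a, b)"

definition edges :: "bw_graph \<Rightarrow> nat set set" where
  "edges G = {{h, opp G h} | h. h \<in> halves G \<and> opp G h \<noteq> h}"

definition weight :: "('b, 'm) frob_scheme \<Rightarrow> bw_graph \<Rightarrow> 'b list \<Rightarrow> (nat \<Rightarrow> 'b) \<Rightarrow> int" where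
  "weight P G b \<kappa> =
     (\<Prod>v\<in>blacks G. tri_form P (\<kappa> (Min v)) (\<kappa> (nxt G (Min v))) (\<kappa> (nxt G (nxt G (Min v))))) *
     (\<Prod>e\<in>edges G. copairing P (\<kappa> (Min e)) (\<kappa> (Max e))) *
     (\<Prod>i<length (labelled G). if \<kappa> (labelled G ! i) = b ! i then 1 else 0) *
     (if unit_leaf G then Poly_Mapping.lookup (funit P) (\<kappa> (start G)) else 1)"

definition cut_morphism :: "('b::finite, 'm) frob_scheme \<Rightarrow> bw_graph \<Rightarrow> 'b list \<Rightarrow> 'b list \<Rightarrow>\<^sub>0 int" where
  "cut_morphism P G b =
     (\<Sum>\<kappa>\<in>halves G \<rightarrow>\<^sub>E UNIV. frag_cmul (weight P G b \<kappa>) (frag_of (map \<kappa> (white_list G))))"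

text \<open>
  A graph with trivalent black vertices has a canonical orientation: the wedge product of
  \<open>v \<and> h1 \<and> h2 \<and> h3\<close> over the black vertices, with \<open>h1, h2, h3\<close> in cyclic order, followed by
  \<open>w \<and> h1 \<and> \<dots> \<and> hk\<close> for the white vertex, with \<open>h1\<close> its start half-edge. The black factors are even
  and invariant under rotation, so their order and first half-edges do not matter.
\<close>

definition canonical_orientation :: "bw_graph \<Rightarrow> orient" where
  "canonical_orientation G =
     concat (map (\<lambda>h. [Inl (orbit (nxt G) h), Inr h, Inr (nxt G h), Inr (nxt G (nxt G h))])
       (sorted_list_of_set (Min ` blacks G))) @
     Inl (white G) # map Inr (white_list G)"

definition reorder_sign :: "'a list \<Rightarrow> 'a list \<Rightarrow> int" where
  "reorder_sign xs ys = sign (THE \<pi>. \<pi> permutes set xs \<and> map \<pi> xs = ys)"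

text \<open>
  The action restricted to Hochschild chains of degree 0 in all inputs. Graphs with a black vertex of
  valence at least 4 have positive degree away from the white vertex, so they act by zero.
\<close>

definition graph_act :: "('b::finite, 'm) frob_scheme \<Rightarrow> bw_graph \<times> orient \<Rightarrow> 'b list \<Rightarrow> 'b list \<Rightarrow>\<^sub>0 int" where
  "graph_act P = (\<lambda>(G, \<omega>) b.
     if high_valence G then 0
     else frag_cmul (reorder_sign (canonical_orientation G) \<omega>) (cut_morphism P G b))"

definition SD_act :: "('b::finite, 'm) frob_scheme \<Rightarrow> ((bw_graph \<times> orient) \<Rightarrow>\<^sub>0 int) \<Rightarrow>
    ('b list \<Rightarrow>\<^sub>0 int) \<Rightarrow> 'b list \<Rightarrow>\<^sub>0 int" where
  "SD_act P c a = frag_extend (\<lambda>X. frag_extend (graph_act P X) a) c"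

text \<open>
  The element \<open>z\<close> of \<open>SD n d\<close> induces \<open>\<Phi>\<close> on Hochschild homology. The action may be computed on any
  representative \<open>c\<close> of \<open>z\<close> and on any chains representing the Hochschild classes. As \<open>\<Phi>\<close> takes
  values in \<open>HH P d\<close>, the results are Hochschild cycles.
\<close>

definition induces :: "('b::finite, 'm) frob_scheme \<Rightarrow> nat \<Rightarrow> nat \<Rightarrow> ((bw_graph \<times> orient) \<Rightarrow>\<^sub>0 int) set \<Rightarrow>
    ((('b list \<Rightarrow>\<^sub>0 int) set set list \<Rightarrow>\<^sub>0 int) set \<Rightarrow> ('b list \<Rightarrow>\<^sub>0 int) set set) \<Rightarrow> bool" where
  "induces P n d z \<Phi> \<longleftrightarrow>
     z \<in> carrier (SD n d) \<and>
     \<Phi> \<in> hom (tensor_power (HH P 0) n) (HH P d) \<and>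
     (\<forall>c\<in>z. \<forall>as. length as = n \<and> set as \<subseteq> carrier (words 1) \<longrightarrow>
        \<Phi> (pure_tensor (HH P 0) (map (HH_class P 0) as)) = HH_class P d (SD_act P c (tensor as)))"


section \<open>The diagrams \<open>\<mu>\<close>\<close>

text \<open>
  A planar trivalent tree with at least two legs, rooted at one of them, is a planar binary tree whose
  leaves are the other legs.
\<close>

datatype ptree = Leg | Fork ptree ptree

fun legs :: "ptree \<Rightarrow> nat" where
  "legs Leg = 1"
| "legs (Fork l r) = legs l + legs r"

text \<open>
  \<open>tree_edges t h m f\<close> and \<open>tree_vertices t f\<close> plant \<open>t\<close> with root at the half-edge \<open>h\<close> and legs at the
  half-edges \<open>m, m + 2, m + 4, \<dots>\<close>, using \<open>f, f + 1, \<dots>\<close> as half-edges of the black vertices. The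
  cyclic ordering is root, right subtree, left subtree, because the tree lies outside the disc
  of the white vertex, whose half-edges are met from left to right.
\<close>

fun tree_edges :: "ptree \<Rightarrow> nat \<Rightarrow> nat \<Rightarrow> nat \<Rightarrow> (nat \<times> nat) list" where
  "tree_edges Leg h m f = [(h, m)]"
| "tree_edges (Fork l r) h m f =
     (h, f) # tree_edges l (f + 2) m (f + 3) @
              tree_edges r (f + 1) (m + 2 * legs l) (f + 3 * legs l)"

fun tree_vertices :: "ptree \<Rightarrow> nat \<Rightarrow> nat list list" where
  "tree_vertices Leg f = []"
| "tree_vertices (Fork l r) f =
     [f, f + 1, f + 2] # tree_vertices l (f + 3) @ tree_vertices r (f + 3 * legs l)"

text \<open>With \<open>g = legs t\<close>, the half-edge \<open>h\<^sub>j\<close> of the white vertex is \<open>j - 1\<close> for \<open>1 \<le> j \<le> 2 * g + 2\<close>.\<close>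

definition mu_graph :: "ptree \<Rightarrow> bw_graph" where
  "mu_graph t = (let k = 2 * legs t + 2 in
     \<lparr>halves = {..<k + 3 * (legs t - 1)},
      nxt = foldr (\<circ>) (map cycle_of_list ([0..<k] # tree_vertices t k)) id,
      opp = foldr (\<circ>) (map (\<lambda>(x, y). transpose x y) (tree_edges t 0 2 k)) id,
      start = 0,
      labelled = map (\<lambda>i. 2 * i + 1) [0..<legs t + 1]\<rparr>)"


section \<open>The algebra of dual numbers\<close>

text \<open>\<open>B1\<close> and \<open>Bx\<close> are the basis \<open>1, x\<close> of \<open>\<int>[x]/(x\<^sup>2)\<close>.\<close>

datatype dual_basis = B1 | Bx

instance dual_basis :: finite
proof
  have "(UNIV :: dual_basis set) \<subseteq> {B1, Bx}"
    using dual_basis.exhaust by blast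
  then show "finite (UNIV :: dual_basis set)"
    by (rule finite_subset) simp
qed

fun dual_mul :: "dual_basis \<Rightarrow> dual_basis \<Rightarrow> dual_basis \<Rightarrow>\<^sub>0 int" where
  "dual_mul B1 b = frag_of b"
| "dual_mul Bx B1 = frag_of Bx"
| "dual_mul Bx Bx = 0"

fun dual_comul :: "dual_basis \<Rightarrow> (dual_basis \<times> dual_basis) \<Rightarrow>\<^sub>0 int" where
  "dual_comul B1 = frag_of (B1, Bx) + frag_of (Bx, B1)"
| "dual_comul Bx = frag_of (Bx, Bx)"

fun dual_counit :: "dual_basis \<Rightarrow> int" where
  "dual_counit B1 = 0"
| "dual_counit Bx = 1"

definition dual_numbers :: "dual_basis frob" where
  "dual_numbers = \<lparr>fmul = dual_mul, funit = frag_of B1, fcomul = dual_comul, fcounit = dual_counit\<rparr>"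

lemma dual_basis_all: "(\<forall>a. Q a) \<longleftrightarrow> Q B1 \<and> Q Bx"
  by (metis dual_basis.exhaust)

lemma symmetric_frobenius_dual_numbers: "symmetric_frobenius dual_numbers"
  unfolding symmetric_frobenius_def dual_numbers_def dual_basis_all
  by (simp add: frag_extend_add counit_ext_def add.commute)

end

theory Submission
  imports Defs
begin

text \<open>
  In the basis \<open>1, x\<close> the structure constants of the dual numbers are 0 or 1. The trilinear form
  \<open>\<epsilon>(abc)\<close> is 1 if exactly one of \<open>a, b, c\<close> is \<open>x\<close> and 0 otherwise, and the copairing is
  \<open>1 \<otimes> x + x \<otimes> 1\<close>. So a graph with trivalent black vertices acts by counting colourings of its
  half-edges in which every black vertex and every edge carries exactly one \<open>x\<close>
  (\<open>cut_morphism_dual_numbers\<close>). This condition depends only on the sets of half-edges that form the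
  vertices and edges, which makes the invariance of the action under isomorphism visible.

  The map on homology exists because the relations of the complex of Sullivan diagrams act by zero
  already on the chain level (\<open>SD_relations_act\<close>), so that the chain obtained does not depend on the
  representative. Reorderings and isomorphisms are a matter of comparing signs. The relation that uses
  the Frobenius structure is the boundary of a graph with a black vertex of valence at least 4. A blow-up acts by zero as long as such a vertex survives. All of them
  disappear only if the graph has exactly one, of valence 4, and the blow-up splits it into two
  trivalent ones. There are two ways of doing this. In both the four outer half-edges must carry
  exactly one \<open>x\<close> (the Frobenius relation), so the two state sums agree, and the orientations
  differ by a cyclic permutation of the four half-edges, which is odd
  (\<open>graph_act_opposite_splits\<close>).

  In the reduced Hochschild complex of the dual numbers, degree \<open>n\<close> is spanned by
  \<open>1 \<otimes> x \<otimes> \<dots> \<otimes> x\<close> and \<open>x \<otimes> x \<otimes> \<dots> \<otimes> x\<close>. The differential kills the second and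
  sends the first to \<open>1 + (-1)^n\<close> times \<open>x \<otimes> \<dots> \<otimes> x\<close>. Hence for odd \<open>n\<close> every chain is a
  cycle, and the coefficient of \<open>1 \<otimes> x \<otimes> \<dots> \<otimes> x\<close> is an invariant of homology classes
  (\<open>HH_class_one_lookup\<close>). In degree 0, homology is the algebra itself.

  It remains to find this coefficient in the value of the diagram with \<open>g + 1\<close> inputs on
  \<open>x \<otimes> \<dots> \<otimes> x\<close>. The trivalent tree represents the iterated coproduct of 1, the sum of all
  words in which one letter is 1 and the others are \<open>x\<close>. The summand whose letter 1 sits at the start
  half-edge contributes \<open>1 \<otimes> x \<otimes> \<dots> \<otimes> x\<close>, and since the weights are nonnegative
  nothing cancels it (\<open>mu_state_sum_lookup\<close>).
\<close>

section \<open>Signs of reorderings\<close>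

lemma reorder_sign_eq:
  assumes "\<pi> permutes set xs" and "map \<pi> xs = ys"
  shows "reorder_sign xs ys = sign \<pi>"
proof -
  have "\<pi>' = \<pi>" if "\<pi>' permutes set xs \<and> map \<pi>' xs = ys" for \<pi>'
  proof
    fix x
    show "\<pi>' x = \<pi> x"
      using that assms by (cases "x \<in> set xs") (auto simp: permutes_def map_eq_conv)
  qed
  then have "(THE \<pi>. \<pi> permutes set xs \<and> map \<pi> xs = ys) = \<pi>"
    using assms by blast
  then show ?thesis
    by (simp add: reorder_sign_def)
qed

definition same_entries :: "'a list \<Rightarrow> 'a list \<Rightarrow> bool" where
  "same_entries xs ys \<longleftrightarrow> distinct xs \<and> distinct ys \<and> set xs = set ys"

text \<open>
  The permutation in the definition of \<open>reorder_sign\<close> exists for such lists. Together with the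
  uniqueness in \<open>reorder_sign_eq\<close> this makes \<open>reorder_sign\<close> a homomorphism from the groupoid of
  reorderings to the signs.
\<close>

lemma same_entries_obtain:
  assumes "same_entries xs ys"
  obtains \<pi> where "\<pi> permutes set xs" and "map \<pi> xs = ys"
proof -
  have dxs: "distinct xs" and dys: "distinct ys" and eq: "set xs = set ys"
    using assms by (auto simp: same_entries_def)
  have len: "length xs = length ys"
    using dxs dys eq distinct_card by metis
  define \<pi> where "\<pi> x = (if x \<in> set xs then the (map_of (zip xs ys) x) else x)" for x
  have map: "map \<pi> xs = ys"
    using len dxs by (intro nth_equalityI) (auto simp: \<pi>_def map_of_zip_nth)
  then have "\<pi> ` set xs = set xs"
    using eq by (metis list.set_map)
  then have "bij_betw \<pi> (set xs) (set xs)"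
    by (simp add: bij_betw_def eq_card_imp_inj_on)
  then have "\<pi> permutes set xs"
    by (rule bij_imp_permutes) (simp add: \<pi>_def)
  then show ?thesis
    using map that by blast
qed

lemma same_entries_refl: "distinct xs \<Longrightarrow> same_entries xs xs"
  by (simp add: same_entries_def)

lemma same_entries_sym: "same_entries xs ys \<Longrightarrow> same_entries ys xs"
  by (auto simp: same_entries_def)

lemma same_entries_trans: "same_entries xs ys \<Longrightarrow> same_entries ys zs \<Longrightarrow> same_entries xs zs"
  by (auto simp: same_entries_def)

lemma same_entries_map:
  "same_entries xs ys \<Longrightarrow> inj_on f (set xs) \<Longrightarrow> same_entries (map f xs) (map f ys)"
  by (auto simp: same_entries_def distinct_map)

lemma reorder_sign_refl: "reorder_sign xs xs = 1"
  by (simp add: reorder_sign_eq[where \<pi> = id] permutes_id)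

lemma reorder_sign_map_permutes:
  assumes "same_entries xs ys" and "\<pi> permutes set ys"
  shows "reorder_sign xs (map \<pi> ys) = sign \<pi> * reorder_sign xs ys"
proof -
  obtain \<rho> where \<rho>: "\<rho> permutes set xs" "map \<rho> xs = ys"
    using same_entries_obtain[OF assms(1)] .
  have "set xs = set ys"
    using assms(1) by (simp add: same_entries_def)
  then have "\<pi> \<circ> \<rho> permutes set xs" and "permutation \<pi>" and "permutation \<rho>"
    using assms(2) \<rho>(1) permutes_compose[of \<rho> "set xs" \<pi>] permutes_imp_permutation[OF finite_set]
    by auto
  moreover have "map (\<pi> \<circ> \<rho>) xs = map \<pi> ys"
    using \<rho>(2) by (metis map_map)
  ultimately show ?thesis
    using reorder_sign_eq[OF \<rho>] by (simp add: reorder_sign_eq[where \<pi> = "\<pi> \<circ> \<rho>"] sign_compose)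
qed

lemma reorder_sign_trans:
  assumes "same_entries xs ys" and "same_entries ys zs"
  shows "reorder_sign xs zs = reorder_sign xs ys * reorder_sign ys zs"
proof -
  obtain \<pi> where \<pi>: "\<pi> permutes set ys" "map \<pi> ys = zs"
    using same_entries_obtain[OF assms(2)] .
  then show ?thesis
    using reorder_sign_map_permutes[OF assms(1) \<pi>(1)] reorder_sign_eq[OF \<pi>] by simp
qed

lemma reorder_sign_square:
  assumes "same_entries xs ys"
  shows "reorder_sign xs ys * reorder_sign xs ys = 1"
proof -
  obtain \<pi> where \<pi>: "\<pi> permutes set xs" "map \<pi> xs = ys"
    using same_entries_obtain[OF assms] .
  then show ?thesis by (simp add: reorder_sign_eq)
qed

lemma reorder_sign_sym:
  assumes "same_entries xs ys"
  shows "reorder_sign ys xs = reorder_sign xs ys"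
proof -
  have "reorder_sign xs ys * (reorder_sign xs ys * reorder_sign ys xs) = reorder_sign xs ys"
    using reorder_sign_trans[OF assms same_entries_sym[OF assms]] by (simp add: reorder_sign_refl)
  then show ?thesis
    by (simp add: mult.assoc[symmetric] reorder_sign_square[OF assms])
qed

lemma reorder_sign_inj_map:
  assumes "same_entries xs ys" and f: "inj_on f (set xs)"
  shows "reorder_sign (map f xs) (map f ys) = reorder_sign xs ys"
proof -
  obtain \<pi> where \<pi>: "\<pi> permutes set xs" "map \<pi> xs = ys"
    using same_entries_obtain[OF assms(1)] .
  let ?\<rho> = "map_permutation (set xs) f \<pi>"
  have "?\<rho> permutes set (map f xs)"
    using f \<pi>(1) by (simp add: map_permutation_permutes bij_betw_def)
  moreover have "map ?\<rho> (map f xs) = map f ys"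
    using f by (auto simp: \<pi>(2)[symmetric] map_permutation_def restrict_id_def)
  ultimately have "reorder_sign (map f xs) (map f ys) = sign ?\<rho>"
    by (rule reorder_sign_eq)
  then show ?thesis
    using f \<pi> by (simp add: sign_map_permutation reorder_sign_eq)
qed

lemma reorder_sign_context:
  assumes "same_entries xs ys" and d: "distinct (as @ xs @ bs)"
  shows "reorder_sign (as @ xs @ bs) (as @ ys @ bs) = reorder_sign xs ys"
proof -
  obtain \<pi> where \<pi>: "\<pi> permutes set xs" "map \<pi> xs = ys"
    using same_entries_obtain[OF assms(1)] .
  have "\<pi> permutes set (as @ xs @ bs)"
    using \<pi>(1) by (rule permutes_subset) auto
  moreover have "map \<pi> as = as" "map \<pi> bs = bs"
    using d by (auto intro!: map_idI permutes_not_in[OF \<pi>(1)])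
  then have "map \<pi> (as @ xs @ bs) = as @ ys @ bs"
    by (simp add: \<pi>(2))
  ultimately show ?thesis
    using \<pi> by (simp add: reorder_sign_eq)
qed

lemma reorder_sign_swap:
  assumes "distinct (as @ x # y # bs)"
  shows "reorder_sign (as @ x # y # bs) (as @ y # x # bs) = - 1"
proof -
  have "map (transpose x y) (as @ x # y # bs) = as @ y # x # bs"
    using assms by (auto intro!: map_idI simp: transpose_def)
  moreover have "transpose x y permutes set (as @ x # y # bs)"
    by (rule permutes_swap_id) auto
  moreover have "x \<noteq> y"
    using assms by auto
  ultimately show ?thesis
    by (simp add: reorder_sign_eq sign_swap_id)
qed

lemma reorder_sign_move:
  assumes "distinct (as @ x # ys @ bs)"
  shows "reorder_sign (as @ x # ys @ bs) (as @ ys @ x # bs) = (- 1) ^ length ys"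
  using assms
proof (induction ys arbitrary: as)
  case Nil
  then show ?case by (simp add: reorder_sign_refl)
next
  case (Cons y ys)
  have "reorder_sign (as @ x # y # ys @ bs) (as @ y # ys @ x # bs) =
      reorder_sign (as @ x # y # ys @ bs) (as @ y # x # ys @ bs) *
      reorder_sign (as @ y # x # ys @ bs) (as @ y # ys @ x # bs)"
    using Cons.prems by (intro reorder_sign_trans) (auto simp: same_entries_def)
  also have "reorder_sign (as @ x # y # ys @ bs) (as @ y # x # ys @ bs) = - 1"
    using Cons.prems by (intro reorder_sign_swap) auto
  also have "reorder_sign (as @ y # x # ys @ bs) (as @ y # ys @ x # bs) = (- 1) ^ length ys"
    using Cons.IH[of "as @ [y]"] Cons.prems by auto
  finally show ?case by simp
qed

lemma reorder_sign_even_block: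
  assumes "distinct (as @ xs @ ys @ bs)" and "even (length ys)"
  shows "reorder_sign (as @ xs @ ys @ bs) (as @ ys @ xs @ bs) = 1"
  using assms(1)
proof (induction xs arbitrary: as bs rule: rev_induct)
  case Nil
  then show ?case by (simp add: reorder_sign_refl)
next
  case (snoc x xs)
  have "reorder_sign (as @ xs @ x # ys @ bs) (as @ ys @ xs @ x # bs) =
      reorder_sign (as @ xs @ x # ys @ bs) (as @ xs @ ys @ x # bs) *
      reorder_sign (as @ xs @ ys @ x # bs) (as @ ys @ xs @ x # bs)"
    using snoc.prems by (intro reorder_sign_trans) (auto simp: same_entries_def)
  also have "reorder_sign (as @ xs @ x # ys @ bs) (as @ xs @ ys @ x # bs) = 1"
    using reorder_sign_move[of "as @ xs" x ys bs] snoc.prems assms(2) by auto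
  also have "reorder_sign (as @ xs @ ys @ x # bs) (as @ ys @ xs @ x # bs) = 1"
    using snoc.IH[of as "x # bs"] snoc.prems by auto
  finally show ?case by simp
qed

text \<open>
  Moving a block past a block of even length takes an even number of transpositions. This is why the
  order of the black vertices in a canonical orientation does not matter.
\<close>

lemma reorder_sign_concat_mset:
  assumes "distinct (as @ concat bs @ cs)" and "mset bs' = mset bs" and "\<forall>b\<in>set bs. even (length b)"
  shows "reorder_sign (as @ concat bs @ cs) (as @ concat bs' @ cs) = 1"
  using assms
proof (induction bs arbitrary: as bs')
  case Nil
  then show ?case by (simp add: reorder_sign_refl)
next
  case (Cons b bs)
  have "b \<in> set bs'"
    using Cons.prems(2) by (metis list.set_intros(1) set_mset_mset)
  then obtain us vs where bs': "bs' = us @ b # vs"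
    by (meson split_list)
  then have mset: "mset (us @ vs) = mset bs"
    using Cons.prems(2) by simp
  have sets: "set (concat us) \<union> set (concat vs) = set (concat bs)"
    using mset by (metis concat_append mset_eq_setD set_append set_concat)
  have "mset (concat (us @ vs)) = mset (concat bs)"
    using mset by (metis mset_concat mset_map sum_mset_sum_list)
  then have dist: "distinct (as @ b @ concat us @ concat vs @ cs)"
    using Cons.prems(1) mset_eq_imp_distinct_iff[of "as @ b @ concat (us @ vs) @ cs" "as @ b @ concat bs @ cs"]
    by simp
  have "reorder_sign (as @ b @ concat bs @ cs) (as @ concat us @ b @ concat vs @ cs) =
      reorder_sign (as @ b @ concat bs @ cs) (as @ b @ concat us @ concat vs @ cs) *
      reorder_sign (as @ b @ concat us @ concat vs @ cs) (as @ concat us @ b @ concat vs @ cs)"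
    using Cons.prems(1) dist sets by (intro reorder_sign_trans) (auto simp: same_entries_def)
  also have "reorder_sign (as @ b @ concat bs @ cs) (as @ b @ concat us @ concat vs @ cs) = 1"
    using Cons.IH[of "as @ b" "us @ vs"] Cons.prems mset by auto
  also have "\<forall>b\<in>set us. even (length b)"
    using Cons.prems(3) mset_eq_setD[OF mset] by auto
  then have "even (length (concat us))"
    by (induction us) auto
  then have "reorder_sign (as @ b @ concat us @ concat vs @ cs) (as @ concat us @ b @ concat vs @ cs) = 1"
    using reorder_sign_even_block[of as b "concat us" "concat vs @ cs"] dist by auto
  finally show ?case
    by (simp add: bs')
qed

text \<open>
  The signs of reorderings inside the blocks multiply; only the case of even ones is needed, for
  the choice of a first half-edge at each black vertex.
\<close>

lemma reorder_sign_concat_map: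
  assumes "distinct (as @ concat (map f hs) @ cs)"
    and "\<And>h. h \<in> set hs \<Longrightarrow> same_entries (f h) (f' h) \<and> reorder_sign (f h) (f' h) = 1"
  shows "same_entries (as @ concat (map f hs) @ cs) (as @ concat (map f' hs) @ cs) \<and>
    reorder_sign (as @ concat (map f hs) @ cs) (as @ concat (map f' hs) @ cs) = 1"
  using assms
proof (induction hs arbitrary: as)
  case Nil
  then show ?case by (simp add: reorder_sign_refl same_entries_refl)
next
  case (Cons h hs)
  have h: "same_entries (f h) (f' h)" "reorder_sign (f h) (f' h) = 1"
    using Cons.prems(2) by auto
  let ?X = "as @ f h @ concat (map f hs) @ cs" and ?Y = "as @ f' h @ concat (map f hs) @ cs"
  have XY: "same_entries ?X ?Y"
    using h(1) Cons.prems(1) by (auto simp: same_entries_def)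
  then have "same_entries ?Y (as @ f' h @ concat (map f' hs) @ cs) \<and>
     reorder_sign ?Y (as @ f' h @ concat (map f' hs) @ cs) = 1"
    using Cons.IH[of "as @ f' h"] Cons.prems by (auto simp: same_entries_def)
  moreover have "reorder_sign ?X ?Y = 1"
    using reorder_sign_context[OF h(1)] h(2) Cons.prems(1) by auto
  ultimately show ?case
    using XY same_entries_trans[OF XY] reorder_sign_trans[OF XY] by auto
qed

section \<open>Canonical orientations\<close>

text \<open>
  The part of the definition of a Sullivan graph that the action depends on and that is preserved by
  relabellings and by blow-ups.
\<close>

definition ribbon_graph :: "bw_graph \<Rightarrow> bool" where
  "ribbon_graph G \<longleftrightarrow> finite (halves G) \<and> nxt G permutes halves G \<and> opp G permutes halves G \<and>
     opp G \<circ> opp G = id \<and> start G \<in> halves G \<and> set (labelled G) \<subseteq> halves G"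

definition trivalent :: "bw_graph \<Rightarrow> bool" where
  "trivalent G \<longleftrightarrow> (\<forall>v\<in>blacks G. card v = 3)"

lemma orbit_list:
  assumes "permutation f"
  shows "distinct (map (\<lambda>i. (f ^^ i) x) [0..<card (orbit f x)])"
    and "set (map (\<lambda>i. (f ^^ i) x) [0..<card (orbit f x)]) = orbit f x"
    and "(f ^^ card (orbit f x)) x = x"
proof -
  have x: "x \<in> orbit f x"
    using assms by (rule permutation_self_in_orbit)
  let ?m = "funpow_dist1 f x x"
  have inj: "inj_on (\<lambda>n. (f ^^ n) x) {0..<?m}"
    using x by (rule inj_on_funpow_dist1)
  moreover have orb: "orbit f x = (\<lambda>n. (f ^^ n) x) ` {0..<?m}"
    using x by (rule orbit_conv_funpow_dist1)
  ultimately have card: "card (orbit f x) = ?m"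
    by (simp add: card_image)
  show "distinct (map (\<lambda>i. (f ^^ i) x) [0..<card (orbit f x)])"
    unfolding card distinct_map set_upt using inj distinct_upt by blast
  show "set (map (\<lambda>i. (f ^^ i) x) [0..<card (orbit f x)]) = orbit f x"
    unfolding card set_map set_upt using orb by blast
  show "(f ^^ card (orbit f x)) x = x"
    unfolding card using x by (rule funpow_dist1_prop)
qed

lemma orbit_card3:
  assumes "permutation f" and "card (orbit f x) = 3"
  shows "orbit f x = {x, f x, f (f x)}" "distinct [x, f x, f (f x)]" "f (f (f x)) = x"
  using orbit_list[OF assms(1), of x]
  unfolding assms(2) by (simp_all add: numeral_eq_Suc insert_commute)

lemma orbit_card4:
  assumes "permutation f" and "card (orbit f x) = 4"
  shows "orbit f x = {x, f x, f (f x), f (f (f x))}"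
    and "distinct [x, f x, f (f x), f (f (f x))]" and "f (f (f (f x))) = x"
  using orbit_list[OF assms(1), of x]
  unfolding assms(2) by (simp_all add: numeral_eq_Suc insert_commute)

context
  fixes G :: bw_graph
  assumes ribbon: "ribbon_graph G"
begin

lemma permutation_nxt: "permutation (nxt G)"
  using ribbon permutes_imp_permutation by (auto simp: ribbon_graph_def)

lemma orbit_nxt_self: "h \<in> orbit (nxt G) h"
  by (simp add: permutation_nxt permutation_self_in_orbit)

lemma orbit_nxt_eq: "h \<in> orbit (nxt G) k \<Longrightarrow> orbit (nxt G) h = orbit (nxt G) k"
  by (rule orbit_cyclic_eq3[OF cyclic_on_orbit'[OF permutation_nxt]])

lemma vertices_orbit: "v \<in> vertices G \<Longrightarrow> h \<in> v \<Longrightarrow> v = orbit (nxt G) h"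
  by (auto simp: vertices_def orbit_nxt_eq)

lemma vertex_subset: "v \<in> vertices G \<Longrightarrow> v \<subseteq> halves G"
  using permutes_orbit_subset[of "nxt G" "halves G"] ribbon by (auto simp: vertices_def ribbon_graph_def)

lemma vertex_finite: "v \<in> vertices G \<Longrightarrow> finite v"
  using ribbon finite_subset[OF vertex_subset] by (simp add: ribbon_graph_def)

lemma finite_vertices: "finite (vertices G)"
  using ribbon by (auto simp: vertices_def ribbon_graph_def)

lemma finite_blacks: "finite (blacks G)"
  using finite_vertices by (simp add: blacks_def)

lemma black_vertex: "v \<in> blacks G \<Longrightarrow> v \<in> vertices G"
  by (simp add: blacks_def)

lemma vertex_nonempty: "v \<in> vertices G \<Longrightarrow> v \<noteq> {}"
  by (auto simp: vertices_def orbit_nonempty)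

lemma vertex_Min: "v \<in> vertices G \<Longrightarrow> Min v \<in> v"
  by (simp add: vertex_finite vertex_nonempty)

lemma vertices_disjoint: "u \<in> vertices G \<Longrightarrow> v \<in> vertices G \<Longrightarrow> u \<noteq> v \<Longrightarrow> u \<inter> v = {}"
  using vertices_orbit by blast

lemma white_vertex: "white G \<in> vertices G"
  using ribbon by (auto simp: white_def vertices_def ribbon_graph_def)

lemma start_white: "start G \<in> white G"
  by (simp add: white_def orbit_nxt_self)

lemma Union_vertices: "\<Union> (vertices G) = halves G"
  using vertex_subset orbit_nxt_self by (auto simp: vertices_def)

lemma white_list: "distinct (white_list G)" "set (white_list G) = white G"
  using orbit_list[OF permutation_nxt] by (simp_all add: white_list_def white_def)

lemma black3:
  assumes "v \<in> blacks G" "card v = 3" "h \<in> v"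
  shows "v = {h, nxt G h, nxt G (nxt G h)}" "distinct [h, nxt G h, nxt G (nxt G h)]"
    "nxt G (nxt G (nxt G h)) = h"
proof -
  have v: "orbit (nxt G) h = v"
    using vertices_orbit[OF black_vertex[OF assms(1)] assms(3)] by simp
  show "v = {h, nxt G h, nxt G (nxt G h)}" "distinct [h, nxt G h, nxt G (nxt G h)]"
    "nxt G (nxt G (nxt G h)) = h"
    using orbit_card3[OF permutation_nxt, of h] assms(2) unfolding v by blast+
qed

end

text \<open>
  The even block that a trivalent black vertex contributes to a canonical orientation when its
  half-edges are listed starting with \<open>h\<close>.
\<close>

definition corolla :: "bw_graph \<Rightarrow> nat \<Rightarrow> orient" where
  "corolla G h = [Inl (orbit (nxt G) h), Inr h, Inr (nxt G h), Inr (nxt G (nxt G h))]"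

definition white_corolla :: "bw_graph \<Rightarrow> orient" where
  "white_corolla G = Inl (white G) # map Inr (white_list G)"

lemma canonical_orientation_corollas:
  "canonical_orientation G =
     concat (map (corolla G) (sorted_list_of_set (Min ` blacks G))) @ white_corolla G"
  by (simp add: canonical_orientation_def corolla_def[abs_def] white_corolla_def)

lemma reorder_sign_rotate:
  assumes "distinct [v, a, b, c]"
  shows "reorder_sign [v, a, b, c] [v, b, c, a] = 1"
    and "reorder_sign [v, a, b, c] [v, c, a, b] = 1"
proof -
  show "reorder_sign [v, a, b, c] [v, b, c, a] = 1"
    using reorder_sign_even_block[of "[v]" "[a]" "[b, c]" "[]"] assms by simp
  have "reorder_sign [v, c, a, b] [v, a, b, c] = 1"
    using reorder_sign_even_block[of "[v]" "[c]" "[a, b]" "[]"] assms by auto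
  then show "reorder_sign [v, a, b, c] [v, c, a, b] = 1"
    using reorder_sign_sym[of "[v, c, a, b]" "[v, a, b, c]"] assms
    by (auto simp: same_entries_def)
qed

lemma corollas_orientation:
  assumes G: "ribbon_graph G" "trivalent G"
    and d: "distinct (map (orbit (nxt G)) hs)" and s: "orbit (nxt G) ` set hs = blacks G"
  shows "orientation G (concat (map (corolla G) hs) @ white_corolla G)"
proof -
  have sc: "set (corolla G h) = insert (Inl (orbit (nxt G) h)) (Inr ` orbit (nxt G) h)" (is ?A)
    and dc: "distinct (corolla G h)" (is ?B) if "h \<in> set hs" for h
  proof -
    have "orbit (nxt G) h \<in> blacks G"
      using s that by blast
    then have "card (orbit (nxt G) h) = 3"
      using G(2) by (simp add: trivalent_def)
    note o = orbit_card3[OF permutation_nxt[OF G(1)] this]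
    show ?A ?B
      using o(2) by (simp_all add: corolla_def o(1))
  qed
  have sw: "set (white_corolla G) = insert (Inl (white G)) (Inr ` white G)"
    using white_list[OF G(1)] by (simp add: white_corolla_def)
  have set: "set (concat (map (corolla G) hs)) = Inl ` blacks G \<union> Inr ` \<Union> (blacks G)"
    using sc by (fastforce simp: s[symmetric])
  have "distinct (concat (map (corolla G) hs))"
  proof (rule distinct_concat)
    have "inj_on (corolla G) (set hs)"
      using d by (auto simp: inj_on_def corolla_def distinct_map)
    then show "distinct (map (corolla G) hs)"
      using d by (simp add: distinct_map)
    show "distinct ys" if "ys \<in> set (map (corolla G) hs)" for ys
      using that dc by auto
    fix ys zs
    assume "ys \<in> set (map (corolla G) hs)" "zs \<in> set (map (corolla G) hs)" "ys \<noteq> zs"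
    then obtain h k where hk: "ys = corolla G h" "zs = corolla G k" "h \<in> set hs" "k \<in> set hs" "h \<noteq> k"
      by auto
    then have ne: "orbit (nxt G) h \<noteq> orbit (nxt G) k"
      using d by (auto simp: distinct_map inj_on_def)
    moreover have "orbit (nxt G) h \<in> vertices G" "orbit (nxt G) k \<in> vertices G"
      using s hk(3,4) by (auto simp: blacks_def)
    ultimately have "orbit (nxt G) h \<inter> orbit (nxt G) k = {}"
      by (rule vertices_disjoint[OF G(1), rotated 2])
    then show "set ys \<inter> set zs = {}"
      using ne by (auto simp: hk sc)
  qed
  moreover have "distinct (white_corolla G)"
    using white_list[OF G(1)] by (auto simp: white_corolla_def distinct_map)
  moreover have "\<Union> (blacks G) \<inter> white G = {}"
    using vertices_disjoint[OF G(1) _ white_vertex[OF G(1)]] by (auto simp: blacks_def)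
  then have "set (concat (map (corolla G) hs)) \<inter> set (white_corolla G) = {}"
    unfolding set sw by (auto simp: blacks_def)
  moreover have "vertices G = insert (white G) (blacks G)"
    using white_vertex[OF G(1)] by (auto simp: blacks_def)
  then have "set (concat (map (corolla G) hs)) \<union> set (white_corolla G) =
      Inl ` vertices G \<union> Inr ` halves G"
    unfolding set sw Union_vertices[OF G(1), symmetric] by auto
  ultimately show ?thesis
    by (simp add: orientation_def)
qed

lemma Min_blacks:
  assumes "ribbon_graph G"
  shows "distinct (map (orbit (nxt G)) (sorted_list_of_set (Min ` blacks G)))"
    and "orbit (nxt G) ` set (sorted_list_of_set (Min ` blacks G)) = blacks G"
proof -
  have M: "orbit (nxt G) (Min v) = v" if "v \<in> blacks G" for v
    using vertices_orbit[OF assms _ vertex_Min[OF assms]] that by (simp add: blacks_def)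
  then show "orbit (nxt G) ` set (sorted_list_of_set (Min ` blacks G)) = blacks G"
    using finite_blacks[OF assms] by (auto simp: image_image)
  show "distinct (map (orbit (nxt G)) (sorted_list_of_set (Min ` blacks G)))"
    using M finite_blacks[OF assms] by (auto simp: distinct_map inj_on_def)
qed

lemma orientation_canonical:
  "ribbon_graph G \<Longrightarrow> trivalent G \<Longrightarrow> orientation G (canonical_orientation G)"
  unfolding canonical_orientation_corollas by (intro corollas_orientation Min_blacks)

lemma orientation_same_entries: "orientation G \<omega> \<Longrightarrow> orientation G \<omega>' \<Longrightarrow> same_entries \<omega> \<omega>'"
  by (simp add: orientation_def same_entries_def)

text \<open>
  The canonical orientation lists the black vertices by their least half-edges, which neither
  relabellings nor blow-ups respect. Up to even reorderings any other list of representatives will do: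
  rotating three half-edges is even, and so is permuting blocks of length 4.
\<close>

lemma reorder_sign_corollas:
  assumes G: "ribbon_graph G" "trivalent G"
    and d: "distinct (map (orbit (nxt G)) hs)" and s: "orbit (nxt G) ` set hs = blacks G"
  shows "reorder_sign (canonical_orientation G) (concat (map (corolla G) hs) @ white_corolla G) = 1"
proof -
  let ?ms = "sorted_list_of_set (Min ` blacks G)" and ?m = "\<lambda>h. Min (orbit (nxt G) h)"
  let ?X = "concat (map (corolla G) hs) @ white_corolla G"
  \<comment> \<open>the corollas in the order of the given representatives, but starting at the least half-edges\<close>
  let ?Y = "concat (map (corolla G \<circ> ?m) hs) @ white_corolla G"
  have X: "orientation G ?X"
    using assms by (rule corollas_orientation)
  have XY: "same_entries ?X ?Y \<and> reorder_sign ?X ?Y = 1"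
  proof (rule reorder_sign_concat_map[where as = "[]", simplified append_Nil])
    show "distinct ?X"
      using X by (simp add: orientation_def)
    fix h assume "h \<in> set hs"
    then have b: "orbit (nxt G) h \<in> blacks G"
      using s by auto
    then have c: "card (orbit (nxt G) h) = 3"
      using G(2) by (simp add: trivalent_def)
    note o = orbit_card3[OF permutation_nxt[OF G(1)] c]
    have m: "?m h \<in> orbit (nxt G) h"
      using b vertex_Min[OF G(1)] by (simp add: blacks_def)
    then have "orbit (nxt G) (?m h) = orbit (nxt G) h"
      by (rule orbit_nxt_eq[OF G(1)])
    moreover have "?m h = h \<or> ?m h = nxt G h \<or> ?m h = nxt G (nxt G h)"
      using m o(1) by auto
    ultimately show "same_entries (corolla G h) ((corolla G \<circ> ?m) h) \<and>
        reorder_sign (corolla G h) ((corolla G \<circ> ?m) h) = 1"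
      using o(2,3) reorder_sign_rotate[of "Inl (orbit (nxt G) h)" "Inr h" "Inr (nxt G h)" "Inr (nxt G (nxt G h))"]
      by (auto simp: corolla_def same_entries_def reorder_sign_refl)
  qed
  have "distinct (map ?m hs)"
    using d vertices_disjoint[OF G(1)] vertex_Min[OF G(1)] s
    by (simp add: distinct_map inj_on_def) (metis blacks_def DiffD1 disjoint_iff image_eqI)
  moreover have "set (map ?m hs) = set ?ms"
    using finite_blacks[OF G(1)] by (simp add: s[symmetric] image_image)
  ultimately have "mset (map ?m hs) = mset ?ms"
    using set_eq_iff_mset_eq_distinct[of "map ?m hs" ?ms] by simp
  then have "mset (map (corolla G \<circ> ?m) hs) = mset (map (corolla G) ?ms)"
    by (metis map_map mset_map)
  moreover have C: "orientation G (canonical_orientation G)"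
    using G by (rule orientation_canonical)
  ultimately have "reorder_sign (canonical_orientation G) ?Y = 1"
    using reorder_sign_concat_mset[of "[]" "map (corolla G) ?ms" "white_corolla G" "map (corolla G \<circ> ?m) hs"]
    by (simp add: canonical_orientation_corollas orientation_def corolla_def)
  then show ?thesis
    using XY reorder_sign_trans[OF orientation_same_entries[OF C X], of ?Y] by simp
qed

section \<open>Colourings\<close>

text \<open>
  The colourings of weight 1: each trilinear form \<open>\<epsilon>(abc)\<close> and each copairing of the dual numbers
  is 1 if exactly one of its arguments is \<open>x\<close>, and 0 otherwise.
\<close>

definition admissible :: "bw_graph \<Rightarrow> dual_basis list \<Rightarrow> (nat \<Rightarrow> dual_basis) \<Rightarrow> bool" where
  "admissible G b \<kappa> \<longleftrightarrow>
     (\<forall>v\<in>blacks G \<union> edges G. card {h \<in> v. \<kappa> h = Bx} = 1) \<and>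
     (\<forall>i<length (labelled G). \<kappa> (labelled G ! i) = b ! i) \<and>
     (unit_leaf G \<longrightarrow> \<kappa> (start G) = B1)"

definition state_sum :: "bw_graph \<Rightarrow> dual_basis list \<Rightarrow> dual_basis list \<Rightarrow>\<^sub>0 int" where
  "state_sum G b = (\<Sum>\<kappa> | \<kappa> \<in> halves G \<rightarrow>\<^sub>E UNIV \<and> admissible G b \<kappa>. frag_of (map \<kappa> (white_list G)))"

lemma counit_ext_frag_of [simp]: "counit_ext P (frag_of b) = fcounit P b"
  by (simp add: counit_ext_def)

lemma counit_ext_0 [simp]: "counit_ext P 0 = 0"
  by (simp add: counit_ext_def)

lemma card_Bx: "finite S \<Longrightarrow> card {h \<in> S. \<kappa> h = Bx} = (\<Sum>h\<in>S. of_bool (\<kappa> h = Bx))"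
  using sum.inter_filter[of S "\<lambda>_. 1 :: nat" "\<lambda>h. \<kappa> h = Bx"] by (simp only: card_eq_sum of_bool_def)

lemma card_Bx_2:
  assumes "v = {h, k}" and "distinct [h, k]"
  shows "card {i \<in> v. \<kappa> i = Bx} = of_bool (\<kappa> h = Bx) + of_bool (\<kappa> k = Bx)"
proof -
  have "finite v" by (simp add: assms(1))
  then show ?thesis
    unfolding card_Bx[OF \<open>finite v\<close>] using assms(2) by (simp add: assms(1))
qed

lemma card_Bx_3:
  assumes "v = {h, k, l}" and "distinct [h, k, l]"
  shows "card {i \<in> v. \<kappa> i = Bx} = of_bool (\<kappa> h = Bx) + of_bool (\<kappa> k = Bx) + of_bool (\<kappa> l = Bx)"
proof -
  have "finite v" by (simp add: assms(1))
  then show ?thesis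
    unfolding card_Bx[OF \<open>finite v\<close>] using assms(2) by (simp add: assms(1))
qed

lemma tri_form_dual_numbers:
  "tri_form dual_numbers a b c = of_bool (of_bool (a = Bx) + of_bool (b = Bx) + of_bool (c = Bx) = (1::nat))"
  by (cases a; cases b; cases c) (simp_all add: tri_form_def dual_numbers_def)

lemma copairing_dual_numbers:
  "copairing dual_numbers a b = of_bool (of_bool (a = Bx) + of_bool (b = Bx) = (1::nat))"
  by (cases a; cases b) (simp_all add: copairing_def dual_numbers_def lookup_add)

lemma prod_of_bool_int: "finite S \<Longrightarrow> (\<Prod>x\<in>S. of_bool (Q x)) = (of_bool (\<forall>x\<in>S. Q x) :: int)"
  by (induction S rule: finite_induct) auto

lemma edge_obtain:
  assumes "ribbon_graph G" and "e \<in> edges G"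
  obtains h where "h \<in> halves G" "opp G h \<in> halves G" "opp G h \<noteq> h" "e = {h, opp G h}"
  using assms permutes_in_image[of "opp G" "halves G"] by (auto simp: edges_def ribbon_graph_def)

lemma finite_edges: "ribbon_graph G \<Longrightarrow> finite (edges G)"
  by (simp add: edges_def ribbon_graph_def)

lemma weight_dual_numbers:
  assumes G: "ribbon_graph G" "trivalent G"
  shows "weight dual_numbers G b \<kappa> = of_bool (admissible G b \<kappa>)"
proof -
  have "tri_form dual_numbers (\<kappa> (Min v)) (\<kappa> (nxt G (Min v))) (\<kappa> (nxt G (nxt G (Min v)))) =
      of_bool (card {h \<in> v. \<kappa> h = Bx} = 1)" if "v \<in> blacks G" for v
  proof -
    have c: "card v = 3" and m: "Min v \<in> v"
      using that G(2) vertex_Min[OF G(1)] by (auto simp: trivalent_def blacks_def)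
    note b = black3[OF G(1) that c m]
    show ?thesis
      unfolding tri_form_dual_numbers card_Bx_3[OF b(1,2)] ..
  qed
  then have 1: "(\<Prod>v\<in>blacks G. tri_form dual_numbers (\<kappa> (Min v)) (\<kappa> (nxt G (Min v))) (\<kappa> (nxt G (nxt G (Min v))))) =
      of_bool (\<forall>v\<in>blacks G. card {h \<in> v. \<kappa> h = Bx} = 1)"
    using prod_of_bool_int[OF finite_blacks[OF G(1)]] by simp
  have "copairing dual_numbers (\<kappa> (Min e)) (\<kappa> (Max e)) = of_bool (card {h \<in> e. \<kappa> h = Bx} = 1)"
    if e_edge: "e \<in> edges G" for e
  proof -
    obtain h k where e: "e = {h, k}" "h \<noteq> k"
      using edge_obtain[OF G(1) e_edge] by metis
    then show ?thesis
      unfolding copairing_dual_numbers using card_Bx_2[OF e(1)] by (auto simp: min_def max_def)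
  qed
  then have 2: "(\<Prod>e\<in>edges G. copairing dual_numbers (\<kappa> (Min e)) (\<kappa> (Max e))) =
      of_bool (\<forall>e\<in>edges G. card {h \<in> e. \<kappa> h = Bx} = 1)"
    using prod_of_bool_int[OF finite_edges[OF G(1)]] by simp
  have 3: "(\<Prod>i<length (labelled G). if \<kappa> (labelled G ! i) = b ! i then 1 else 0) =
      (of_bool (\<forall>i<length (labelled G). \<kappa> (labelled G ! i) = b ! i) :: int)"
    using prod_of_bool_int[of "{..<length (labelled G)}" "\<lambda>i. \<kappa> (labelled G ! i) = b ! i"]
    by (simp add: of_bool_def Ball_def)
  have 4: "(if unit_leaf G then Poly_Mapping.lookup (funit dual_numbers) (\<kappa> (start G)) else 1) =
      of_bool (unit_leaf G \<longrightarrow> \<kappa> (start G) = B1)"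
    by (simp add: dual_numbers_def)
  show ?thesis
    unfolding weight_def 1 2 3 4 admissible_def by (auto simp: ball_Un)
qed

lemma cut_morphism_dual_numbers:
  assumes G: "ribbon_graph G" "trivalent G"
  shows "cut_morphism dual_numbers G b = state_sum G b"
proof -
  have "finite (halves G \<rightarrow>\<^sub>E (UNIV :: dual_basis set))"
    using G(1) by (intro finite_PiE) (auto simp: ribbon_graph_def)
  then show ?thesis
    unfolding cut_morphism_def state_sum_def weight_dual_numbers[OF G]
    by (intro sum.mono_neutral_cong_right) auto
qed

lemma vertex_or_edge_subset:
  "ribbon_graph G \<Longrightarrow> v \<in> blacks G \<union> edges G \<Longrightarrow> v \<subseteq> halves G"
  using vertex_subset black_vertex edge_obtain by (metis Un_iff empty_subsetI insert_subset)

lemma admissible_cong: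
  assumes G: "ribbon_graph G" and eq: "\<And>h. h \<in> halves G \<Longrightarrow> \<kappa> h = \<kappa>' h"
  shows "admissible G b \<kappa> = admissible G b \<kappa>'"
proof -
  have "{h \<in> v. \<kappa> h = Bx} = {h \<in> v. \<kappa>' h = Bx}" if "v \<in> blacks G \<union> edges G" for v
    using vertex_or_edge_subset[OF G that] eq by (metis (no_types, lifting) subsetD)
  moreover have "\<kappa> (labelled G ! i) = \<kappa>' (labelled G ! i)" if "i < length (labelled G)" for i
    using G that eq nth_mem by (auto simp: ribbon_graph_def)
  moreover have "\<kappa> (start G) = \<kappa>' (start G)"
    using G eq by (auto simp: ribbon_graph_def)
  ultimately show ?thesis
    by (simp add: admissible_def)
qed

lemma white_list_cong:
  assumes G: "ribbon_graph G" and eq: "\<And>h. h \<in> halves G \<Longrightarrow> \<kappa> h = \<kappa>' h"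
  shows "map \<kappa> (white_list G) = map \<kappa>' (white_list G)"
  using white_list[OF G] vertex_subset[OF G white_vertex[OF G]] eq by auto


section \<open>Relabelling\<close>

context
  fixes G G' :: bw_graph and \<phi> :: "nat \<Rightarrow> nat" and \<omega> :: orient
  assumes G: "ribbon_graph G" and \<phi>: "bij \<phi>" and G': "G' = fst (relabel \<phi> (G, \<omega>))"
begin

lemma \<phi>_inv [simp]: "inv_into UNIV \<phi> (\<phi> x) = x"
  using \<phi> by (simp add: bij_is_inj)

lemma \<phi>_eq [simp]: "\<phi> x = \<phi> y \<longleftrightarrow> x = y"
  using \<phi> by (simp add: bij_is_inj inj_eq)

lemma relabel_simps:
  "halves G' = \<phi> ` halves G" "nxt G' (\<phi> h) = \<phi> (nxt G h)" "opp G' (\<phi> h) = \<phi> (opp G h)"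
  "start G' = \<phi> (start G)" "labelled G' = map \<phi> (labelled G)"
  by (simp_all add: G' relabel_def)

lemma relabel_permutes:
  assumes "f permutes S"
  shows "(\<phi> \<circ> f \<circ> inv_into UNIV \<phi>) permutes \<phi> ` S"
proof -
  have "bij (\<phi> \<circ> f \<circ> inv_into UNIV \<phi>)"
    using \<phi> permutes_bij[OF assms] by (intro bij_comp bij_imp_bij_inv)
  moreover have "(\<phi> \<circ> f \<circ> inv_into UNIV \<phi>) x = x" if "x \<notin> \<phi> ` S" for x
  proof -
    have "x = \<phi> (inv_into UNIV \<phi> x)"
      using \<phi> by (simp add: bij_is_surj surj_f_inv_f)
    moreover from this have "inv_into UNIV \<phi> x \<notin> S"
      using that by auto
    ultimately show ?thesis
      using assms by (simp add: permutes_not_in)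
  qed
  ultimately show ?thesis
    by (simp add: permutes_def bij_iff)
qed

lemma relabel_ribbon: "ribbon_graph G'"
proof -
  have n: "nxt G' = \<phi> \<circ> nxt G \<circ> inv_into UNIV \<phi>" and o: "opp G' = \<phi> \<circ> opp G \<circ> inv_into UNIV \<phi>"
    by (simp_all add: G' relabel_def)
  have "opp G' (opp G' x) = x" for x
  proof -
    obtain y where "x = \<phi> y"
      using \<phi> by (meson bij_pointE)
    then show ?thesis
      using G by (simp add: relabel_simps ribbon_graph_def fun_eq_iff)
  qed
  then have "opp G' \<circ> opp G' = id"
    by (simp add: fun_eq_iff)
  moreover have "nxt G' permutes halves G'" "opp G' permutes halves G'"
    unfolding n o relabel_simps(1) using G by (simp_all add: relabel_permutes ribbon_graph_def)
  ultimately show ?thesis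
    using G by (auto simp: ribbon_graph_def relabel_simps)
qed

lemma relabel_orbit: "orbit (nxt G') (\<phi> h) = \<phi> ` orbit (nxt G) h"
  by (rule orbit_inverse[symmetric]) (simp_all add: orbit_nxt_self[OF G] relabel_simps)

lemma relabel_white: "white G' = \<phi> ` white G"
  by (simp add: white_def relabel_simps relabel_orbit)

lemma relabel_blacks: "blacks G' = (`) \<phi> ` blacks G"
proof -
  have "inj ((`) \<phi>)"
    using \<phi> by (simp add: bij_is_inj inj_image_eq_iff inj_def)
  moreover have "vertices G' = (`) \<phi> ` vertices G"
    by (simp add: vertices_def relabel_simps image_image relabel_orbit)
  ultimately show ?thesis
    by (simp add: blacks_def relabel_white image_set_diff)
qed

lemma relabel_edges: "edges G' = (`) \<phi> ` edges G"
  by (auto simp: edges_def relabel_simps image_iff) (metis image_empty image_insert)+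

lemma relabel_card: "card (\<phi> ` v) = card v"
  using \<phi> by (simp add: card_image bij_is_inj inj_on_subset[OF _ subset_UNIV])

lemma relabel_trivalent: "trivalent G' = trivalent G"
  by (simp add: trivalent_def relabel_blacks relabel_card)

lemma relabel_high_valence: "high_valence G' = high_valence G"
  by (simp add: high_valence_def relabel_blacks relabel_card)

lemma relabel_white_list: "white_list G' = map \<phi> (white_list G)"
proof -
  have "(nxt G' ^^ i) (\<phi> h) = \<phi> ((nxt G ^^ i) h)" for i h
    by (induction i) (simp_all add: relabel_simps)
  then show ?thesis
    by (simp add: white_list_def relabel_simps relabel_white relabel_card)
qed

lemma relabel_unit_leaf: "unit_leaf G' = unit_leaf G"
  by (auto simp: unit_leaf_def relabel_simps)

lemma relabel_admissible: "admissible G' b \<kappa> = admissible G b (\<kappa> \<circ> \<phi>)"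
proof -
  have "{h \<in> \<phi> ` v. \<kappa> h = Bx} = \<phi> ` {h \<in> v. (\<kappa> \<circ> \<phi>) h = Bx}" for v
    by auto
  then have "card {h \<in> \<phi> ` v. \<kappa> h = Bx} = card {h \<in> v. (\<kappa> \<circ> \<phi>) h = Bx}" for v
    by (simp only: relabel_card)
  then show ?thesis
    unfolding admissible_def relabel_unit_leaf
    by (simp add: relabel_blacks relabel_edges relabel_simps ball_Un)
qed

lemma relabel_state_sum: "state_sum G' b = state_sum G b"
proof -
  have ad: "admissible G b (restrict (\<kappa> \<circ> \<phi>) (halves G)) = admissible G b (\<kappa> \<circ> \<phi>)" for \<kappa>
    by (rule admissible_cong[OF G]) simp
  have ad': "admissible G' b (restrict (\<kappa> \<circ> inv_into UNIV \<phi>) (\<phi> ` halves G)) = admissible G b \<kappa>" for \<kappa>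
    unfolding relabel_admissible by (rule admissible_cong[OF G]) simp
  show ?thesis
    unfolding state_sum_def
  proof (rule sum.reindex_bij_witness[where j = "\<lambda>\<kappa>. restrict (\<kappa> \<circ> \<phi>) (halves G)"
        and i = "\<lambda>\<kappa>. restrict (\<kappa> \<circ> inv_into UNIV \<phi>) (\<phi> ` halves G)"], goal_cases)
    case (1 \<kappa>)
    then show ?case
      by (intro ext) (auto simp: relabel_simps PiE_iff extensional_def)
  next
    case (2 \<kappa>)
    then show ?case
      using ad relabel_admissible by simp
  next
    case (3 \<kappa>)
    then show ?case
      by (intro ext) (auto simp: PiE_iff extensional_def)
  next
    case (4 \<kappa>)
    then show ?case
      using ad' by (simp add: relabel_simps)
  next
    case (5 \<kappa>)
    have "map (restrict (\<kappa> \<circ> \<phi>) (halves G)) (white_list G) = map (\<kappa> \<circ> \<phi>) (white_list G)"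
      by (rule white_list_cong[OF G]) simp
    then show ?case
      by (simp only: relabel_white_list map_map)
  qed
qed

text \<open>
  The bijection carries the canonical orientation to one with the same blocks in another order and with
  other first half-edges, which are even changes by \<open>reorder_sign_corollas\<close>.
\<close>

lemma relabel_reorder_sign:
  assumes tri: "trivalent G" and \<omega>: "orientation G \<omega>"
  shows "reorder_sign (canonical_orientation G') (map (map_sum ((`) \<phi>) \<phi>) \<omega>) =
    reorder_sign (canonical_orientation G) \<omega>"
proof -
  let ?f = "map_sum ((`) \<phi>) \<phi>" and ?hs = "sorted_list_of_set (Min ` blacks G)"
  have inj: "inj ?f"
    using \<phi> by (intro sum.inj_map) (simp_all add: bij_is_inj inj_image_eq_iff inj_def)
  have c: "canonical_orientation G = concat (map (corolla G) ?hs) @ white_corolla G"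
    by (rule canonical_orientation_corollas)
  have m: "map ?f (canonical_orientation G) = concat (map (corolla G') (map \<phi> ?hs)) @ white_corolla G'"
  proof -
    have "map ?f (corolla G h) = corolla G' (\<phi> h)" for h
      by (simp add: corolla_def relabel_orbit relabel_simps)
    then have "map (map ?f) (map (corolla G) ?hs) = map (corolla G') (map \<phi> ?hs)"
      by simp
    moreover have "map ?f (white_corolla G) = white_corolla G'"
      by (simp add: white_corolla_def relabel_white relabel_white_list)
    ultimately show ?thesis
      by (simp only: c map_append map_concat)
  qed
  have "map (orbit (nxt G')) (map \<phi> ?hs) = map ((`) \<phi>) (map (orbit (nxt G)) ?hs)"
    by (simp add: relabel_orbit)
  then have d: "distinct (map (orbit (nxt G')) (map \<phi> ?hs))"
    using Min_blacks(1)[OF G] \<phi>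
    by (simp add: distinct_map[of "(`) \<phi>"] inj_on_def bij_is_inj inj_image_eq_iff del: map_map)
  have "orbit (nxt G') ` set (map \<phi> ?hs) = (`) \<phi> ` orbit (nxt G) ` set ?hs"
    by (simp add: image_image relabel_orbit)
  then have s: "orbit (nxt G') ` set (map \<phi> ?hs) = blacks G'"
    using Min_blacks(2)[OF G] by (simp add: relabel_blacks)
  have tri': "trivalent G'"
    using tri by (simp add: relabel_trivalent)
  have 1: "reorder_sign (canonical_orientation G') (map ?f (canonical_orientation G)) = 1"
    unfolding m using relabel_ribbon tri' d s by (rule reorder_sign_corollas)
  have same: "same_entries (canonical_orientation G) \<omega>"
    using orientation_same_entries[OF orientation_canonical[OF G tri] \<omega>] .
  have s1: "same_entries (canonical_orientation G') (map ?f (canonical_orientation G))"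
    unfolding m using relabel_ribbon tri' d s
    by (intro orientation_same_entries[of G'] orientation_canonical corollas_orientation)
  have s2: "same_entries (map ?f (canonical_orientation G)) (map ?f \<omega>)"
    using same inj by (intro same_entries_map) (auto intro: inj_on_subset)
  have "reorder_sign (map ?f (canonical_orientation G)) (map ?f \<omega>) = reorder_sign (canonical_orientation G) \<omega>"
    using same inj by (intro reorder_sign_inj_map) (auto intro: inj_on_subset)
  then show ?thesis
    using 1 reorder_sign_trans[OF s1 s2] by simp
qed

end

lemma sullivan_ribbon: "sullivan_graph n G \<Longrightarrow> ribbon_graph G"
  by (auto simp: sullivan_graph_def ribbon_graph_def)

lemma sullivan_trivalent: "sullivan_graph n G \<Longrightarrow> \<not> high_valence G \<Longrightarrow> trivalent G"
  by (force simp: sullivan_graph_def high_valence_def trivalent_def)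

lemma graph_act_dual_numbers:
  assumes "ribbon_graph G" "trivalent G"
  shows "graph_act dual_numbers (G, \<omega>) b =
    frag_cmul (reorder_sign (canonical_orientation G) \<omega>) (state_sum G b)"
  using assms by (auto simp: graph_act_def cut_morphism_dual_numbers high_valence_def trivalent_def)

lemma graph_act_reorder:
  assumes G: "sullivan_graph n G" and \<omega>: "orientation G \<omega>" and \<pi>: "\<pi> permutes set \<omega>"
  shows "graph_act dual_numbers (G, map \<pi> \<omega>) b = frag_cmul (sign \<pi>) (graph_act dual_numbers (G, \<omega>) b)"
proof (cases "high_valence G")
  case True
  then show ?thesis by (simp add: graph_act_def)
next
  case False
  then have t: "ribbon_graph G" "trivalent G"
    using G sullivan_ribbon sullivan_trivalent by auto
  show ?thesis
    using reorder_sign_map_permutes[OF orientation_same_entries[OF orientation_canonical[OF t] \<omega>] \<pi>]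
    by (simp add: graph_act_dual_numbers[OF t])
qed

lemma graph_act_relabel:
  assumes G: "sullivan_graph n G" and \<omega>: "orientation G \<omega>" and \<phi>: "bij \<phi>"
  shows "graph_act dual_numbers (relabel \<phi> (G, \<omega>)) b = graph_act dual_numbers (G, \<omega>) b"
proof -
  define G' where "G' = fst (relabel \<phi> (G, \<omega>))"
  have R: "relabel \<phi> (G, \<omega>) = (G', map (map_sum ((`) \<phi>) \<phi>) \<omega>)"
    by (simp add: G'_def relabel_def)
  note rel = sullivan_ribbon[OF G] \<phi> G'_def
  show ?thesis
  proof (cases "high_valence G")
    case True
    then show ?thesis
      using relabel_high_valence[OF rel] by (simp add: R graph_act_def)
  next
    case False
    then have "trivalent G"
      using G sullivan_trivalent by auto
    then show ?thesis
      using relabel_ribbon[OF rel] relabel_trivalent[OF rel] relabel_state_sum[OF rel]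
        relabel_reorder_sign[OF rel _ \<omega>] sullivan_ribbon[OF G]
      by (simp add: R graph_act_dual_numbers)
  qed
qed

section \<open>Blow-ups\<close>

text \<open>
  The half-edge \<open>p\<close> of a blow-up; \<open>q\<close> is its successor.
\<close>

definition fresh :: "bw_graph \<Rightarrow> nat" where
  "fresh G = Suc (Max (halves G))"

definition blow_graph :: "nat \<Rightarrow> nat \<Rightarrow> bw_graph \<Rightarrow> bw_graph" where
  "blow_graph a b G = fst (blow_up a b (G, []))"

lemma blow_graph_simps:
  "halves (blow_graph a b G) = insert (fresh G) (insert (Suc (fresh G)) (halves G))"
  "nxt (blow_graph a b G) h = (if h = fresh G then a else if h = b then fresh G
     else if h = Suc (fresh G) then (if nxt G b = a then Suc (fresh G) else nxt G b)
     else if nxt G h = a then Suc (fresh G) else nxt G h)"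
  "opp (blow_graph a b G) = (opp G)(fresh G := Suc (fresh G), Suc (fresh G) := fresh G)"
  "start (blow_graph a b G) = (if start G \<in> arc G a b then Suc (fresh G) else start G)"
  "labelled (blow_graph a b G) = labelled G"
  by (simp_all add: blow_graph_def blow_up_def fresh_def Let_def)

lemma blow_up_eq:
  "blow_up a b (G, \<omega>) = (blow_graph a b G,
     Inl (insert (fresh G) (arc G a b)) # Inr (Suc (fresh G)) # Inr (fresh G) #
     map (\<lambda>z. if z = Inl (orbit (nxt G) a) then Inl (insert (Suc (fresh G)) (orbit (nxt G) a - arc G a b)) else z) \<omega>)"
  by (simp add: blow_graph_def blow_up_def fresh_def Let_def)

lemma fresh_notin:
  assumes "ribbon_graph G"
  shows "fresh G \<notin> halves G" "Suc (fresh G) \<notin> halves G"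
proof -
  have "h \<le> Max (halves G)" if "h \<in> halves G" for h
    using assms that by (simp add: ribbon_graph_def)
  then show "fresh G \<notin> halves G" "Suc (fresh G) \<notin> halves G"
    by (metis fresh_def Suc_n_not_le_n Suc_leD)+
qed

lemma nxt_in_v:
  assumes G: "ribbon_graph G" and v: "v \<in> vertices G"
  shows "nxt G h \<in> v \<longleftrightarrow> h \<in> v"
proof
  assume "nxt G h \<in> v"
  moreover have "nxt G h \<in> orbit (nxt G) h"
    by (rule orbit.base)
  ultimately show "h \<in> v"
    using vertices_orbit[OF G v] orbit_nxt_eq[OF G] orbit_nxt_self[OF G] by metis
next
  assume "h \<in> v"
  then show "nxt G h \<in> v"
    using vertices_orbit[OF G v] orbit.base[of "nxt G" h] by blast
qed

lemma nxt_halves: "ribbon_graph G \<Longrightarrow> nxt G h \<in> halves G \<longleftrightarrow> h \<in> halves G"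
  using permutes_in_image by (fastforce simp: ribbon_graph_def)

lemma nxt_inj: "ribbon_graph G \<Longrightarrow> nxt G h = nxt G k \<longleftrightarrow> h = k"
  using permutes_inj by (fastforce simp: ribbon_graph_def inj_eq)

context
  fixes G :: bw_graph and v :: "nat set" and a b :: nat
  assumes G: "ribbon_graph G" and v: "v \<in> vertices G" and a: "a \<in> v" and b: "b \<in> v"
begin

lemma arc_facts:
  "arc G a b \<subseteq> v" "card (arc G a b) = Suc (funpow_dist (nxt G) a b)"
proof -
  have o: "v = orbit (nxt G) a"
    using vertices_orbit[OF G v a] .
  then have "(nxt G ^^ i) a \<in> v" for i
    using funpow_in_orbit[OF orbit_nxt_self[OF G]] by simp
  then show "arc G a b \<subseteq> v"
    by (auto simp: arc_def)
  have "inj_on (\<lambda>n. (nxt G ^^ n) a) {..funpow_dist (nxt G) a b}"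
    using inj_on_funpow_dist[of b "nxt G" a] b o by (simp add: atLeast0AtMost)
  then show "card (arc G a b) = Suc (funpow_dist (nxt G) a b)"
    by (simp add: arc_def card_image)
qed

lemma v_halves: "a \<in> halves G" "b \<in> halves G" "v \<subseteq> halves G"
  using vertex_subset[OF G v] a b by auto

lemma blow_graph_ribbon: "ribbon_graph (blow_graph a b G)"
proof -
  let ?p = "fresh G" and ?q = "Suc (fresh G)" and ?G = "blow_graph a b G"
  note p = fresh_notin[OF G]
  have fin: "finite (halves ?G)"
    using G by (simp add: blow_graph_simps ribbon_graph_def)
  have "inj_on (nxt ?G) (halves ?G)"
  proof (rule inj_onI)
    fix x y
    assume "x \<in> halves ?G" "y \<in> halves ?G" "nxt ?G x = nxt ?G y"
    then show "x = y"
      using p v_halves nxt_inj[OF G] nxt_halves[OF G]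
      by (simp add: blow_graph_simps split: if_splits) metis+
  qed
  moreover have "nxt ?G ` halves ?G \<subseteq> halves ?G"
    using v_halves nxt_halves[OF G] by (auto simp: blow_graph_simps)
  ultimately have "bij_betw (nxt ?G) (halves ?G) (halves ?G)"
    using fin by (simp add: bij_betw_def endo_inj_surj)
  moreover have "nxt ?G h = h" if "h \<notin> halves ?G" for h
  proof -
    have "nxt G h = h"
      using that G permutes_not_in[of "nxt G" "halves G" h] by (simp add: blow_graph_simps ribbon_graph_def)
    then show ?thesis
      using that v_halves by (auto simp: blow_graph_simps)
  qed
  ultimately have n: "nxt ?G permutes halves ?G"
    by (rule bij_imp_permutes)
  have oo: "opp G (opp G h) = h" for h
    using G by (simp add: ribbon_graph_def fun_eq_iff)
  have fixed: "opp G ?p = ?p" "opp G ?q = ?q"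
    using G p permutes_not_in[of "opp G" "halves G"] by (simp_all add: ribbon_graph_def)
  have eq: "opp G h \<noteq> ?p" "opp G h \<noteq> ?q" if "h \<noteq> ?p" "h \<noteq> ?q" for h
    using that fixed oo by metis+
  then have o: "opp ?G (opp ?G h) = h" for h
    using oo by (simp add: blow_graph_simps)
  have "opp ?G permutes halves ?G"
  proof (rule bij_imp_permutes)
    have "opp ?G ` halves ?G \<subseteq> halves ?G"
      using G permutes_in_image[of "opp G" "halves G"] by (auto simp: blow_graph_simps ribbon_graph_def)
    then show "bij_betw (opp ?G) (halves ?G) (halves ?G)"
      using o by (intro bij_betw_byWitness[where f' = "opp ?G"]) auto
    show "opp ?G h = h" if "h \<notin> halves ?G" for h
      using that G permutes_not_in[of "opp G" "halves G" h] by (auto simp: blow_graph_simps ribbon_graph_def)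
  qed
  moreover have "opp ?G \<circ> opp ?G = id"
    using o by (simp add: fun_eq_iff)
  ultimately show ?thesis
    using fin n G by (auto simp: ribbon_graph_def blow_graph_simps)
qed

lemma blow_graph_nxt_outside: "h \<in> halves G \<Longrightarrow> h \<notin> v \<Longrightarrow> nxt (blow_graph a b G) h = nxt G h"
  using fresh_notin[OF G] a b nxt_in_v[OF G v] by (auto simp: blow_graph_simps)

lemma blow_graph_funpow_outside:
  assumes "h \<in> halves G" "h \<notin> v"
  shows "(nxt (blow_graph a b G) ^^ i) h = (nxt G ^^ i) h"
proof -
  have "(nxt G ^^ i) h \<in> halves G \<and> (nxt G ^^ i) h \<notin> v" for i
    using assms by (induction i) (simp_all add: nxt_halves[OF G] nxt_in_v[OF G v])
  then show ?thesis
    by (induction i) (simp_all add: blow_graph_nxt_outside)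
qed

lemma blow_graph_orbit_outside:
  "h \<in> halves G \<Longrightarrow> h \<notin> v \<Longrightarrow> orbit (nxt (blow_graph a b G)) h = orbit (nxt G) h"
  by (simp add: orbit_altdef blow_graph_funpow_outside)

text \<open>
  High valence is inherited: a blow-up at \<open>v\<close> leaves all other black vertices as they are. The start
  half-edge of the new graph is the old one or \<open>q\<close>, so no black vertex turns white.
\<close>

lemma blow_graph_black_outside:
  assumes "u \<in> blacks G" and "u \<noteq> v"
  shows "u \<in> blacks (blow_graph a b G)"
proof -
  let ?G = "blow_graph a b G"
  obtain h where h: "h \<in> halves G" "u = orbit (nxt G) h"
    using assms(1) by (auto simp: blacks_def vertices_def)
  have u: "u \<in> vertices G"
    using assms(1) by (simp add: blacks_def)
  have disj: "u \<inter> v = {}" "u \<inter> white G = {}" "u \<subseteq> halves G"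
    using vertices_disjoint[OF G u v assms(2)] vertices_disjoint[OF G u white_vertex[OF G]] assms(1)
      vertex_subset[OF G u] by (auto simp: blacks_def)
  have "h \<in> u"
    using h(2) orbit_nxt_self[OF G] by simp
  then have o: "orbit (nxt ?G) h = u"
    using h disj(1) blow_graph_orbit_outside by auto
  then have "u \<in> vertices ?G"
    using h(1) by (auto simp: vertices_def blow_graph_simps)
  moreover have "start ?G \<notin> u"
    using disj start_white[OF G] fresh_notin(2)[OF G] by (auto simp: blow_graph_simps)
  then have "white ?G \<noteq> u"
    using start_white[OF blow_graph_ribbon] by auto
  ultimately show ?thesis
    by (simp add: blacks_def)
qed

end

lemma graph_act_high_valence: "high_valence G \<Longrightarrow> graph_act P (G, \<omega>) w = 0"
  by (simp add: graph_act_def)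

text \<open>
  Neither a blow-up of the white vertex nor the erasure of a unit leaf touches the black vertices of
  the graph, so a black vertex of valence at least 4 survives in every term.
\<close>

lemma high_valence_white_term:
  assumes G: "ribbon_graph G" and hv: "high_valence G" and ab: "a \<in> white G" "b \<in> white G" "a \<noteq> b"
  shows "frag_extend (\<lambda>X. graph_act P X w) (white_term a b (G, \<omega>)) = 0"
proof -
  have blow: "high_valence (blow_graph a b G)"
    using hv blow_graph_black_outside[OF G white_vertex[OF G] ab(1,2)]
    by (auto simp: high_valence_def) (auto simp: blacks_def)
  have drop: "high_valence (fst (drop_unit h (G, \<omega>)))" if h: "h \<in> white G" "h \<noteq> start G" for h
  proof -
    let ?G = "fst (drop_unit h (G, \<omega>))"
    have simps: "halves ?G = halves G - {start G}" "start ?G = h"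
      "nxt ?G x = (if x = start G then start G else if nxt G x = start G then nxt G (start G) else nxt G x)" for x
      by (simp_all add: drop_unit_def Let_def)
    obtain u where u: "u \<in> blacks G" "4 \<le> card u"
      using hv by (auto simp: high_valence_def)
    then have uv: "u \<in> vertices G" "u \<noteq> white G"
      by (auto simp: blacks_def)
    have disj: "u \<inter> white G = {}"
      using vertices_disjoint[OF G uv(1) white_vertex[OF G] uv(2)] .
    obtain k where k: "k \<in> halves G" "u = orbit (nxt G) k"
      using uv by (auto simp: vertices_def)
    have ku: "k \<in> u"
      using k orbit_nxt_self[OF G] by simp
    have "nxt ?G x = nxt G x" if "x \<in> u" for x
    proof -
      have "nxt G x \<in> u"
        using nxt_in_v[OF G uv(1)] that by blast
      then show ?thesis
        using that disj start_white[OF G] by (auto simp: simps)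
    qed
    then have "orbit (nxt ?G) k = orbit (nxt G) k"
      by (intro orbit_cong[OF orbit_nxt_self[OF G]]) (simp add: k(2))
    then have o: "orbit (nxt ?G) k = u"
      by (simp add: k(2))
    moreover have "k \<in> halves ?G"
      using k(1) ku disj start_white[OF G] by (auto simp: simps)
    ultimately have "u \<in> vertices ?G"
      by (auto simp: vertices_def)
    moreover have "white ?G \<noteq> u"
    proof
      assume "white ?G = u"
      then have "nxt ?G h \<in> u"
        unfolding white_def simps(2) using orbit.base by metis
      moreover have "nxt ?G h \<in> white G"
        using nxt_in_v[OF G white_vertex[OF G]] h start_white[OF G] by (auto simp: simps)
      ultimately show False
        using disj by blast
    qed
    ultimately show ?thesis
      using u(2) by (auto simp: high_valence_def blacks_def)
  qed
  have bh: "b \<in> white G" "a \<in> white G"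
    using ab by auto
  have act: "graph_act P (drop_unit h (G, \<omega>)) w = 0" if "h \<in> white G" "h \<noteq> start G" for h
    using drop[OF that] by (cases "drop_unit h (G, \<omega>)") (simp add: graph_act_def)
  show ?thesis
    using blow ab act[of a] act[of b]
    by (auto simp: white_term_def Let_def frag_extend_cmul blow_up_eq graph_act_high_valence)
qed

section \<open>Resolving a 4-valent vertex\<close>

text \<open>
  Let \<open>a, b, c, d\<close> be the half-edges of a 4-valent vertex in cyclic order, starting anywhere. Moving
  \<open>a, b\<close> to a new vertex gives vertices \<open>{p, a, b}\<close> and \<open>{q, c, d}\<close>. The starting point is kept
  arbitrary so that the same lemmas apply to the other splitting, with \<open>b\<close> in place of \<open>a\<close>.
\<close>

context
  fixes G :: bw_graph and v :: "nat set" and a :: nat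
  assumes G: "ribbon_graph G" and v: "v \<in> blacks G" and a: "a \<in> v" and card_v: "card v = 4"
    and others: "\<forall>u\<in>blacks G - {v}. card u = 3"
begin

private abbreviation (input) "p \<equiv> fresh G"
private abbreviation (input) "q \<equiv> Suc (fresh G)"
private abbreviation (input) "b \<equiv> nxt G a"
private abbreviation (input) "c \<equiv> nxt G (nxt G a)"
private abbreviation (input) "d \<equiv> nxt G (nxt G (nxt G a))"
private abbreviation (input) "G' \<equiv> blow_graph a (nxt G a) G"

lemma v_vertex: "v \<in> vertices G"
  using v by (simp add: blacks_def)

lemma v_orbit: "orbit (nxt G) a = v"
  using vertices_orbit[OF G v_vertex a] by simp

lemma v_four: "v = {a, b, c, d}" "distinct [a, b, c, d]" "nxt G d = a"
proof -
  have "card (orbit (nxt G) a) = 4"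
    using card_v v_orbit by simp
  from orbit_card4[OF permutation_nxt[OF G] this] v_orbit
  show "v = {a, b, c, d}" "distinct [a, b, c, d]" "nxt G d = a"
    by simp_all
qed

lemma b_in_v: "b \<in> v"
  using v_four(1) by auto

lemma arc_two: "arc G a b = {a, b}"
proof -
  have "a \<noteq> b"
    using v_four(2) by auto
  then have "funpow_dist (nxt G) a b = Suc (funpow_dist (nxt G) b b)"
    by (rule funpow_dist_step) (rule orbit.base)
  then show ?thesis
    by (auto simp: arc_def funpow_dist_0 atMost_Suc)
qed

lemma fresh_v: "p \<notin> v" "q \<notin> v"
  using fresh_notin[OF G] vertex_subset[OF G v_vertex] by auto

lemmas ribbon' = blow_graph_ribbon[OF G v_vertex a b_in_v]
lemmas orbit_outside = blow_graph_orbit_outside[OF G v_vertex a b_in_v]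

lemma nxt_new: "nxt G' p = a" "nxt G' a = b" "nxt G' b = p" "nxt G' q = c" "nxt G' c = d" "nxt G' d = q"
proof -
  have ne: "a \<noteq> b" "a \<noteq> c" "a \<noteq> d" "b \<noteq> c" "b \<noteq> d" "c \<noteq> d"
    using v_four(2) by simp_all
  have "p \<noteq> h \<and> q \<noteq> h" if "h \<in> v" for h
    using that fresh_v by auto
  moreover have "a \<in> v" "b \<in> v" "c \<in> v" "d \<in> v"
    using a nxt_in_v[OF G v_vertex] by blast+
  ultimately have p: "a \<noteq> p" "b \<noteq> p" "c \<noteq> p" "d \<noteq> p" "a \<noteq> q" "b \<noteq> q" "c \<noteq> q" "d \<noteq> q"
    by metis+
  show "nxt G' p = a" "nxt G' a = b" "nxt G' b = p" "nxt G' q = c" "nxt G' c = d" "nxt G' d = q"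
    unfolding blow_graph_simps v_four(3) using ne ne[symmetric] p p[symmetric] by simp_all
qed

lemma orbit_new:
  "h \<in> {p, a, b} \<Longrightarrow> orbit (nxt G') h = {p, a, b}" "h \<in> {q, c, d} \<Longrightarrow> orbit (nxt G') h = {q, c, d}"
proof -
  have o: "orbit (nxt G') x = {x, y, z}" if "nxt G' x = y" "nxt G' y = z" "nxt G' z = x" for x y z
  proof
    show "orbit (nxt G') x \<subseteq> {x, y, z}"
    proof
      fix k assume "k \<in> orbit (nxt G') x"
      then show "k \<in> {x, y, z}"
        by induction (use that in auto)
    qed
    have "nxt G' x \<in> orbit (nxt G') x" "nxt G' (nxt G' x) \<in> orbit (nxt G') x"
      "nxt G' (nxt G' (nxt G' x)) \<in> orbit (nxt G') x"
      by (auto intro: orbit.intros)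
    then show "{x, y, z} \<subseteq> orbit (nxt G') x"
      by (simp add: that)
  qed
  show "h \<in> {p, a, b} \<Longrightarrow> orbit (nxt G') h = {p, a, b}" "h \<in> {q, c, d} \<Longrightarrow> orbit (nxt G') h = {q, c, d}"
    using o[OF nxt_new(1-3)] o[OF nxt_new(2,3,1)] o[OF nxt_new(3,1,2)]
      o[OF nxt_new(4-6)] o[OF nxt_new(5,6,4)] o[OF nxt_new(6,4,5)]
    by (auto simp: insert_commute)
qed

lemma start_outside: "start G \<in> halves G" "start G \<notin> v"
  using G v start_white[OF G] vertices_disjoint[OF G v_vertex white_vertex[OF G]]
  by (auto simp: ribbon_graph_def blacks_def)

lemma start_new: "start G' = start G"
  using start_outside(2) v_four(1) by (simp add: blow_graph_simps arc_two)

lemma white_new: "white G' = white G"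
  using start_outside by (simp add: white_def start_new orbit_outside)

lemma white_list_new: "white_list G' = white_list G"
  using start_outside
  by (simp add: white_list_def white_new start_new blow_graph_funpow_outside[OF G v_vertex a b_in_v])

lemma vertices_new: "vertices G' = insert {p, a, b} (insert {q, c, d} (vertices G - {v}))"
proof -
  have "orbit (nxt G') ` (halves G - v) = orbit (nxt G) ` (halves G - v)"
    using orbit_outside by (intro image_cong) auto
  also have "\<dots> = vertices G - {v}"
    using vertices_orbit[OF G v_vertex] orbit_nxt_self[OF G] by (auto simp: vertices_def)
  finally have "orbit (nxt G') ` (halves G - v) = vertices G - {v}" .
  moreover have "halves G' = {p, a, b} \<union> {q, c, d} \<union> (halves G - v)"
    using v_four(1) vertex_subset[OF G v_vertex] by (auto simp: blow_graph_simps)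
  moreover have "orbit (nxt G') ` {p, a, b} = {{p, a, b}}" "orbit (nxt G') ` {q, c, d} = {{q, c, d}}"
    using orbit_new by (auto simp: image_iff)
  ultimately show ?thesis
    unfolding vertices_def[of G'] by (simp only: image_Un) blast
qed

lemma new_not_vertex: "{p, a, b} \<notin> vertices G" "{q, c, d} \<notin> vertices G"
  using vertex_subset[OF G] fresh_notin[OF G] by blast+

lemma blacks_new: "blacks G' = insert {p, a, b} (insert {q, c, d} (blacks G - {v}))"
  using new_not_vertex white_vertex[OF G] by (auto simp: blacks_def vertices_new white_new)

lemma trivalent_new: "trivalent G'"
  using others v_four fresh_v by (auto simp: trivalent_def blacks_new)

lemma edges_new: "edges G' = insert {p, q} (edges G)"
proof -
  have o: "opp G' h = opp G h" if "h \<in> halves G" for h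
    using that fresh_notin[OF G] by (auto simp: blow_graph_simps)
  have "edges G' = (\<lambda>h. {h, opp G' h}) ` {h \<in> halves G'. opp G' h \<noteq> h}"
    by (auto simp: edges_def)
  also have "{h \<in> halves G'. opp G' h \<noteq> h} = {p, q} \<union> {h \<in> halves G. opp G h \<noteq> h}"
    using o by (auto simp: blow_graph_simps(1)) (auto simp: blow_graph_simps(3))
  also have "(\<lambda>h. {h, opp G' h}) ` \<dots> = insert {p, q} ((\<lambda>h. {h, opp G' h}) ` {h \<in> halves G. opp G h \<noteq> h})"
    by (auto simp: blow_graph_simps(3))
  also have "(\<lambda>h. {h, opp G' h}) ` {h \<in> halves G. opp G h \<noteq> h} = edges G"
    using o by (auto simp: edges_def)
  finally show ?thesis .
qed

lemma unit_leaf_new: "unit_leaf G' = unit_leaf G"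
  using start_outside(1) fresh_notin[OF G] by (auto simp: unit_leaf_def start_new blow_graph_simps(3,5))

text \<open>
  Exactly one \<open>x\<close> on \<open>{p, a, b}\<close> and one on \<open>{q, c, d}\<close> make two on the six half-edges. The edge
  \<open>{p, q}\<close> carries one of them, which leaves exactly one on \<open>{a, b, c, d}\<close>. Conversely, the position
  of this one determines the colours of \<open>p\<close> and \<open>q\<close>. On the old half-edges the condition no longer
  refers to the splitting.
\<close>

lemma admissible_new:
  "admissible G' w \<kappa> \<longleftrightarrow> admissible G w \<kappa> \<and>
     \<kappa> p = (if \<kappa> a = Bx \<or> \<kappa> b = Bx then B1 else Bx) \<and> \<kappa> q = (if \<kappa> a = Bx \<or> \<kappa> b = Bx then Bx else B1)"
proof -
  have n: "\<kappa> h \<noteq> Bx \<longleftrightarrow> \<kappa> h = B1" for h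
    by (cases "\<kappa> h") auto
  have pab: "card {h \<in> {p, a, b}. \<kappa> h = Bx} = of_bool (\<kappa> p = Bx) + of_bool (\<kappa> a = Bx) + of_bool (\<kappa> b = Bx)"
    using v_four fresh_v by (intro card_Bx_3) auto
  have qcd: "card {h \<in> {q, c, d}. \<kappa> h = Bx} = of_bool (\<kappa> q = Bx) + of_bool (\<kappa> c = Bx) + of_bool (\<kappa> d = Bx)"
    using v_four fresh_v by (intro card_Bx_3) auto
  have pq: "card {h \<in> {p, q}. \<kappa> h = Bx} = of_bool (\<kappa> p = Bx) + of_bool (\<kappa> q = Bx)"
    by (intro card_Bx_2) auto
  have "finite v"
    by (simp add: v_four(1))
  then have "card {h \<in> v. \<kappa> h = Bx} =
      of_bool (\<kappa> a = Bx) + of_bool (\<kappa> b = Bx) + of_bool (\<kappa> c = Bx) + of_bool (\<kappa> d = Bx)"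
    unfolding card_Bx[OF \<open>finite v\<close>] using v_four(2) by (simp add: v_four(1))
  then have *: "card {h \<in> {p, a, b}. \<kappa> h = Bx} = 1 \<and> card {h \<in> {q, c, d}. \<kappa> h = Bx} = 1 \<and>
      card {h \<in> {p, q}. \<kappa> h = Bx} = 1 \<longleftrightarrow> card {h \<in> v. \<kappa> h = Bx} = 1 \<and>
      \<kappa> p = (if \<kappa> a = Bx \<or> \<kappa> b = Bx then B1 else Bx) \<and> \<kappa> q = (if \<kappa> a = Bx \<or> \<kappa> b = Bx then Bx else B1)"
    unfolding pab qcd pq by (auto simp: of_bool_def n split: if_splits)
  have "blacks G' \<union> edges G' = {{p, a, b}, {q, c, d}, {p, q}} \<union> ((blacks G - {v}) \<union> edges G)"
    by (auto simp: blacks_new edges_new)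
  moreover have "v \<notin> edges G"
    using card_v edge_obtain[OF G] by (metis card_2_iff numeral_eq_iff semiring_norm(85) verit_eq_simplify(8))
  then have "blacks G \<union> edges G = {v} \<union> ((blacks G - {v}) \<union> edges G)"
    using v by auto
  ultimately show ?thesis
    unfolding admissible_def unit_leaf_new start_new blow_graph_simps(5)
    by (simp only: ball_Un ball_simps) (use * in blast)
qed

text \<open>
  Both splittings therefore have the same state sum, that of the unresolved graph.
\<close>

lemma state_sum_new: "state_sum G' w = state_sum G w"
proof -
  define pc where "pc \<kappa> = (if \<kappa> a = Bx \<or> \<kappa> b = Bx then B1 else Bx)" for \<kappa> :: "nat \<Rightarrow> dual_basis"
  define qc where "qc \<kappa> = (if \<kappa> a = Bx \<or> \<kappa> b = Bx then Bx else B1)" for \<kappa> :: "nat \<Rightarrow> dual_basis"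
  have ab: "a \<in> halves G" "b \<in> halves G" "a \<noteq> p" "a \<noteq> q" "b \<noteq> p" "b \<noteq> q"
    using vertex_subset[OF G v_vertex] a b_in_v fresh_v by auto
  note p = fresh_notin[OF G]
  show ?thesis
    unfolding state_sum_def
  proof (rule sum.reindex_bij_witness[where j = "\<lambda>\<kappa>. restrict \<kappa> (halves G)"
        and i = "\<lambda>\<kappa>. \<kappa>(p := pc \<kappa>, q := qc \<kappa>)"], goal_cases)
    case (1 \<kappa>)
    then show ?case
      using ab p
      by (intro ext) (auto simp: blow_graph_simps PiE_iff extensional_def admissible_new pc_def qc_def)
  next
    case (2 \<kappa>)
    moreover have "admissible G w (restrict \<kappa> (halves G)) = admissible G w \<kappa>"
      by (rule admissible_cong[OF G]) simp
    ultimately show ?case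
      by (simp add: admissible_new)
  next
    case (3 \<kappa>)
    then show ?case
      using p by (intro ext) (auto simp: PiE_iff extensional_def)
  next
    case (4 \<kappa>)
    moreover have "admissible G w (\<kappa>(p := pc \<kappa>, q := qc \<kappa>)) = admissible G w \<kappa>"
      using p by (intro admissible_cong[OF G]) auto
    ultimately show ?case
      using ab by (auto simp: admissible_new blow_graph_simps PiE_iff extensional_def pc_def qc_def)
  next
    case (5 \<kappa>)
    have "map (restrict \<kappa> (halves G)) (white_list G) = map \<kappa> (white_list G)"
      by (rule white_list_cong[OF G]) simp
    then show ?case
      by (simp only: white_list_new)
  qed
qed

private abbreviation (input) "rest \<equiv> filter (\<lambda>h. orbit (nxt G) h \<noteq> v) (sorted_list_of_set (Min ` blacks G))"

lemma rest_outside: "h \<in> set rest \<Longrightarrow> h \<in> halves G \<and> h \<notin> v \<and> orbit (nxt G) h \<in> blacks G - {v}"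
proof -
  assume h: "h \<in> set rest"
  then have "orbit (nxt G) h \<in> blacks G"
    using Min_blacks(2)[OF G] by auto
  moreover have "h \<in> orbit (nxt G) h" "h \<notin> v"
    using orbit_nxt_self[OF G] h vertices_orbit[OF G v_vertex, of h] by auto
  ultimately show ?thesis
    using h vertex_subset[OF G, of "orbit (nxt G) h"] by (auto simp: blacks_def)
qed

lemma reps_new:
  "distinct (map (orbit (nxt G')) (q # p # rest))" "orbit (nxt G') ` set (q # p # rest) = blacks G'"
proof -
  have r: "map (orbit (nxt G')) rest = map (orbit (nxt G)) rest"
    using rest_outside orbit_outside by (intro map_cong) auto
  have s: "set (map (orbit (nxt G)) rest) = blacks G - {v}"
    using Min_blacks(2)[OF G] by auto
  have d: "distinct (map (orbit (nxt G)) rest)"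
    using Min_blacks(1)[OF G] by (auto simp: distinct_map inj_on_def)
  have new: "{p, a, b} \<notin> blacks G" "{q, c, d} \<notin> blacks G" "{q, c, d} \<noteq> {p, a, b}"
    using new_not_vertex v_four(2) fresh_v a b_in_v by (auto simp: blacks_def)
  show "distinct (map (orbit (nxt G')) (q # p # rest))"
    using d s new orbit_new by (simp only: list.map r distinct.simps) auto
  have "set (map (orbit (nxt G')) (q # p # rest)) = insert {q, c, d} (insert {p, a, b} (blacks G - {v}))"
    using s orbit_new by (simp only: list.map r list.set) auto
  then show "orbit (nxt G') ` set (q # p # rest) = blacks G'"
    by (auto simp: blacks_new)
qed

text \<open>
  The canonical orientation of the resolved graph, with the two new vertices listed first and starting
  at the new half-edges. The remaining part is common to both splittings.
\<close>

lemma corollas_new: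
  "concat (map (corolla G') (q # p # rest)) @ white_corolla G' =
    [Inl {q, c, d}, Inr q, Inr c, Inr d, Inl {p, a, b}, Inr p, Inr a, Inr b] @
    (concat (map (corolla G) rest) @ white_corolla G)"
proof -
  have "corolla G' h = corolla G h" if "h \<in> set rest" for h
  proof -
    have h: "h \<in> halves G" "h \<notin> v"
      using rest_outside[OF that] by auto
    then have "nxt G h \<in> halves G" "nxt G h \<notin> v"
      using nxt_halves[OF G] nxt_in_v[OF G v_vertex] by auto
    then show ?thesis
      using h blow_graph_nxt_outside[OF G v_vertex a b_in_v] by (simp add: corolla_def orbit_outside)
  qed
  then have "map (corolla G') rest = map (corolla G) rest"
    by (intro map_cong) auto
  moreover have "corolla G' q = [Inl {q, c, d}, Inr q, Inr c, Inr d]"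
    "corolla G' p = [Inl {p, a, b}, Inr p, Inr a, Inr b]"
    using orbit_new nxt_new by (simp_all add: corolla_def)
  moreover have "white_corolla G' = white_corolla G"
    by (simp add: white_corolla_def white_new white_list_new)
  ultimately show ?thesis
    by (simp only: list.map concat.simps append_assoc append_Cons append_Nil)
qed

lemma orientation_new:
  assumes "orientation G \<omega>"
  shows "orientation G' (Inl {p, a, b} # Inr q # Inr p # map (\<lambda>z. if z = Inl v then Inl {q, c, d} else z) \<omega>)"
proof -
  let ?f = "\<lambda>z. if z = Inl v then Inl {q, c, d} else z"
  have \<omega>: "distinct \<omega>" "set \<omega> = Inl ` vertices G \<union> Inr ` halves G"
    using assms by (auto simp: orientation_def)
  have "set (map ?f \<omega>) = Inl ` insert {q, c, d} (vertices G - {v}) \<union> Inr ` halves G"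
    using v_vertex by (auto simp: \<omega>(2) image_iff)
  moreover have "distinct (map ?f \<omega>)"
    using new_not_vertex by (auto simp: distinct_map \<omega> inj_on_def)
  moreover have "{q, c, d} \<noteq> {p, a, b}"
    using v_four(2) fresh_v a b_in_v by auto
  ultimately show ?thesis
    using new_not_vertex fresh_notin[OF G]
    by (auto simp: orientation_def vertices_new blow_graph_simps)
qed

end

lemma inj_on_rename:
  "y1 \<notin> S \<Longrightarrow> y2 \<notin> S \<Longrightarrow> y1 \<noteq> y2 \<Longrightarrow> inj_on (\<lambda>z. if z = x1 then y1 else if z = x2 then y2 else z) S"
  by (auto simp: inj_on_def)

text \<open>
  The comparison of the canonical orientations of the two splittings: a cyclic permutation of four
  entries.
\<close>

lemma reorder_sign_rotate_legs:
  assumes "distinct ([v1, q, d, a, v2, p, b, c] @ R)"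
  shows "reorder_sign ([v1, q, d, a, v2, p, b, c] @ R) ([v1, q, c, d, v2, p, a, b] @ R) = - 1"
    (is "reorder_sign ?C ?D = _")
proof -
  let ?E = "[v1, q, d, v2, p, a, b, c] @ R"
  have d: "distinct ?D" "same_entries ?C ?E" "same_entries ?D ?E"
    using assms by (auto simp: same_entries_def)
  \<comment> \<open>\<open>a\<close> moves past two entries\<close>
  have "reorder_sign ?C ?E = 1"
    using reorder_sign_move[of "[v1, q, d]" a "[v2, p]" "[b, c] @ R"] assms by simp
  \<comment> \<open>\<open>c\<close> moves past five entries\<close>
  moreover have "reorder_sign ?D ?E = - 1"
    using reorder_sign_move[of "[v1, q]" c "[d, v2, p, a, b]" R] d(1) by simp
  ultimately show ?thesis
    using reorder_sign_trans[OF d(2) same_entries_sym[OF d(3)]] reorder_sign_sym[OF d(3)] by simp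
qed

text \<open>
  The renaming \<open>f\<close> of the two new vertices identifies the orientations that the two blow-ups
  inherit from \<open>\<omega>\<close>. It does not identify the canonical orientations: they then differ by the
  4-cycle of the half-edges \<open>a, b, c, d\<close>.
\<close>

lemma graph_act_opposite_splits:
  assumes G: "ribbon_graph G" and v: "v \<in> blacks G" and a: "a \<in> v" and card_v: "card v = 4"
    and others: "\<forall>u\<in>blacks G - {v}. card u = 3" and \<omega>: "orientation G \<omega>"
  shows "graph_act dual_numbers (blow_up a (nxt G a) (G, \<omega>)) w =
    - graph_act dual_numbers (blow_up (nxt G a) (nxt G (nxt G a)) (G, \<omega>)) w"
proof -
  let ?b = "nxt G a"
  let ?c = "nxt G ?b"
  let ?d = "nxt G ?c"
  let ?p = "fresh G" and ?q = "Suc (fresh G)"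
  note four = v_four[OF G v a card_v others]
  have b: "?b \<in> v"
    using four(1) by blast
  note A = G v a card_v others and B = G v b card_v others
  let ?Ga = "blow_graph a ?b G" and ?Gb = "blow_graph ?b ?c G"
  let ?R = "concat (map (corolla G) (filter (\<lambda>h. orbit (nxt G) h \<noteq> v) (sorted_list_of_set (Min ` blacks G)))) @ white_corolla G"
  let ?Ca = "[Inl {?q, ?c, ?d}, Inr ?q, Inr ?c, Inr ?d, Inl {?p, a, ?b}, Inr ?p, Inr a, Inr ?b] @ ?R"
  let ?Cb = "[Inl {?q, ?d, a}, Inr ?q, Inr ?d, Inr a, Inl {?p, ?b, ?c}, Inr ?p, Inr ?b, Inr ?c] @ ?R"
  let ?wa = "Inl {?p, a, ?b} # Inr ?q # Inr ?p # map (\<lambda>z. if z = Inl v then Inl {?q, ?c, ?d} else z) \<omega>"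
  let ?wb = "Inl {?p, ?b, ?c} # Inr ?q # Inr ?p # map (\<lambda>z. if z = Inl v then Inl {?q, ?d, a} else z) \<omega>"
  define f :: "nat set + nat \<Rightarrow> nat set + nat" where
    "f = (\<lambda>z. if z = Inl {?q, ?c, ?d} then Inl {?q, ?d, a} else if z = Inl {?p, a, ?b} then Inl {?p, ?b, ?c} else z)"
  have four_b: "nxt G ?d = a"
    by (rule four(3))
  have arcs: "orbit (nxt G) a = v" "orbit (nxt G) ?b = v" "arc G a ?b = {a, ?b}" "arc G ?b ?c = {?b, ?c}"
    by (rule v_orbit[OF A] v_orbit[OF B] arc_two[OF A] arc_two[OF B])+
  have wa: "blow_up a ?b (G, \<omega>) = (?Ga, ?wa)"
  proof -
    have "v - {a, ?b} = {?c, ?d}"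
      using four(1,2) by auto
    then show ?thesis
      by (simp add: blow_up_eq arcs)
  qed
  have wb: "blow_up ?b ?c (G, \<omega>) = (?Gb, ?wb)"
  proof -
    have "v - {?b, ?c} = {?d, a}"
      using four(1,2) by auto
    then show ?thesis
      by (simp add: blow_up_eq arcs)
  qed
  have oa: "orientation ?Ga ?wa"
    using orientation_new[OF A \<omega>] .
  have ob: "orientation ?Gb ?wb"
    using orientation_new[OF B \<omega>] unfolding four_b .
  have Ca: "orientation ?Ga ?Ca" "reorder_sign (canonical_orientation ?Ga) ?Ca = 1"
    using corollas_orientation[OF ribbon'[OF A] trivalent_new[OF A] reps_new[OF A]]
      reorder_sign_corollas[OF ribbon'[OF A] trivalent_new[OF A] reps_new[OF A]]
    unfolding corollas_new[OF A] by blast+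
  have Cb: "orientation ?Gb ?Cb" "reorder_sign (canonical_orientation ?Gb) ?Cb = 1"
    using corollas_orientation[OF ribbon'[OF B] trivalent_new[OF B] reps_new[OF B]]
      reorder_sign_corollas[OF ribbon'[OF B] trivalent_new[OF B] reps_new[OF B]]
    unfolding corollas_new[OF B] four_b by blast+
  have new: "{?q, ?c, ?d} \<notin> vertices G" "{?p, a, ?b} \<notin> vertices G"
    "{?q, ?d, a} \<notin> vertices G" "{?p, ?b, ?c} \<notin> vertices G"
    using new_not_vertex[OF A] new_not_vertex[OF B] unfolding four_b by blast+
  have ne: "{?q, ?c, ?d} \<noteq> {?p, a, ?b}" "{?q, ?d, a} \<noteq> {?p, ?b, ?c}"
    using fresh_v[OF A] four(1) by auto
  have f\<omega>: "map f ?wa = ?wb"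
  proof -
    have "f (if z = Inl v then Inl {?q, ?c, ?d} else z) = (if z = Inl v then Inl {?q, ?d, a} else z)"
      if "z \<in> set \<omega>" for z
      using that \<omega> new(1,2) by (auto simp: f_def orientation_def)
    moreover have "f (Inl {?p, a, ?b}) = Inl {?p, ?b, ?c}" "f (Inr i) = Inr i" for i
      using ne(1) by (simp_all add: f_def)
    ultimately show ?thesis
      by simp
  qed
  have fC: "map f ?Ca = [Inl {?q, ?d, a}, Inr ?q, Inr ?c, Inr ?d, Inl {?p, ?b, ?c}, Inr ?p, Inr a, Inr ?b] @ ?R" (is "_ = ?D")
  proof -
    have "distinct ?Ca"
      using Ca(1) by (simp add: orientation_def)
    then have "Inl {?q, ?c, ?d} \<notin> set ?R" "Inl {?p, a, ?b} \<notin> set ?R"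
      by auto
    then have "map f ?R = ?R"
      by (intro map_idI) (metis f_def)
    moreover have "f (Inl {?q, ?c, ?d}) = Inl {?q, ?d, a}" "f (Inl {?p, a, ?b}) = Inl {?p, ?b, ?c}" "f (Inr i) = Inr i" for i
      using ne(1) by (simp_all add: f_def)
    ultimately show ?thesis
      by (simp only: map_append list.map)
  qed
  have inj: "inj_on f (set ?Ca)"
  proof -
    have "set ?Ca = Inl ` vertices ?Ga \<union> Inr ` halves ?Ga"
      using Ca(1) by (simp add: orientation_def)
    moreover have "a \<notin> {?q, ?c, ?d}" "?c \<notin> {?p, a, ?b}" "?d \<notin> {?p, a, ?b}" "?b \<notin> {?q, ?c, ?d}"
      using four(2) fresh_v[OF A] four(1) by auto
    then have "{?q, ?d, a} \<noteq> {?q, ?c, ?d}" "{?p, ?b, ?c} \<noteq> {?p, a, ?b}"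
      "{?q, ?d, a} \<noteq> {?p, a, ?b}" "{?p, ?b, ?c} \<noteq> {?q, ?c, ?d}"
      by (metis insertCI)+
    then have "{?q, ?d, a} \<notin> vertices ?Ga" "{?p, ?b, ?c} \<notin> vertices ?Ga"
      using new(3,4) unfolding vertices_new[OF A] by simp_all
    ultimately show ?thesis
      unfolding f_def using ne(2) by (intro inj_on_rename) auto
  qed
  have CD: "reorder_sign ?Cb ?D = - 1"
  proof -
    have "distinct ?Cb"
      using Cb(1) by (simp add: orientation_def)
    then show ?thesis
      by (rule reorder_sign_rotate_legs)
  qed
  note sa = orientation_same_entries[OF Ca(1) oa]
  have "reorder_sign (canonical_orientation ?Ga) ?wa = reorder_sign ?Ca ?wa"
    using reorder_sign_trans[OF orientation_same_entries[OF orientation_canonical[OF ribbon'[OF A] trivalent_new[OF A]] Ca(1)] sa]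
      Ca(2) by simp
  moreover have "reorder_sign (canonical_orientation ?Gb) ?wb = - reorder_sign ?Ca ?wa"
  proof -
    have s: "same_entries ?D ?wb"
      using same_entries_map[OF sa inj] unfolding fC f\<omega> .
    have "reorder_sign ?D ?wb = reorder_sign ?Ca ?wa"
      using reorder_sign_inj_map[OF sa inj] unfolding fC f\<omega> .
    moreover have "same_entries ?Cb ?wb"
      using orientation_same_entries[OF Cb(1) ob] .
    then have "reorder_sign ?Cb ?wb = reorder_sign ?Cb ?D * reorder_sign ?D ?wb"
      using s same_entries_sym same_entries_trans by (intro reorder_sign_trans) blast+
    moreover have "reorder_sign (canonical_orientation ?Gb) ?wb = reorder_sign ?Cb ?wb"
      using reorder_sign_trans[OF orientation_same_entries[OF orientation_canonical[OF ribbon'[OF B] trivalent_new[OF B]] Cb(1)]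
          orientation_same_entries[OF Cb(1) ob]] Cb(2) by simp
    ultimately show ?thesis
      using CD by simp
  qed
  ultimately show ?thesis
    unfolding wa wb graph_act_dual_numbers[OF ribbon'[OF A] trivalent_new[OF A]]
      graph_act_dual_numbers[OF ribbon'[OF B] trivalent_new[OF B]] state_sum_new[OF A] state_sum_new[OF B]
    by simp
qed

text \<open>
  A vertex of valence \<open>n\<close> splits into two whose valences add up to \<open>n + 2\<close>, so both can be trivalent only
  for \<open>n = 4\<close>. Instead of determining the new orbits completely, the proof exhibits enough of their
  elements to rule out the other cases.
\<close>

lemma trivalent_split:
  assumes G: "ribbon_graph G" and v: "v \<in> blacks G" and a: "a \<in> v" and b: "b \<in> v"
    and arc: "2 \<le> card (arc G a b)" "2 \<le> card (v - arc G a b)"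
    and low: "\<not> high_valence (blow_graph a b G)"
  shows "b = nxt G a" and "card v = 4" and "\<And>u. u \<in> blacks G \<Longrightarrow> u \<noteq> v \<Longrightarrow> card u < 4"
proof -
  let ?G = "blow_graph a b G"
  have vv: "v \<in> vertices G" "v \<noteq> white G"
    using v by (auto simp: blacks_def)
  note R = blow_graph_ribbon[OF G vv(1) a b]
  show others: "card u < 4" if "u \<in> blacks G" "u \<noteq> v" for u
    using low blow_graph_black_outside[OF G vv(1) a b that] by (force simp: high_valence_def)
  have start: "start G \<notin> v"
    using start_white[OF G] vertices_disjoint[OF G vv(1) white_vertex[OF G] vv(2)] by blast
  then have "start G \<notin> arc G a b"
    using arc_facts(1)[OF G vv(1) a b] by blast
  then have w: "white ?G = white G"
    using start G blow_graph_orbit_outside[OF G vv(1) a b]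
    by (simp add: white_def blow_graph_simps ribbon_graph_def)
  have new: "card (orbit (nxt ?G) h) < 4" if "h \<in> {fresh G, Suc (fresh G)}" for h
  proof -
    have "orbit (nxt ?G) h \<in> vertices ?G"
      using that by (auto simp: vertices_def blow_graph_simps(1))
    moreover have "h \<notin> white G"
      using that fresh_notin[OF G] vertex_subset[OF G white_vertex[OF G]] by blast
    then have "orbit (nxt ?G) h \<noteq> white ?G"
      using w orbit_nxt_self[OF R] by metis
    ultimately show ?thesis
      using low by (force simp: blacks_def high_valence_def)
  qed
  define D where "D = funpow_dist (nxt G) a b"
  have vo: "orbit (nxt G) a = v" "orbit (nxt G) b = v"
    using vertices_orbit[OF G vv(1)] a b by auto
  have Db: "(nxt G ^^ D) a = b"
    unfolding D_def using funpow_dist_prop vo(1) b by metis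
  have cardarc: "card (arc G a b) = Suc D"
    unfolding D_def by (rule arc_facts(2)[OF G vv(1) a b])
  have pv: "fresh G \<notin> v" "Suc (fresh G) \<notin> v"
    using fresh_notin[OF G] vertex_subset[OF G vv(1)] by auto
  \<comment> \<open>from \<open>p\<close> the new cyclic ordering runs through the whole arc\<close>
  have pow: "(nxt ?G ^^ Suc i) (fresh G) = (nxt G ^^ i) a" if "i \<le> D" for i
    using that
  proof (induction i)
    case 0
    then show ?case by (simp add: blow_graph_simps)
  next
    case (Suc i)
    have ne: "(nxt G ^^ i) a \<noteq> b" "(nxt G ^^ Suc i) a \<noteq> a"
      using funpow_neq_less_funpow_dist[of b "nxt G" a i D] funpow_neq_less_funpow_dist[of b "nxt G" a "Suc i" 0]
        Suc.prems vo(1) b Db by (auto simp: D_def)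
    have "(nxt G ^^ i) a \<in> v"
      using funpow_in_orbit[OF orbit_nxt_self[OF G]] vo(1) by blast
    then have "(nxt G ^^ i) a \<noteq> fresh G" "(nxt G ^^ i) a \<noteq> Suc (fresh G)"
      using pv by auto
    then show ?case
      using Suc ne by (simp add: blow_graph_simps)
  qed
  have "insert (fresh G) (arc G a b) \<subseteq> orbit (nxt ?G) (fresh G)"
  proof -
    have "(nxt G ^^ i) a \<in> orbit (nxt ?G) (fresh G)" if "i \<le> D" for i
      using funpow_in_orbit[OF orbit_nxt_self[OF R], of "Suc i" "fresh G"] pow[OF that] by simp
    then show ?thesis
      using orbit_nxt_self[OF R] by (auto simp: arc_def D_def)
  qed
  moreover have "finite (orbit (nxt ?G) (fresh G))" "finite (orbit (nxt ?G) (Suc (fresh G)))"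
    using orbit_nxt_self[OF R] by (simp_all add: finite_orbit)
  moreover have "card (insert (fresh G) (arc G a b)) = Suc (Suc D)"
    using cardarc pv arc_facts(1)[OF G vv(1) a b] vertex_finite[OF G vv(1)] finite_subset
    by (subst card_insert_disjoint) auto
  ultimately have "Suc (Suc D) < 4"
    using new[of "fresh G"] card_mono by (metis insertI1 le_less_trans)
  then have D: "D = 1"
    using arc(1) cardarc by simp
  then show ab: "b = nxt G a"
    using Db by simp
  have "card (v - arc G a b) = card v - 2"
    using card_Diff_subset[of "arc G a b" v] cardarc D arc_facts(1)[OF G vv(1) a b]
      vertex_finite[OF G vv(1)] finite_subset by fastforce
  then have ge: "4 \<le> card v"
    using arc(2) by simp
  have "\<not> 5 \<le> card v"
  proof
    assume five: "5 \<le> card v"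
    have dist: "inj_on (\<lambda>i. (nxt G ^^ i) a) {0..<card v}"
      using orbit_list(1)[OF permutation_nxt[OF G], of a] vo(1) by (simp add: distinct_map)
    have neq: "(nxt G ^^ i) a \<noteq> (nxt G ^^ j) a" if "i < j" "j < 5" for i j
      using inj_onD[OF dist, of i j] that five by auto
    define x where "x i = (nxt G ^^ i) a" for i
    have x: "nxt G (x i) = x (Suc i)" "b = x 1" for i
      by (simp_all add: x_def ab)
    have xn: "x i \<noteq> x j" if "i < j" "j < 5" for i j
      using neq that by (simp add: x_def)
    have xq: "x i \<in> v" for i
      unfolding x_def using funpow_in_orbit[OF orbit_nxt_self[OF G]] vo(1) by blast
    then have xp: "x i \<noteq> fresh G" "x i \<noteq> Suc (fresh G)" for i
      using pv by metis+
    have a0: "a = x 0"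
      by (simp add: x_def)
    have n: "nxt ?G (Suc (fresh G)) = x 2" "nxt ?G (x 2) = x 3" "nxt ?G (x 3) = x 4"
      using xn[of 0 2] xn[of 0 3] xn[of 0 4] xn[of 1 2] xn[of 1 3] xp[of 1] xp[of 2] xp[of 3]
      by (simp_all add: blow_graph_simps x(1) x(2) a0 numeral_eq_Suc)
    \<comment> \<open>a fifth half-edge at \<open>v\<close> would make the vertex of \<open>q\<close> at least 4-valent\<close>
    let ?S = "{Suc (fresh G), x 2, x 3, x 4}"
    have "?S \<subseteq> orbit (nxt ?G) (Suc (fresh G))"
      using orbit_nxt_self[OF R] orbit.base[of "nxt ?G" "Suc (fresh G)"] orbit.step[of "x 2" "nxt ?G" "Suc (fresh G)"]
        orbit.step[of "x 3" "nxt ?G" "Suc (fresh G)"] by (simp add: n)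
    moreover have "card ?S = 4"
      using xn[of 2 3] xn[of 2 4] xn[of 3 4] xp[of 2] xp[of 3] xp[of 4] by auto
    moreover have "finite (orbit (nxt ?G) (Suc (fresh G)))"
      using orbit_nxt_self[OF R] by (simp add: finite_orbit)
    ultimately have "4 \<le> card (orbit (nxt ?G) (Suc (fresh G)))"
      by (metis card_mono)
    then show False
      using new[of "Suc (fresh G)"] by simp
  qed
  then show "card v = 4"
    using ge by simp
qed

section \<open>Spans\<close>

lemma frag_span_add:
  assumes "x \<in> frag_span S" "y \<in> frag_span S"
  shows "x + y \<in> frag_span S"
proof -
  obtain c d where cd: "x = frag_extend (\<lambda>x. x) c" "Poly_Mapping.keys c \<subseteq> S"
    "y = frag_extend (\<lambda>x. x) d" "Poly_Mapping.keys d \<subseteq> S"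
    using assms by (auto simp: frag_span_def)
  then have "x + y = frag_extend (\<lambda>x. x) (c + d)" "Poly_Mapping.keys (c + d) \<subseteq> S"
    using keys_add[of c d] by (auto simp: frag_extend_add)
  then show ?thesis
    unfolding frag_span_def by auto
qed

lemma frag_span_minus:
  assumes "x \<in> frag_span S"
  shows "- x \<in> frag_span S"
proof -
  obtain c where c: "x = frag_extend (\<lambda>x. x) c" "Poly_Mapping.keys c \<subseteq> S"
    using assms by (auto simp: frag_span_def)
  then have "- x = frag_extend (\<lambda>x. x) (- c)" "Poly_Mapping.keys (- c) \<subseteq> S"
    by (auto simp: frag_extend_minus)
  then show ?thesis
    unfolding frag_span_def by auto
qed

lemma frag_span_0: "0 \<in> frag_span S"
  unfolding frag_span_def by (rule image_eqI[of _ _ 0]) simp_all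

lemma frag_span_base: "x \<in> S \<Longrightarrow> x \<in> frag_span S"
  unfolding frag_span_def by (rule image_eqI[of _ _ "frag_of x"]) simp_all

lemma frag_span_induct [consumes 1, case_names zero base diff]:
  assumes "x \<in> frag_span S" and "P 0" and "\<And>x. x \<in> S \<Longrightarrow> P x"
    and "\<And>a b. P a \<Longrightarrow> P b \<Longrightarrow> P (a - b)"
  shows "P x"
proof -
  obtain c where c: "x = frag_extend (\<lambda>x. x) c" "Poly_Mapping.keys c \<subseteq> S"
    using assms(1) by (auto simp: frag_span_def)
  from c(2) have "P (frag_extend (\<lambda>x. x) c)"
    by (induction rule: frag_induction) (use assms in \<open>auto simp: frag_extend_diff\<close>)
  then show ?thesis
    by (simp add: c(1))
qed

lemma frag_span_subgroup:
  assumes "\<And>x. x \<in> S \<Longrightarrow> Poly_Mapping.keys x \<subseteq> T"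
  shows "subgroup (frag_span S) (free_Abelian_group T)"
proof
  have keys: "Poly_Mapping.keys x \<subseteq> T" if "x \<in> frag_span S" for x
    using that
  proof (induction rule: frag_span_induct)
    case (diff a b)
    then show ?case
      using keys_diff[of a b] by blast
  qed (use assms in auto)
  then show "frag_span S \<subseteq> carrier (free_Abelian_group T)"
    by auto
  show "inv\<^bsub>free_Abelian_group T\<^esub> x \<in> frag_span S" if "x \<in> frag_span S" for x
    using keys[OF that] that by (simp add: frag_span_minus)
qed (auto simp: frag_span_add frag_span_0)

lemma free_Abelian_normal: "subgroup H (free_Abelian_group T) \<Longrightarrow> H \<lhd> free_Abelian_group T"
  by (simp add: abelian_free_Abelian_group comm_group.normal_iff_subgroup)


section \<open>The relations act by zero\<close>

lemma finite_white_splits: "ribbon_graph G \<Longrightarrow> finite (white_splits G)"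
proof -
  assume G: "ribbon_graph G"
  have "white_splits G \<subseteq> white G \<times> white G"
    by (auto simp: white_splits_def)
  then show ?thesis
    using vertex_finite[OF G white_vertex[OF G]] finite_subset by blast
qed

lemma finite_black_splits: "ribbon_graph G \<Longrightarrow> finite (black_splits G)"
proof -
  assume G: "ribbon_graph G"
  have "black_splits G \<subseteq> halves G \<times> halves G"
    using vertex_subset[OF G] by (auto simp: black_splits_def blacks_def)
  then show ?thesis
    using G finite_subset by (auto simp: ribbon_graph_def)
qed

text \<open>
  The listed splittings are those whose arc avoids the least half-edge. At a 4-valent vertex both arcs
  have two elements, which leaves the second and third, or the third and fourth half-edge.
\<close>

lemma black_splits_four:
  assumes G: "ribbon_graph G" and v: "v \<in> blacks G" and four: "card v = 4"
    and others: "\<forall>u\<in>blacks G - {v}. card u = 3"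
  shows "black_splits G = {(nxt G (Min v), nxt G (nxt G (Min v))),
    (nxt G (nxt G (Min v)), nxt G (nxt G (nxt G (Min v))))}"
proof -
  let ?a = "Min v"
  let ?b = "nxt G ?a"
  let ?c = "nxt G ?b"
  let ?d = "nxt G ?c"
  have vv: "v \<in> vertices G"
    using v by (simp add: blacks_def)
  have a: "?a \<in> v"
    using vertex_Min[OF G vv] .
  note f = v_four[OF G v a four others]
  have fin: "finite v"
    using vertex_finite[OF G vv] .
  have b: "?b \<in> v" "?c \<in> v"
    using f(1) by auto
  show ?thesis
  proof (intro equalityI subsetI)
    fix x assume "x \<in> black_splits G"
    then obtain h k u where x: "x = (h, k)" and u: "u \<in> blacks G" "h \<in> u" "k \<in> u"
      "2 \<le> card (arc G h k)" "2 \<le> card (u - arc G h k)" "Min u \<notin> arc G h k"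
      by (auto simp: black_splits_def)
    have uv: "u \<in> vertices G"
      using u(1) by (simp add: blacks_def)
    note arc = arc_facts[OF G uv u(2,3)]
    have card: "card u = card (arc G h k) + card (u - arc G h k)"
      using arc(1) vertex_finite[OF G uv] by (metis add_diff_inverse_nat card_Diff_subset card_mono finite_subset not_le)
    then have "card u \<noteq> 3"
      using u(4,5) by simp
    then have uv': "u = v"
      using u(1) others by blast
    then have "funpow_dist (nxt G) h k = 1"
      using card u(4,5) four arc(2) by simp
    moreover have "k \<in> orbit (nxt G) h"
      using vertices_orbit[OF G uv u(2)] u(3) by simp
    ultimately have k: "k = nxt G h"
      using funpow_dist_prop[of k "nxt G" h] by simp
    have "arc G h k = {h, k}"
      using arc_two[OF G v _ four others] u(2) uv' k by blast
    then have "h \<noteq> ?a" "nxt G h \<noteq> ?a"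
      using u(6) uv' k by auto
    moreover have "h \<in> {?a, ?b, ?c, ?d}"
      using u(2) uv' f(1) by simp
    ultimately show "x \<in> {(?b, ?c), (?c, ?d)}"
      using f(3) x k by auto
  next
    fix x assume "x \<in> {(?b, ?c), (?c, ?d)}"
    have "(h, nxt G h) \<in> black_splits G" if h: "h \<in> v" "h \<noteq> ?a" "nxt G h \<noteq> ?a" for h
    proof -
      have arc: "arc G h (nxt G h) = {h, nxt G h}"
        using arc_two[OF G v h(1) four others] .
      have hn: "h \<noteq> nxt G h" "nxt G h \<in> v"
        using v_four[OF G v h(1) four others] by auto
      then have "card {h, nxt G h} = 2" "card (v - {h, nxt G h}) = 2"
        using h(1) four fin by (simp_all add: card_Diff_subset)
      then have "h \<in> v \<and> nxt G h \<in> v \<and> 2 \<le> card (arc G h (nxt G h)) \<and>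
          2 \<le> card (v - arc G h (nxt G h)) \<and> ?a \<notin> arc G h (nxt G h)"
        unfolding arc using h hn(2) by (metis insertE order_refl singletonD)
      then show ?thesis
        unfolding black_splits_def mem_Collect_eq case_prod_conv using v by blast
    qed
    then show "x \<in> black_splits G"
    proof -
      have "?b \<noteq> ?a" "?c \<noteq> ?a" "?d \<noteq> ?a"
        using f(2) by simp_all
      then show ?thesis
        using \<open>x \<in> {(?b, ?c), (?c, ?d)}\<close> b
          \<open>\<And>h. h \<in> v \<Longrightarrow> h \<noteq> ?a \<Longrightarrow> nxt G h \<noteq> ?a \<Longrightarrow> (h, nxt G h) \<in> black_splits G\<close>
        by blast
    qed
  qed
qed

text \<open>
  If some splitting acts nontrivially, \<open>trivalent_split\<close> shows that the graph has a single black vertex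
  of valence different from 3, and that it is 4-valent. Then only its two splittings are in the sum.
\<close>

lemma black_splits_cancel:
  assumes G: "sullivan_graph n G" and \<omega>: "orientation G \<omega>"
  shows "(\<Sum>(a, b)\<in>black_splits G. graph_act dual_numbers (blow_up a b (G, \<omega>)) w) = 0"
proof (cases "\<forall>(a, b)\<in>black_splits G. graph_act dual_numbers (blow_up a b (G, \<omega>)) w = 0")
  case True
  then show ?thesis
    by (intro sum.neutral) auto
next
  case False
  note R = sullivan_ribbon[OF G]
  obtain a b where ab: "(a, b) \<in> black_splits G" "graph_act dual_numbers (blow_up a b (G, \<omega>)) w \<noteq> 0"
    using False by auto
  then obtain v where v: "v \<in> blacks G" "a \<in> v" "b \<in> v" "2 \<le> card (arc G a b)" "2 \<le> card (v - arc G a b)"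
    by (auto simp: black_splits_def)
  have "\<not> high_valence (blow_graph a b G)"
    using ab(2) graph_act_high_valence by (auto simp: blow_up_eq)
  note split = trivalent_split[OF R v this]
  have others: "\<forall>u\<in>blacks G - {v}. card u = 3"
    using split(3) G by (force simp: sullivan_graph_def)
  have vv: "v \<in> vertices G"
    using v(1) by (simp add: blacks_def)
  let ?h = "Min v"
  have h: "?h \<in> v" "nxt G ?h \<in> v"
    using vertex_Min[OF R vv] nxt_in_v[OF R vv] by auto
  have "nxt G ?h \<noteq> nxt G (nxt G ?h)"
    using v_four(2)[OF R v(1) h(1) split(2) others] by simp
  then show ?thesis
    using graph_act_opposite_splits[OF R v(1) h(2) split(2) others \<omega>, of w]
    by (simp add: black_splits_four[OF R v(1) split(2) others])
qed

lemma graph_act_boundary: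
  assumes G: "sullivan_graph n G" and \<omega>: "orientation G \<omega>" and hv: "high_valence G"
  shows "frag_extend (\<lambda>X. graph_act dual_numbers X w) (graph_bd (G, \<omega>)) = 0"
proof -
  note R = sullivan_ribbon[OF G]
  let ?A = "frag_extend (\<lambda>X. graph_act dual_numbers X w)"
  have "?A (\<Sum>(a, b)\<in>white_splits G. white_term a b (G, \<omega>)) = (\<Sum>(a, b)\<in>white_splits G. ?A (white_term a b (G, \<omega>)))"
    using finite_white_splits[OF R] by (simp add: frag_extend_sum case_prod_unfold o_def)
  also have "\<dots> = 0"
    using high_valence_white_term[OF R hv] by (intro sum.neutral) (auto simp: white_splits_def)
  finally have 1: "?A (\<Sum>(a, b)\<in>white_splits G. white_term a b (G, \<omega>)) = 0" .
  have "?A (\<Sum>(a, b)\<in>black_splits G. frag_of (blow_up a b (G, \<omega>))) =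
      (\<Sum>(a, b)\<in>black_splits G. graph_act dual_numbers (blow_up a b (G, \<omega>)) w)"
    using finite_black_splits[OF R] by (simp add: frag_extend_sum case_prod_unfold o_def)
  also have "\<dots> = 0"
    using black_splits_cancel[OF G \<omega>] .
  finally show ?thesis
    using 1 by (simp add: graph_bd_def frag_extend_add)
qed

text \<open>
  Lets the action of a relation be tested on single words.
\<close>

lemma frag_extend_swap:
  "frag_extend (\<lambda>X. frag_extend (f X) a) c = frag_extend (\<lambda>w. frag_extend (\<lambda>X. f X w) c) a"
  by (simp add: frag_extend_def frag_cmul_sum sum.swap[of _ "Poly_Mapping.keys a"] mult.commute)

lemma SD_relations_act:
  assumes "c \<in> SD_relations n d"
  shows "SD_act dual_numbers c a = 0"
proof -
  have "frag_extend (\<lambda>X. graph_act dual_numbers X w) c = 0" for w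
    using assms unfolding SD_relations_def
  proof (induction rule: frag_span_induct)
    case (base x)
    then consider
      (reorder) G \<omega> \<pi> where "x = frag_of (G, map \<pi> \<omega>) - frag_cmul (sign \<pi>) (frag_of (G, \<omega>))"
        "(G, \<omega>) \<in> oriented_graphs n d" "\<pi> permutes set \<omega>"
      | (relabel) \<phi> X where "x = frag_of (relabel \<phi> X) - frag_of X" "X \<in> oriented_graphs n d" "bij \<phi>"
      | (high) X where "x = frag_of X" "high_valence (fst X)"
      | (boundary) X where "x = graph_bd X" "X \<in> oriented_graphs n (d + 1)" "high_valence (fst X)"
      by blast
    then show ?case
    proof cases
      case reorder
      then show ?thesis
        by (auto simp: oriented_graphs_def frag_extend_diff frag_extend_cmul graph_act_reorder)
    next
      case relabel
      obtain G \<omega> where "X = (G, \<omega>)"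
        by (cases X)
      then show ?thesis
        using relabel by (auto simp: oriented_graphs_def frag_extend_diff graph_act_relabel)
    next
      case high
      then show ?thesis
        by (cases X) (simp add: graph_act_high_valence)
    next
      case boundary
      obtain G \<omega> where "X = (G, \<omega>)"
        by (cases X)
      then show ?thesis
        using boundary by (auto simp: oriented_graphs_def graph_act_boundary)
    qed
  qed (simp_all add: frag_extend_diff)
  then show ?thesis
    unfolding SD_act_def by (subst frag_extend_swap) (simp add: frag_extend_eq_0)
qed


section \<open>The graphs mu\<close>

lemma legs_pos: "0 < legs t"
  by (induction t) auto

text \<open>
  Both structure permutations of the graphs \<open>\<mu>\<close> are such products: the vertices are disjoint cycles, and
  an edge is a cycle of length 2.
\<close>

definition cycles_product :: "'a list list \<Rightarrow> 'a \<Rightarrow> 'a" where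
  "cycles_product css = foldr (\<circ>) (map cycle_of_list css) id"

lemma cycles_product_simps:
  "cycles_product [] = id" "cycles_product (cs # css) = cycle_of_list cs \<circ> cycles_product css"
  by (auto simp: cycles_product_def fun_eq_iff)

lemma cycles_product:
  assumes "distinct (concat css)" and "cs \<in> set css" and "x \<in> set cs"
  shows "cycles_product css x = cycle_of_list cs x"
  using assms
proof (induction css)
  case Nil
  then show ?case by simp
next
  case (Cons ds css)
  have out: "cycles_product css y = y" if "y \<notin> set (concat css)" for y
    using that by (induction css) (auto simp: cycles_product_simps id_outside_supp)
  show ?case
  proof (cases "cs = ds")
    case True
    then have "x \<notin> set (concat css)"
      using Cons.prems by auto
    then show ?thesis
      using True out by (simp add: cycles_product_simps)
  next
    case False
    then have cs: "cs \<in> set css"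
      using Cons.prems(2) by simp
    have "cycle_of_list cs x \<in> set cs"
      using permutes_in_image[OF cycle_permutes] Cons.prems(3) by metis
    then have "cycle_of_list cs x \<notin> set ds"
      using cs Cons.prems(1) by auto
    then show ?thesis
      using Cons.IH[OF _ cs Cons.prems(3)] Cons.prems(1) by (simp add: cycles_product_simps id_outside_supp)
  qed
qed

lemma cycles_product_permutes: "cycles_product css permutes set (concat css)"
proof (induction css)
  case Nil
  show ?case
    unfolding cycles_product_simps by (rule permutes_id)
next
  case (Cons cs css)
  have "cycle_of_list cs permutes set (concat (cs # css))"
    by (rule permutes_subset[OF cycle_permutes]) auto
  moreover have "cycles_product css permutes set (concat (cs # css))"
    by (rule permutes_subset[OF Cons.IH]) auto
  ultimately show ?case
    unfolding cycles_product_simps by (rule permutes_compose[rotated])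
qed

lemma cycle_of_list_nth:
  assumes "distinct cs" and "i < length cs"
  shows "cycle_of_list cs (cs ! i) = cs ! (Suc i mod length cs)"
proof -
  have "map (cycle_of_list cs) cs = rotate1 cs"
    using cyclic_rotation[OF assms(1), of 1] by simp
  then show ?thesis
    using assms(2) by (metis nth_map nth_rotate1)
qed

lemma cycle_of_list_3:
  assumes "distinct [x, y, z]"
  shows "cycle_of_list [x, y, z] x = y" "cycle_of_list [x, y, z] y = z" "cycle_of_list [x, y, z] z = x"
  using assms by (auto simp: transpose_def)

lemma upt_split: "i \<le> j \<Longrightarrow> j \<le> n \<Longrightarrow> [i..<n] = [i..<j] @ [j..<n]"
  by (metis le_iff_add upt_add_eq_append)

text \<open>
  The numbering of the black half-edges: first the root vertex, then the left and the right subtree.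
\<close>

lemma upt_fork:
  "[f..<f + 3 * (legs (Fork l r) - 1)] =
     [f, f + 1, f + 2] @ [f + 3..<f + 3 + 3 * (legs l - 1)] @ [f + 3 * legs l..<f + 3 * legs l + 3 * (legs r - 1)]"
proof -
  obtain i j where ij: "legs l = Suc i" "legs r = Suc j"
    using legs_pos[of l] legs_pos[of r] by (metis gr0_implies_Suc)
  have "[f..<f + 3 * (legs (Fork l r) - 1)] = [f..<f + 3] @ [f + 3..<f + 3 * (legs (Fork l r) - 1)]"
    by (rule upt_split) (simp_all add: ij)
  also have "[f + 3..<f + 3 * (legs (Fork l r) - 1)] =
      [f + 3..<f + 3 + 3 * (legs l - 1)] @ [f + 3 + 3 * (legs l - 1)..<f + 3 * (legs (Fork l r) - 1)]"
    by (rule upt_split) (simp_all add: ij)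
  also have "f + 3 + 3 * (legs l - 1) = f + 3 * legs l"
    by (simp add: ij)
  also have "f + 3 * (legs (Fork l r) - 1) = f + 3 * legs l + 3 * (legs r - 1)"
    by (simp add: ij)
  also have "[f..<f + 3] = [f, f + 1, f + 2]"
    by (simp add: numeral_3_eq_3 upt_rec)
  finally show ?thesis
    by (simp add: ij add.assoc)
qed

lemma concat_tree_vertices: "concat (tree_vertices t f) = [f..<f + 3 * (legs t - 1)]"
proof (induction t arbitrary: f)
  case (Fork l r)
  then show ?case
    unfolding upt_fork by simp
qed simp

lemma tree_vertices_form:
  "vs \<in> set (tree_vertices t f) \<Longrightarrow> \<exists>j<legs t - 1. vs = [f + 3 * j, f + 3 * j + 1, f + 3 * j + 2]"
proof (induction t arbitrary: f)
  case Leg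
  then show ?case by simp
next
  case (Fork l r)
  from Fork.prems consider "vs = [f, f + 1, f + 2]" | "vs \<in> set (tree_vertices l (f + 3))"
    | "vs \<in> set (tree_vertices r (f + 3 * legs l))"
    by auto
  then show ?case
  proof cases
    case 1
    then show ?thesis
      using legs_pos[of l] legs_pos[of r] by (intro exI[of _ 0]) simp
  next
    case 2
    then obtain j where "j < legs l - 1" "vs = [f + 3 + 3 * j, f + 3 + 3 * j + 1, f + 3 + 3 * j + 2]"
      using Fork.IH(1) by blast
    then show ?thesis
      using legs_pos[of r] by (intro exI[of _ "Suc j"]) (simp)
  next
    case 3
    then obtain j where "j < legs r - 1"
      "vs = [f + 3 * legs l + 3 * j, f + 3 * legs l + 3 * j + 1, f + 3 * legs l + 3 * j + 2]"
      using Fork.IH(2) by blast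
    then show ?thesis
      using legs_pos[of l] by (intro exI[of _ "legs l + j"]) (simp add: algebra_simps)
  qed
qed

lemma mset_tree_edges:
  "mset (concat (map (\<lambda>(x, y). [x, y]) (tree_edges t h m f))) =
     {#h#} + mset (map (\<lambda>i. m + 2 * i) [0..<legs t]) + mset [f..<f + 3 * (legs t - 1)]"
proof (induction t arbitrary: h m f)
  case Leg
  then show ?case by simp
next
  case (Fork l r)
  have "[0..<legs (Fork l r)] = [0..<legs l] @ map (\<lambda>i. i + legs l) [0..<legs r]"
    using upt_add_eq_append[of 0 "legs l" "legs r"] by (simp add: map_add_upt add.commute)
  then have M: "map (\<lambda>i. m + 2 * i) [0..<legs (Fork l r)] =
      map (\<lambda>i. m + 2 * i) [0..<legs l] @ map (\<lambda>i. m + 2 * legs l + 2 * i) [0..<legs r]"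
    by (simp add: o_def add_mult_distrib2 add.assoc add.left_commute)
  show ?case
    unfolding upt_fork M by (simp add: Fork ac_simps)
qed

lemma tree_edges_endpoints:
  "(\<Union>(x, y)\<in>set (tree_edges t h m f). {x, y}) =
     insert h ((\<lambda>i. m + 2 * i) ` {..<legs t} \<union> {f..<f + 3 * (legs t - 1)})"
proof -
  have "set (concat (map (\<lambda>(x, y). [x, y]) (tree_edges t h m f))) =
      insert h ((\<lambda>i. m + 2 * i) ` {..<legs t} \<union> {f..<f + 3 * (legs t - 1)})"
    using arg_cong[OF mset_tree_edges[of t h m f], of set_mset] by (simp add: lessThan_atLeast0)
  then show ?thesis
    by (simp add: case_prod_unfold)
qed

text \<open>
  Reading \<open>C\<close> as coloured \<open>x\<close>, the assumed pattern is the only possible one: if the edge above a fork has 1 at its upper end, the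
  root half-edge of the fork must carry \<open>x\<close>, and then its other two half-edges carry 1 and are in turn
  upper ends of this kind. So the colouring propagates from the root to the legs.
\<close>

lemma tree_edges_colour:
  assumes "(x, y) \<in> set (tree_edges t h m f)"
    and "\<not> C h" and "\<And>i. i < legs t \<Longrightarrow> C (m + 2 * i)"
    and "\<And>j. j < legs t - 1 \<Longrightarrow> C (f + 3 * j) \<and> \<not> C (f + 3 * j + 1) \<and> \<not> C (f + 3 * j + 2)"
  shows "C x \<longleftrightarrow> \<not> C y"
  using assms
proof (induction t arbitrary: h m f)
  case Leg
  then show ?case by simp
next
  case (Fork l r)
  note pos = legs_pos[of l] legs_pos[of r]
  have root: "C f" "\<not> C (f + 1)" "\<not> C (f + 2)"
    using Fork.prems(4)[of 0] pos by auto
  from Fork.prems(1) consider "x = h" "y = f" | "(x, y) \<in> set (tree_edges l (f + 2) m (f + 3))"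
    | "(x, y) \<in> set (tree_edges r (f + 1) (m + 2 * legs l) (f + 3 * legs l))"
    by auto
  then show ?case
  proof cases
    case 1
    then show ?thesis using root Fork.prems(2) by simp
  next
    case 2
    then show ?thesis
    proof (rule Fork.IH(1))
      show "C (f + 3 + 3 * j) \<and> \<not> C (f + 3 + 3 * j + 1) \<and> \<not> C (f + 3 + 3 * j + 2)" if "j < legs l - 1" for j
        using Fork.prems(4)[of "Suc j"] that pos by (simp add: add.assoc)
    qed (use root Fork.prems(3) in auto)
  next
    case 3
    then show ?thesis
    proof (rule Fork.IH(2))
      show "C (m + 2 * legs l + 2 * i)" if "i < legs r" for i
        using Fork.prems(3)[of "legs l + i"] that by (simp add: algebra_simps)
      show "C (f + 3 * legs l + 3 * j) \<and> \<not> C (f + 3 * legs l + 3 * j + 1) \<and> \<not> C (f + 3 * legs l + 3 * j + 2)"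
        if "j < legs r - 1" for j
        using Fork.prems(4)[of "legs l + j"] that by (simp add: algebra_simps)
    qed (use root in auto)
  qed
qed

text \<open>
  A planar tree cuts the outside of the white disc into regions, numbered from left to right; region
  \<open>c + i\<close> lies in front of leg \<open>i\<close> of a tree whose first leg is preceded by region \<open>c\<close>. The list assigns to
  the half-edges of the tree, in the order of their numbering, the region along which the boundary cycle
  runs that leaves through them: at a fork, that is the region left of its subtree for the root, the one
  right of it for the right branch, and the one between the branches for the left branch.
\<close>

fun tree_regions :: "ptree \<Rightarrow> nat \<Rightarrow> nat list" where
  "tree_regions Leg c = []"
| "tree_regions (Fork l r) c =
     [c, c + (legs l + legs r), c + legs l] @ tree_regions l c @ tree_regions r (c + legs l)"

lemma length_tree_regions: "length (tree_regions t c) = 3 * (legs t - 1)"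
proof (induction t arbitrary: c)
  case (Fork l r)
  then show ?case
    using legs_pos[of l] legs_pos[of r] by (simp)
qed simp

text \<open>
  Boundary cycles stay in one region. The two conclusions concern the two directions of an edge: a
  boundary cycle that goes out along \<open>x\<close> continues with \<open>nx y\<close>, and conversely.
\<close>

lemma tree_edges_region:
  assumes "(x, y) \<in> set (tree_edges t h m f)"
    and "\<And>u v w. [u, v, w] \<in> set (tree_vertices t f) \<Longrightarrow> nx u = v \<and> nx v = w \<and> nx w = u"
    and "R (nx h) = c" and "R h = c + legs t"
    and "\<And>i. i < legs t \<Longrightarrow> R (m + 2 * i) = c + i \<and> R (nx (m + 2 * i)) = c + i + 1"
    and "\<And>i. i < 3 * (legs t - 1) \<Longrightarrow> R (f + i) = tree_regions t c ! i"
  shows "R (nx y) = R x \<and> R (nx x) = R y"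
  using assms
proof (induction t arbitrary: h m f c)
  case Leg
  from Leg.prems(1) Leg.prems(3,4) Leg.prems(5)[of 0] show ?case by simp
next
  case (Fork l r)
  note pos = legs_pos[of l] legs_pos[of r]
  have nx: "nx f = f + 1" "nx (f + 1) = f + 2" "nx (f + 2) = f"
    using Fork.prems(2)[of f "f + 1" "f + 2"] by auto
  have R: "R f = c" "R (f + 1) = c + (legs l + legs r)" "R (f + 2) = c + legs l"
    using Fork.prems(6)[of 0] Fork.prems(6)[of 1] Fork.prems(6)[of 2] pos by simp_all
  from Fork.prems(1) consider "x = h" "y = f" | "(x, y) \<in> set (tree_edges l (f + 2) m (f + 3))"
    | "(x, y) \<in> set (tree_edges r (f + 1) (m + 2 * legs l) (f + 3 * legs l))"
    by auto
  then show ?case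
  proof cases
    case 1
    then show ?thesis
      using R nx Fork.prems(3,4) by simp
  next
    case 2
    then show ?thesis
    proof (rule Fork.IH(1)[where c = c])
      show "nx u = v \<and> nx v = w \<and> nx w = u" if "[u, v, w] \<in> set (tree_vertices l (f + 3))" for u v w
        using Fork.prems(2)[of u v w] that by simp
      show "R (m + 2 * i) = c + i \<and> R (nx (m + 2 * i)) = c + i + 1" if "i < legs l" for i
        using Fork.prems(5)[of i] that by simp
      show "R (f + 3 + i) = tree_regions l c ! i" if "i < 3 * (legs l - 1)" for i
        using Fork.prems(6)[of "3 + i"] that pos
        by (simp add: nth_append length_tree_regions add.assoc)
    qed (use R nx in auto)
  next
    case 3
    then show ?thesis
    proof (rule Fork.IH(2)[where c = "c + legs l"])
      show "nx u = v \<and> nx v = w \<and> nx w = u" if "[u, v, w] \<in> set (tree_vertices r (f + 3 * legs l))" for u v w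
        using Fork.prems(2)[of u v w] that by simp
      show "R (m + 2 * legs l + 2 * i) = c + legs l + i \<and> R (nx (m + 2 * legs l + 2 * i)) = c + legs l + i + 1"
        if "i < legs r" for i
        using Fork.prems(5)[of "legs l + i"] that by (simp add: algebra_simps)
      show "R (f + 3 * legs l + i) = tree_regions r (c + legs l) ! i" if "i < 3 * (legs r - 1)" for i
      proof -
        obtain n where n: "legs l = Suc n"
          using pos(1) gr0_implies_Suc by blast
        show ?thesis
          using Fork.prems(6)[of "3 * legs l + i"] that n
          by (simp add: nth_append length_tree_regions add.assoc)
      qed
    qed (use R nx in auto)
  qed
qed

text \<open>
  The leaf with label \<open>i + 1\<close> is the half-edge \<open>2 * i + 1\<close> and lies in region \<open>i\<close>. A boundary
  cycle that leaves through the half-edge 0 runs along the last of these regions.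
\<close>

definition mu_region :: "ptree \<Rightarrow> nat \<Rightarrow> nat" where
  "mu_region t h = (if h = 0 then legs t else if h < 2 * legs t + 2 then (h - 1) div 2
     else tree_regions t 0 ! (h - (2 * legs t + 2)))"

text \<open>
  The colouring behind the summand \<open>1 \<otimes> x \<otimes> \<dots> \<otimes> x\<close> of the iterated coproduct. At every fork
  the root half-edge carries \<open>x\<close>; its number exceeds the number of white half-edges by a multiple of 3.
\<close>

definition mu_colouring :: "ptree \<Rightarrow> nat \<Rightarrow> dual_basis" where
  "mu_colouring t = restrict
     (\<lambda>h. if h = 0 then B1 else if h < 2 * legs t + 2 \<or> (h - (2 * legs t + 2)) mod 3 = 0 then Bx else B1)
     (halves (mu_graph t))"

context
  fixes t :: ptree and G :: bw_graph and k :: nat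
  assumes G: "G = mu_graph t" and k: "k = 2 * legs t + 2"
begin

lemma mu_simps:
  "halves G = {..<k + 3 * (legs t - 1)}" "start G = 0" "labelled G = map (\<lambda>i. 2 * i + 1) [0..<legs t + 1]"
  by (simp_all add: G k mu_graph_def Let_def)

lemma mu_nxt_cycles: "nxt G = cycles_product ([0..<k] # tree_vertices t k)"
  by (simp add: G k mu_graph_def Let_def cycles_product_def)

lemma mu_cycles: "concat ([0..<k] # tree_vertices t k) = [0..<k + 3 * (legs t - 1)]"
  using upt_split[of 0 k "k + 3 * (legs t - 1)"] by (simp add: concat_tree_vertices)

lemma mu_nxt_white: "i < k \<Longrightarrow> nxt G i = Suc i mod k"
proof -
  assume i: "i < k"
  have "nxt G i = cycle_of_list [0..<k] i"
    unfolding mu_nxt_cycles by (rule cycles_product) (use i mu_cycles in auto)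
  then show ?thesis
    using cycle_of_list_nth[of "[0..<k]" i] i by simp
qed

lemma mu_nxt_black:
  assumes "[x, y, z] \<in> set (tree_vertices t k)"
  shows "nxt G x = y \<and> nxt G y = z \<and> nxt G z = x"
proof -
  have "distinct [x, y, z]"
    using tree_vertices_form[OF assms] by auto
  moreover have "nxt G u = cycle_of_list [x, y, z] u" if "u \<in> set [x, y, z]" for u
    unfolding mu_nxt_cycles by (rule cycles_product) (use that assms mu_cycles in auto)
  ultimately show ?thesis
    using cycle_of_list_3[of x y z] by simp
qed

lemma mu_nxt_permutes: "nxt G permutes halves G"
  using cycles_product_permutes[of "[0..<k] # tree_vertices t k"]
  unfolding mu_nxt_cycles mu_cycles mu_simps by (simp add: lessThan_atLeast0)

lemma mu_halves_cases:
  assumes "h \<in> halves G"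
  obtains "h < k" | x y z where "[x, y, z] \<in> set (tree_vertices t k)" "h \<in> {x, y, z}"
proof (cases "h < k")
  case False
  then have "h \<in> set (concat (tree_vertices t k))"
    using assms by (simp add: mu_simps concat_tree_vertices)
  then obtain vs where "vs \<in> set (tree_vertices t k)" "h \<in> set vs"
    by auto
  then show ?thesis
    using tree_vertices_form[of vs t k] that(2) by fastforce
qed

lemma mu_orbit_black:
  assumes "[x, y, z] \<in> set (tree_vertices t k)" "h \<in> {x, y, z}"
  shows "orbit (nxt G) h = {x, y, z}"
proof
  show "orbit (nxt G) h \<subseteq> {x, y, z}"
  proof
    fix u assume "u \<in> orbit (nxt G) h"
    then show "u \<in> {x, y, z}"
      by induction (use assms(2) mu_nxt_black[OF assms(1)] in auto)
  qed
  have "{nxt G h, nxt G (nxt G h), nxt G (nxt G (nxt G h))} \<subseteq> orbit (nxt G) h"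
    by (auto intro: orbit.intros)
  then show "{x, y, z} \<subseteq> orbit (nxt G) h"
    using assms(2) mu_nxt_black[OF assms(1)] by auto
qed

lemma mu_orbit_white: "h < k \<Longrightarrow> orbit (nxt G) h = {..<k}"
proof -
  assume h: "h < k"
  have perm: "permutation (nxt G)"
    using mu_nxt_permutes permutes_imp_permutation[of "halves G"] by (simp add: mu_simps)
  have pow: "(nxt G ^^ i) 0 = i" if "i < k" for i
    using that by (induction i) (simp_all add: mu_nxt_white)
  have "u \<in> orbit (nxt G) 0" if "u < k" for u
    using funpow_in_orbit[OF permutation_self_in_orbit[OF perm, of 0], of u] pow[OF that] by simp
  moreover have "u < k" if "u \<in> orbit (nxt G) 0" for u
    using that by induction (simp_all add: mu_nxt_white k)
  ultimately have o: "orbit (nxt G) 0 = {..<k}"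
    by auto
  then have "orbit (nxt G) h = orbit (nxt G) 0"
    using h by (intro orbit_cyclic_eq3[OF cyclic_on_orbit'[OF perm]]) simp
  then show ?thesis
    using o by simp
qed

lemma mu_vertices: "vertices G = insert {..<k} (set ` set (tree_vertices t k))"
proof
  show "vertices G \<subseteq> insert {..<k} (set ` set (tree_vertices t k))"
  proof
    fix v assume "v \<in> vertices G"
    then obtain h where h: "h \<in> halves G" "v = orbit (nxt G) h"
      by (auto simp: vertices_def)
    from h(1) show "v \<in> insert {..<k} (set ` set (tree_vertices t k))"
    proof (cases rule: mu_halves_cases)
      case 1
      then show ?thesis by (simp add: h(2) mu_orbit_white)
    next
      case (2 x y z)
      then have "v = set [x, y, z]"
        using mu_orbit_black h(2) by simp
      then show ?thesis
        using 2(1) by blast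
    qed
  qed
  have "{..<k} = orbit (nxt G) 0" "0 \<in> halves G"
    using mu_orbit_white[of 0] by (simp_all add: k mu_simps)
  then have "{..<k} \<in> vertices G"
    unfolding vertices_def by blast
  moreover have "set vs \<in> vertices G" if vs: "vs \<in> set (tree_vertices t k)" for vs
  proof -
    obtain j where j: "j < legs t - 1" "vs = [k + 3 * j, k + 3 * j + 1, k + 3 * j + 2]"
      using tree_vertices_form[OF vs] by blast
    then have "set vs = orbit (nxt G) (k + 3 * j)"
      using mu_orbit_black[of "k + 3 * j" "k + 3 * j + 1" "k + 3 * j + 2"] vs by simp
    moreover have "k + 3 * j \<in> halves G"
      using j(1) by (simp add: mu_simps)
    ultimately show ?thesis
      unfolding vertices_def by blast
  qed
  ultimately show "insert {..<k} (set ` set (tree_vertices t k)) \<subseteq> vertices G"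
    by auto
qed

lemma mu_white: "white G = {..<k}"
  by (simp add: white_def mu_simps mu_orbit_white k)

lemma mu_blacks: "blacks G = set ` set (tree_vertices t k)"
proof -
  have "set vs \<noteq> {..<k}" if vs: "vs \<in> set (tree_vertices t k)" for vs
  proof -
    obtain j where "vs = [k + 3 * j, k + 3 * j + 1, k + 3 * j + 2]"
      using tree_vertices_form[OF vs] by blast
    then have "k + 3 * j \<in> set vs" "k + 3 * j \<notin> {..<k}"
      by simp_all
    then show ?thesis
      by blast
  qed
  then show ?thesis
    unfolding blacks_def mu_vertices mu_white by blast
qed

lemma mu_black_card: "v \<in> blacks G \<Longrightarrow> card v = 3"
  unfolding mu_blacks using tree_vertices_form by fastforce

lemma mu_white_list: "white_list G = [0..<k]"
proof -
  have "(nxt G ^^ i) 0 = i" if "i < k" for i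
    using that by (induction i) (simp_all add: mu_nxt_white)
  then show ?thesis
    by (intro nth_equalityI) (simp_all add: white_list_def mu_simps mu_white)
qed

lemma mu_degree: "degree G = 2 * legs t + 1"
  by (simp add: degree_def mu_white mu_black_card k)

lemma mu_opp_cycles:
  "opp G = cycles_product (map (\<lambda>(x, y). [x, y]) (tree_edges t 0 2 k))"
proof -
  have [simp]: "(cycle_of_list \<circ> (\<lambda>(x, y). [x, y])) = (\<lambda>(x, y). transpose x y)"
    by (auto simp: fun_eq_iff)
  show ?thesis
    by (simp add: G k mu_graph_def Let_def cycles_product_def)
qed

lemma mu_edges_distinct: "distinct (concat (map (\<lambda>(x, y). [x, y]) (tree_edges t 0 2 k)))"
proof -
  let ?xs = "0 # map (\<lambda>i. 2 + 2 * i) [0..<legs t] @ [k..<k + 3 * (legs t - 1)]"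
  have "mset (concat (map (\<lambda>(x, y). [x, y]) (tree_edges t 0 2 k))) = mset ?xs"
    unfolding mset_tree_edges by simp
  moreover have "distinct ?xs"
    by (auto simp: distinct_map inj_on_def k)
  ultimately show ?thesis
    using mset_eq_imp_distinct_iff by blast
qed

lemma mu_opp_edge:
  assumes "(x, y) \<in> set (tree_edges t 0 2 k)"
  shows "opp G x = y" "opp G y = x" "x \<noteq> y" "x \<in> halves G" "y \<in> halves G"
proof -
  have xy: "[x, y] \<in> set (map (\<lambda>(x, y). [x, y]) (tree_edges t 0 2 k))"
    using assms by force
  have "opp G u = cycle_of_list [x, y] u" if "u \<in> {x, y}" for u
    unfolding mu_opp_cycles using that by (intro cycles_product[OF mu_edges_distinct xy]) auto
  then show "opp G x = y" "opp G y = x"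
    by simp_all
  show "x \<noteq> y"
    using distinct_concat_iff mu_edges_distinct xy
    by (metis distinct_length_2_or_more)
  have "{x, y} \<subseteq> (\<Union>(x, y)\<in>set (tree_edges t 0 2 k). {x, y})"
    using assms by blast
  then show "x \<in> halves G" "y \<in> halves G"
    unfolding tree_edges_endpoints by (auto simp: mu_simps k)
qed

lemma mu_opp_leaf: "h \<notin> (\<Union>(x, y)\<in>set (tree_edges t 0 2 k). {x, y}) \<Longrightarrow> opp G h = h"
proof -
  assume h: "h \<notin> (\<Union>(x, y)\<in>set (tree_edges t 0 2 k). {x, y})"
  have "opp G permutes set (concat (map (\<lambda>(x, y). [x, y]) (tree_edges t 0 2 k)))"
    unfolding mu_opp_cycles by (rule cycles_product_permutes)
  then show ?thesis
    by (rule permutes_not_in) (use h in \<open>auto simp: case_prod_unfold\<close>)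
qed

lemma mu_opp_cases:
  obtains "opp G h = h" "h \<notin> insert 0 ((\<lambda>i. 2 + 2 * i) ` {..<legs t} \<union> {k..<k + 3 * (legs t - 1)})"
  | y where "(h, y) \<in> set (tree_edges t 0 2 k)"
  | y where "(y, h) \<in> set (tree_edges t 0 2 k)"
proof (cases "h \<in> (\<Union>(x, y)\<in>set (tree_edges t 0 2 k). {x, y})")
  case True
  then show ?thesis using that(2,3) by auto
next
  case False
  then show ?thesis
    using that(1)[OF mu_opp_leaf[OF False]] unfolding tree_edges_endpoints by blast
qed

lemma mu_opp_involution: "opp G (opp G h) = h"
  by (cases h rule: mu_opp_cases) (simp_all add: mu_opp_edge)

lemma mu_opp_permutes: "opp G permutes halves G"
proof (rule bij_imp_permutes)
  have "opp G h \<in> halves G" if "h \<in> halves G" for h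
    using that by (cases h rule: mu_opp_cases) (auto simp: mu_opp_edge)
  then show "bij_betw (opp G) (halves G) (halves G)"
    using mu_opp_involution by (intro bij_betw_byWitness[where f' = "opp G"]) auto
  show "opp G h = h" if "h \<notin> halves G" for h
    using that by (cases h rule: mu_opp_cases) (auto simp: mu_opp_edge)
qed

lemma mu_leaves: "{h \<in> halves G. opp G h = h} = set (labelled G)"
proof (intro equalityI subsetI)
  fix h assume "h \<in> {h \<in> halves G. opp G h = h}"
  then have h: "h \<in> halves G" "opp G h = h"
    by auto
  have "h \<notin> insert 0 ((\<lambda>i. 2 + 2 * i) ` {..<legs t} \<union> {k..<k + 3 * (legs t - 1)})"
    using h(2) by (cases h rule: mu_opp_cases) (metis mu_opp_edge)+
  moreover have "h = 0 \<or> h \<in> (\<lambda>i. 2 + 2 * i) ` {..<legs t}" if "h < k" "even h"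
  proof -
    from that obtain i where i: "h = 2 * i"
      by (elim evenE)
    show ?thesis
      using i that(1) by (cases i) (auto simp: k)
  qed
  ultimately have "odd h" "h < k"
    using h(1) by (auto simp: mu_simps)
  then obtain i where "h = 2 * i + 1" "i < legs t + 1"
    by (auto simp: k elim!: oddE)
  then show "h \<in> set (labelled G)"
    by (auto simp: mu_simps)
next
  fix h assume "h \<in> set (labelled G)"
  then obtain i where i: "h = 2 * i + 1" "i < legs t + 1"
    by (auto simp: mu_simps)
  have "h \<notin> (\<Union>(x, y)\<in>set (tree_edges t 0 2 k). {x, y})"
    unfolding tree_edges_endpoints using i by (auto simp: k) presburger+
  then show "h \<in> {h \<in> halves G. opp G h = h}"
    using mu_opp_leaf i by (simp add: mu_simps k)
qed

lemma mu_region_step: "h \<in> halves G \<Longrightarrow> mu_region t (nxt G (opp G h)) = mu_region t h"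
proof -
  assume h: "h \<in> halves G"
  \<comment> \<open>the tree is planted at the half-edge 0, after which region 0 begins\<close>
  have edge: "mu_region t (nxt G y) = mu_region t x \<and> mu_region t (nxt G x) = mu_region t y"
    if "(x, y) \<in> set (tree_edges t 0 2 k)" for x y
    using that
  proof (rule tree_edges_region[where c = 0])
    show "mu_region t (2 + 2 * i) = 0 + i \<and> mu_region t (nxt G (2 + 2 * i)) = 0 + i + 1" if "i < legs t" for i
      using that by (simp add: mu_nxt_white mu_region_def k)
  qed (use mu_nxt_black in \<open>auto simp: mu_region_def mu_nxt_white k\<close>)
  show ?thesis
  proof (cases h rule: mu_opp_cases)
    case 1
    then have "h \<in> set (labelled G)"
      using mu_leaves h by blast
    then obtain i where i: "h = 2 * i + 1" "i < legs t + 1"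
      by (auto simp: mu_simps)
    show ?thesis
    proof (cases "i = legs t")
      case True
      then show ?thesis
        using i 1(1) by (simp add: mu_nxt_white k mu_region_def)
    next
      case False
      then show ?thesis
        using i 1(1) by (simp add: mu_nxt_white k mu_region_def)
    qed
  next
    case (2 y)
    then show ?thesis using edge mu_opp_edge by metis
  next
    case (3 y)
    then show ?thesis using edge mu_opp_edge by metis
  qed
qed

text \<open>
  Planarity of the tree separates the incoming boundary components: the region is constant on boundary
  cycles and tells the labelled leaves apart.
\<close>

lemma mu_boundary_cycle:
  assumes "h \<in> set (labelled G)" "h' \<in> set (labelled G)" "h' \<in> boundary_cycle G h"
  shows "h' = h"
proof -
  have "h \<in> halves G"
    using assms(1) mu_leaves by blast
  have step: "nxt G (opp G x) \<in> halves G \<and> mu_region t (nxt G (opp G x)) = mu_region t x" if "x \<in> halves G" for x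
    using that mu_region_step permutes_in_image[OF mu_nxt_permutes] permutes_in_image[OF mu_opp_permutes] by metis
  have "x \<in> halves G \<and> mu_region t x = mu_region t h" if "x \<in> boundary_cycle G h" for x
    using that unfolding boundary_cycle_def by induction (use step \<open>h \<in> halves G\<close> in auto)
  then have "mu_region t h' = mu_region t h"
    using assms(3) by blast
  moreover obtain i j where "h = 2 * i + 1" "i < legs t + 1" "h' = 2 * j + 1" "j < legs t + 1"
    using assms(1,2) by (auto simp: mu_simps)
  ultimately show ?thesis
    by (simp add: mu_region_def k)
qed

lemma mu_sullivan: "sullivan_graph (legs t + 1) G"
proof -
  have "opp G \<circ> opp G = id"
    by (simp add: fun_eq_iff mu_opp_involution)
  moreover have "start G \<in> halves G" "finite (halves G)"
    by (simp_all add: mu_simps k)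
  moreover have "distinct (labelled G)" "length (labelled G) = legs t + 1"
    by (simp_all add: mu_simps distinct_map inj_on_def del: upt_Suc)
  ultimately show ?thesis
    using mu_nxt_permutes mu_opp_permutes mu_leaves mu_black_card mu_boundary_cycle
    by (simp add: sullivan_graph_def) blast
qed

lemma mu_trivalent: "trivalent G"
  by (simp add: trivalent_def mu_black_card)

lemma mu_colouring_admissible: "admissible G (replicate (legs t + 1) Bx) (mu_colouring t)"
proof -
  have "card {h \<in> e. mu_colouring t h = Bx} = 1" if e: "e \<in> edges G" for e
  proof -
    have ex: "\<exists>x y. (x, y) \<in> set (tree_edges t 0 2 k) \<and> e = {x, y}"
    proof -
      obtain h where h: "e = {h, opp G h}" "opp G h \<noteq> h"
        using e by (auto simp: edges_def)
      show ?thesis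
        using h by (cases h rule: mu_opp_cases) (metis mu_opp_edge(1,2) insert_commute)+
    qed
    then obtain x y where xy: "(x, y) \<in> set (tree_edges t 0 2 k)" "e = {x, y}"
      by blast
    have "mu_colouring t x = Bx \<longleftrightarrow> \<not> mu_colouring t y = Bx"
      using xy(1)
      by (rule tree_edges_colour[where C = "\<lambda>h. mu_colouring t h = Bx"],
          simp_all add: mu_colouring_def mu_simps G[symmetric] k, presburger)
    moreover have "distinct [x, y]"
      using mu_opp_edge(3)[OF xy(1)] by simp
    ultimately show ?thesis
      using card_Bx_2[OF xy(2), of "mu_colouring t"] by auto
  qed
  moreover have "card {h \<in> v. mu_colouring t h = Bx} = 1" if v: "v \<in> blacks G" for v
  proof -
    obtain vs where vs: "vs \<in> set (tree_vertices t k)" "v = set vs"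
      using v unfolding mu_blacks by blast
    then obtain j where j: "j < legs t - 1" "v = {k + 3 * j, k + 3 * j + 1, k + 3 * j + 2}"
      using tree_vertices_form[OF vs(1)] by auto
    have "mu_colouring t (k + 3 * j) = Bx" "mu_colouring t (k + 3 * j + 1) = B1" "mu_colouring t (k + 3 * j + 2) = B1"
      using j(1) by (simp_all add: mu_colouring_def mu_simps G[symmetric] k) presburger
    then show ?thesis
      using card_Bx_3[OF j(2), of "mu_colouring t"] by simp
  qed
  moreover have "mu_colouring t (labelled G ! i) = replicate (legs t + 1) Bx ! i" if "i < length (labelled G)" for i
    using that by (simp add: mu_colouring_def mu_simps G[symmetric] k del: upt_Suc replicate_Suc)
  moreover have "mu_colouring t (start G) = B1"
    by (simp add: mu_colouring_def mu_simps G[symmetric] k)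
  ultimately show ?thesis
    unfolding admissible_def by blast
qed

text \<open>
  All terms of the state sum are words with coefficient 1, so one colouring with the right boundary
  values suffices.
\<close>

lemma mu_state_sum_lookup:
  "0 < Poly_Mapping.lookup (state_sum G (replicate (legs t + 1) Bx)) (B1 # replicate (2 * legs t + 1) Bx)"
proof -
  let ?w = "B1 # replicate (2 * legs t + 1) Bx"
  let ?K = "{\<kappa> \<in> halves G \<rightarrow>\<^sub>E UNIV. admissible G (replicate (legs t + 1) Bx) \<kappa>}"
  have "finite (halves G \<rightarrow>\<^sub>E (UNIV :: dual_basis set))"
    by (intro finite_PiE) (simp_all add: mu_simps)
  then have fin: "finite ?K"
    by simp
  have "map (mu_colouring t) [0..<k] = ?w"
    by (rule nth_equalityI) (auto simp del: upt_Suc simp: mu_colouring_def mu_simps G[symmetric] k nth_Cons split: nat.split)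
  then have w: "map (mu_colouring t) (white_list G) = ?w"
    by (simp add: mu_white_list)
  have "mu_colouring t \<in> ?K"
    using mu_colouring_admissible by (simp add: mu_colouring_def G)
  have "1 = Poly_Mapping.lookup (frag_of (map (mu_colouring t) (white_list G))) ?w"
    by (simp add: w)
  also have "\<dots> \<le> (\<Sum>\<kappa>\<in>?K. Poly_Mapping.lookup (frag_of (map \<kappa> (white_list G))) ?w)"
    using fin \<open>mu_colouring t \<in> ?K\<close> by (intro member_le_sum) auto
  also have "\<dots> = Poly_Mapping.lookup (state_sum G (replicate (legs t + 1) Bx)) ?w"
    by (simp add: state_sum_def lookup_sum)
  finally show ?thesis
    by simp
qed

end

section \<open>Hochschild chains\<close>

definition degenerate_words :: "nat \<Rightarrow> dual_basis list set" where
  "degenerate_words n = {u. length u = n + 1 \<and> (\<exists>j. 1 \<le> j \<and> j \<le> n \<and> u ! j = B1)}"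

lemma keys_tensor:
  assumes "set as \<subseteq> carrier (words 1)" and "u \<in> Poly_Mapping.keys (tensor as)"
  shows "length u = length as \<and> (\<forall>i<length as. [u ! i] \<in> Poly_Mapping.keys (as ! i))"
  using assms
proof (induction as arbitrary: u)
  case Nil
  then show ?case by (simp add: keys_frag_of)
next
  case (Cons a as)
  have a: "Poly_Mapping.keys a \<subseteq> {u. length u = 1}"
    using Cons.prems(1) by (simp add: words_def)
  from Cons.prems(2) obtain w where w: "w \<in> Poly_Mapping.keys a"
    "u \<in> Poly_Mapping.keys (frag_extend (\<lambda>v. frag_of (w @ v)) (tensor as))"
    using keys_frag_extend by (fastforce simp del: frag_extend_def)
  obtain v where v: "v \<in> Poly_Mapping.keys (tensor as)" "u = w @ v"
    using w(2) keys_frag_extend[of "\<lambda>v. frag_of (w @ v)" "tensor as"] by (auto simp: keys_frag_of)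
  obtain x where x: "w = [x]"
    using w(1) a by (auto simp: length_Suc_conv)
  have "length v = length as \<and> (\<forall>i<length as. [v ! i] \<in> Poly_Mapping.keys (as ! i))"
    using Cons.IH[OF _ v(1)] Cons.prems(1) by simp
  then show ?case
    using w(1) v(2) x by (auto simp: nth_Cons split: nat.split)
qed

lemma tensor_letters: "tensor (map (\<lambda>b. frag_of [b]) u) = frag_of u"
  by (induction u) simp_all

text \<open>
  As the unit is a basis element, the degenerate chains are spanned by words. They are the ones with
  letter 1 in some position other than 0.
\<close>

lemma degen_dual_numbers: "degen dual_numbers n = carrier (free_Abelian_group (degenerate_words n))"
proof
  let ?S = "{tensor as | as j. length as = n + 1 \<and> set as \<subseteq> carrier (words 1) \<and>
     1 \<le> j \<and> j \<le> n \<and> as ! j = unit_word dual_numbers}"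
  have unit: "unit_word dual_numbers = frag_of [B1]"
    by (simp add: unit_word_def dual_numbers_def)
  have S: "Poly_Mapping.keys x \<subseteq> degenerate_words n" if x: "x \<in> ?S" for x
  proof
    fix u assume u: "u \<in> Poly_Mapping.keys x"
    obtain as j where as: "x = tensor as" "length as = n + 1" "set as \<subseteq> carrier (words 1)"
      "1 \<le> j" "j \<le> n" "as ! j = frag_of [B1]"
      using x unfolding unit by blast
    have "length u = length as \<and> (\<forall>i<length as. [u ! i] \<in> Poly_Mapping.keys (as ! i))"
      using keys_tensor[OF as(3)] u as(1) by blast
    then show "u \<in> degenerate_words n"
      unfolding degenerate_words_def mem_Collect_eq
    proof (intro conjI exI[of _ j])
      have "[u ! j] \<in> Poly_Mapping.keys (as ! j)"
        using \<open>length u = length as \<and> _\<close> as(2,5) by simp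
      then show "u ! j = B1"
        by (simp add: as(6) keys_frag_of)
    qed (use \<open>length u = length as \<and> _\<close> as in simp_all)
  qed
  have "subgroup (frag_span ?S) (free_Abelian_group (degenerate_words n))"
    using S by (rule frag_span_subgroup)
  then show "degen dual_numbers n \<subseteq> carrier (free_Abelian_group (degenerate_words n))"
    unfolding degen_def by (rule subgroup.subset)
  show "carrier (free_Abelian_group (degenerate_words n)) \<subseteq> degen dual_numbers n"
  proof
    fix x assume "x \<in> carrier (free_Abelian_group (degenerate_words n))"
    then have "Poly_Mapping.keys x \<subseteq> degenerate_words n"
      by simp
    then show "x \<in> degen dual_numbers n"
    proof (induction rule: frag_induction)
      case zero
      then show ?case by (simp add: degen_def frag_span_0)
    next
      case (one u)
      then obtain j where j: "length u = n + 1" "1 \<le> j" "j \<le> n" "u ! j = B1"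
        by (auto simp: degenerate_words_def)
      have "frag_of u = tensor (map (\<lambda>b. frag_of [b]) u)"
        by (simp add: tensor_letters)
      moreover have "set (map (\<lambda>b. frag_of [b]) u) \<subseteq> carrier (words 1)"
        by (auto simp: words_def keys_frag_of)
      ultimately have "frag_of u \<in> ?S"
        using j unit by (intro CollectI exI[of _ "map (\<lambda>b. frag_of [b]) u"] exI[of _ j]) auto
      then show ?case
        unfolding degen_def by (rule frag_span_base)
    next
      case (diff a b)
      then show ?case
        unfolding degen_def using frag_span_add[OF _ frag_span_minus] by fastforce
    qed
  qed
qed

lemma degen_closed:
  "0 \<in> degen dual_numbers n" "x \<in> degen dual_numbers n \<Longrightarrow> y \<in> degen dual_numbers n \<Longrightarrow> x + y \<in> degen dual_numbers n"
  "x \<in> degen dual_numbers n \<Longrightarrow> - x \<in> degen dual_numbers n"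
  by (simp_all add: degen_def frag_span_0 frag_span_add frag_span_minus)

lemma degen_cmul: "x \<in> degen dual_numbers n \<Longrightarrow> frag_cmul k x \<in> degen dual_numbers n"
  using keys_cmul[of k x] by (auto simp: degen_dual_numbers)

lemma degen_diff: "x \<in> degen dual_numbers n \<Longrightarrow> y \<in> degen dual_numbers n \<Longrightarrow> x - y \<in> degen dual_numbers n"
  using degen_closed(2)[of x n "- y"] degen_closed(3)[of y n] by simp

lemma degen_sum: "(\<And>i. i \<in> I \<Longrightarrow> f i \<in> degen dual_numbers n) \<Longrightarrow> sum f I \<in> degen dual_numbers n"
  by (induction I rule: infinite_finite_induct) (auto simp: degen_closed)

lemma degen_subgroup: "subgroup (degen dual_numbers n) (words (n + 1))"
  unfolding degen_def words_def[of "n + 1"]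
proof (rule frag_span_subgroup)
  fix x assume "x \<in> {tensor as |as j. length as = n + 1 \<and> set as \<subseteq> carrier (words 1) \<and>
     1 \<le> j \<and> j \<le> n \<and> as ! j = unit_word dual_numbers}"
  then obtain as where "x = tensor as" "length as = n + 1" "set as \<subseteq> carrier (words 1)"
    by blast
  then show "Poly_Mapping.keys x \<subseteq> {u. length u = n + 1}"
    using keys_tensor[of as] by auto
qed

text \<open>
  The last face, which multiplies cyclically, is the default case.
\<close>

definition face :: "dual_basis list \<Rightarrow> nat \<Rightarrow> dual_basis list \<Rightarrow>\<^sub>0 int" where
  "face u i = (if Suc i < length u
     then frag_extend (\<lambda>c. frag_of (take i u @ c # drop (i + 2) u)) (dual_mul (u ! i) (u ! Suc i))
     else frag_extend (\<lambda>c. frag_of (c # tl (butlast u))) (dual_mul (last u) (hd u)))"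

lemma hoch_word_faces:
  assumes "u \<noteq> []"
  shows "hoch_word dual_numbers u = (\<Sum>i<length u. frag_cmul ((- 1) ^ i) (face u i))"
proof -
  obtain n where n: "length u = Suc n"
    using assms by (cases u) auto
  show ?thesis
    unfolding hoch_word_def n
    by (simp add: face_def n dual_numbers_def)
qed

lemma degenerate_face:
  assumes len: "length u = n + 1" and j: "1 \<le> j" "j \<le> n" "u ! j = B1" and i: "i \<le> n" "i \<noteq> j" "Suc i \<noteq> j"
  shows "face u i \<in> degen dual_numbers (n - 1)"
proof (cases "i < n")
  case True
  have "take i u @ c # drop (i + 2) u \<in> degenerate_words (n - 1)" for c
  proof (cases "i < j")
    case True
    then have "(take i u @ c # drop (i + 2) u) ! (j - 1) = B1"
    proof -
      from \<open>i < j\<close> i(3) have "Suc i < j"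
        by simp
      then have "j = i + 2 + (j - i - 2)"
        by simp
      then obtain m where m: "j = i + 2 + m"
        by blast
      then show ?thesis
        using len j by (simp add: nth_append)
    qed
    then show ?thesis
      using len i j True \<open>i < n\<close> by (auto simp: degenerate_words_def intro!: exI[of _ "j - 1"])
  next
    case False
    then have "(take i u @ c # drop (i + 2) u) ! j = B1"
      using len i j \<open>i < n\<close> by (auto simp: nth_append)
    then show ?thesis
      using len i j False \<open>i < n\<close> by (auto simp: degenerate_words_def intro!: exI[of _ j])
  qed
  then show ?thesis
    using keys_frag_extend[of "\<lambda>c. frag_of (take i u @ c # drop (i + 2) u)" "dual_mul (u ! i) (u ! Suc i)"] len True
    by (auto simp: face_def degen_dual_numbers keys_frag_of)
next
  case False
  have "c # tl (butlast u) \<in> degenerate_words (n - 1)" for c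
  proof -
    have "(c # tl (butlast u)) ! j = B1"
      using len i j False by (auto simp: nth_Cons' nth_tl nth_butlast)
    then show ?thesis
      using len i j False by (auto simp: degenerate_words_def intro!: exI[of _ j])
  qed
  then show ?thesis
    using keys_frag_extend[of "\<lambda>c. frag_of (c # tl (butlast u))" "dual_mul (last u) (hd u)"] len False
    by (auto simp: face_def degen_dual_numbers keys_frag_of)
qed

lemma dual_mul_B1: "dual_mul a B1 = frag_of a"
  by (cases a) simp_all

lemma face_before_unit:
  assumes "1 \<le> j" "j < length u" "u ! j = B1"
  shows "face u (j - 1) = frag_of (take j u @ drop (Suc j) u)"
proof -
  have "take j u = take (j - 1) u @ [u ! (j - 1)]"
    using assms take_Suc_conv_app_nth[of "j - 1" u] by simp
  then show ?thesis
    using assms by (simp add: face_def dual_mul_B1)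
qed

lemma face_after_unit:
  assumes "1 \<le> j" "j < length u" "u ! j = B1"
  shows "face u j = frag_of (take j u @ drop (Suc j) u)"
proof (cases "Suc j < length u")
  case True
  then show ?thesis
    using assms by (simp add: face_def Cons_nth_drop_Suc)
next
  case False
  then have j: "j = length u - 1" and u: "u \<noteq> []"
    using assms by auto
  then have "last u = B1"
    using assms by (simp add: last_conv_nth)
  moreover have "take j u = hd u # tl (butlast u)"
  proof -
    have "take j u = butlast u"
      by (simp add: j butlast_conv_take)
    moreover have "butlast u \<noteq> []" "hd (butlast u) = hd u"
      using j assms by (cases u; auto)+
    ultimately show ?thesis
      by (metis list.collapse)
  qed
  ultimately show ?thesis
    using False by (simp add: face_def)
qed

text \<open>
  The two faces that multiply the letter 1 with its neighbours coincide and have opposite signs. All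
  other faces still contain that letter.
\<close>

lemma hoch_word_degenerate:
  assumes "u \<in> degenerate_words n"
  shows "hoch_word dual_numbers u \<in> degen dual_numbers (n - 1)"
proof -
  obtain j where len: "length u = n + 1" and j: "1 \<le> j" "j \<le> n" "u ! j = B1"
    using assms by (auto simp: degenerate_words_def)
  let ?f = "\<lambda>i. frag_cmul ((- 1) ^ i) (face u i)"
  have "hoch_word dual_numbers u = sum ?f {..<length u}"
    using len by (intro hoch_word_faces) auto
  also have "\<dots> = ?f j + sum ?f ({..<length u} - {j})"
    using len j by (intro sum.remove) auto
  also have "sum ?f ({..<length u} - {j}) = ?f (j - 1) + sum ?f ({..<length u} - {j} - {j - 1})"
    using len j by (intro sum.remove) auto
  also have "{..<length u} - {j} - {j - 1} = {..<length u} - {j - 1, j}"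
    by auto
  finally have "hoch_word dual_numbers u = ?f (j - 1) + ?f j + sum ?f ({..<length u} - {j - 1, j})"
    by (simp add: add.left_commute add.assoc)
  moreover have "?f (j - 1) + ?f j = 0"
  proof -
    obtain i where "j = Suc i"
      using j(1) by (cases j) auto
    then show ?thesis
      using face_before_unit[of j u] face_after_unit[of j u] len j
      by (simp flip: frag_cmul_distrib)
  qed
  moreover have "sum ?f ({..<length u} - {j - 1, j}) \<in> degen dual_numbers (n - 1)"
  proof (rule degen_sum)
    fix i assume "i \<in> {..<length u} - {j - 1, j}"
    then show "?f i \<in> degen dual_numbers (n - 1)"
      using degenerate_face[OF len j, of i] degen_cmul len j by auto
  qed
  ultimately show ?thesis
    by simp
qed

text \<open>
  Since \<open>x * x = 0\<close>, only the first and the last face of a word \<open>1 \<otimes> x \<otimes> \<dots> \<otimes> x\<close> survive.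
\<close>

lemma hoch_word_Bx:
  assumes "0 < m"
  shows "hoch_word dual_numbers (Bx # replicate m Bx) = 0"
    and "hoch_word dual_numbers (B1 # replicate m Bx) = frag_cmul (1 + (- 1) ^ m) (frag_of (replicate m Bx))"
proof -
  have last: "last (c # replicate m Bx) = Bx" for c
    using assms by (cases m) auto
  have "face (Bx # replicate m Bx) i = 0" for i
    using last by (auto simp: face_def nth_Cons' simp del: last.simps)
  then show "hoch_word dual_numbers (Bx # replicate m Bx) = 0"
    by (simp add: hoch_word_faces)
  let ?u = "B1 # replicate m Bx"
  have f0: "face ?u 0 = frag_of (replicate m Bx)"
    using assms by (cases m) (simp_all add: face_def)
  have fm: "face ?u m = frag_of (replicate m Bx)"
  proof -
    have "butlast ?u = take m ?u"
      by (simp only: butlast_conv_take length_Cons length_replicate diff_Suc_1)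
    then have "tl (butlast ?u) = replicate (m - 1) Bx"
      using assms by (simp add: take_Cons')
    moreover have "Bx # replicate (m - 1) Bx = replicate m Bx"
      using assms by (cases m) auto
    ultimately show ?thesis
      using last[of B1] unfolding face_def by (simp del: last.simps butlast.simps)
  qed
  have fi: "face ?u i = 0" if "0 < i" "i < m" for i
    using that by (simp add: face_def nth_Cons')
  have "hoch_word dual_numbers ?u = (\<Sum>i\<in>{0, m}. frag_cmul ((- 1) ^ i) (face ?u i))"
    unfolding hoch_word_faces[OF list.distinct(2)]
    using fi assms by (intro sum.mono_neutral_right) auto
  then show "hoch_word dual_numbers ?u = frag_cmul (1 + (- 1) ^ m) (frag_of (replicate m Bx))"
    using assms by (simp add: f0 fm frag_cmul_distrib)
qed

lemma nondegenerate_word: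
  assumes "length u = n + 1" "u \<notin> degenerate_words n"
  shows "u = B1 # replicate n Bx \<or> u = Bx # replicate n Bx"
proof -
  obtain c w where u: "u = c # w" "length w = n"
    using assms(1) by (cases u) auto
  have "w ! i = Bx" if "i < n" for i
  proof -
    have "w ! i \<noteq> B1"
      using assms that u by (force simp: degenerate_words_def dest: spec[of _ "Suc i"])
    then show ?thesis
      by (cases "w ! i") auto
  qed
  then have "w = replicate n Bx"
    using u(2) by (intro nth_equalityI) auto
  then show ?thesis
    using u(1) by (cases c) auto
qed

lemma hoch_word_odd:
  assumes "odd n" "length u = n + 1"
  shows "hoch_word dual_numbers u \<in> degen dual_numbers (n - 1)"
proof (cases "u \<in> degenerate_words n")
  case True
  then show ?thesis by (rule hoch_word_degenerate)
next
  case False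
  have "0 < n"
    using assms(1) by (cases n) auto
  then show ?thesis
    using nondegenerate_word[OF assms(2) False] hoch_word_Bx[of n] assms(1)
    by (auto simp: degen_closed(1))
qed

text \<open>
  Boundaries of degenerate words are degenerate, and the other words of this length have boundaries in
  the span of \<open>x \<otimes> \<dots> \<otimes> x\<close>. So \<open>1 \<otimes> x \<otimes> \<dots> \<otimes> x\<close> never occurs in a boundary.
\<close>

lemma lookup_hoch_word:
  assumes "length u = n + 2"
  shows "Poly_Mapping.lookup (hoch_word dual_numbers u) (B1 # replicate n Bx) = 0"
proof (cases "u \<in> degenerate_words (n + 1)")
  case True
  then have "Poly_Mapping.keys (hoch_word dual_numbers u) \<subseteq> degenerate_words n"
    using hoch_word_degenerate[OF True] by (simp add: degen_dual_numbers)
  moreover have "B1 # replicate n Bx \<notin> degenerate_words n"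
    by (auto simp: degenerate_words_def nth_Cons split: nat.splits)
  ultimately show ?thesis
    by (auto simp: in_keys_iff)
next
  case False
  then show ?thesis
    using nondegenerate_word[of u "n + 1"] hoch_word_Bx[of "n + 1"] assms by auto
qed

section \<open>Hochschild homology of the dual numbers\<close>

abbreviation bd :: "(dual_basis list \<Rightarrow>\<^sub>0 int) \<Rightarrow> dual_basis list \<Rightarrow>\<^sub>0 int" where
  "bd \<equiv> frag_extend (hoch_word dual_numbers)"

definition chain_class :: "nat \<Rightarrow> (dual_basis list \<Rightarrow>\<^sub>0 int) \<Rightarrow> (dual_basis list \<Rightarrow>\<^sub>0 int) set" where
  "chain_class n c = degen dual_numbers n #>\<^bsub>words (n + 1)\<^esub> c"

lemma chain_class_iff: "y \<in> chain_class n c \<longleftrightarrow> y - c \<in> degen dual_numbers n"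
proof
  assume "y - c \<in> degen dual_numbers n"
  moreover have "y = (y - c) + c"
    by simp
  ultimately show "y \<in> chain_class n c"
    unfolding chain_class_def r_coset_def words_def by (auto intro!: bexI[of _ "y - c"])
qed (auto simp: chain_class_def r_coset_def words_def)

lemma chain_class_eq: "chain_class n x = chain_class n y \<longleftrightarrow> x - y \<in> degen dual_numbers n"
proof
  assume "chain_class n x = chain_class n y"
  then show "x - y \<in> degen dual_numbers n"
    using chain_class_iff[of x n x] chain_class_iff[of x n y] by (simp add: degen_closed(1))
next
  assume xy: "x - y \<in> degen dual_numbers n"
  have "z - x \<in> degen dual_numbers n \<longleftrightarrow> z - y \<in> degen dual_numbers n" for z
    using degen_closed(2)[of "z - x" n "x - y"] degen_diff[of "z - y" n "x - y"] xy by auto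
  then show "chain_class n x = chain_class n y"
    by (auto simp: chain_class_iff)
qed

lemma words_comm_group: "comm_group (words n)"
  by (simp add: words_def abelian_free_Abelian_group)

lemma degen_normal: "degen dual_numbers n \<lhd> words (n + 1)"
  unfolding words_def by (rule free_Abelian_normal[OF degen_subgroup[unfolded words_def]])

lemma hoch_comm_group: "comm_group (hoch dual_numbers n)"
  unfolding hoch_def using words_comm_group degen_subgroup by (rule comm_group.abelian_FactGroup)

lemma chain_class_hom: "chain_class n \<in> hom (words (n + 1)) (hoch dual_numbers n)"
  unfolding hoch_def chain_class_def[abs_def] by (rule normal.r_coset_hom_Mod[OF degen_normal])

lemma hoch_carrier: "carrier (hoch dual_numbers n) = chain_class n ` carrier (words (n + 1))"
  by (simp add: hoch_def carrier_FactGroup chain_class_def[abs_def])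

lemma bd_degen: "x \<in> degen dual_numbers n \<Longrightarrow> bd x \<in> degen dual_numbers (n - 1)"
proof -
  assume "x \<in> degen dual_numbers n"
  then have "Poly_Mapping.keys x \<subseteq> degenerate_words n"
    by (simp add: degen_dual_numbers)
  then show ?thesis
    by (induction rule: frag_induction)
      (auto simp: degen_closed(1) hoch_word_degenerate frag_extend_diff degen_diff simp del: One_nat_def)
qed

lemma hoch_bd_chain_class:
  assumes "0 < n"
  shows "hoch_bd dual_numbers n (chain_class n x) = chain_class (n - 1) (bd x)"
proof -
  have "chain_class (n - 1) (bd y) = chain_class (n - 1) (bd x)" if "y \<in> chain_class n x" for y
    using that bd_degen by (simp add: chain_class_eq chain_class_iff flip: frag_extend_diff)
  moreover have "x \<in> chain_class n x"
    by (simp add: chain_class_iff degen_closed(1))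
  moreover have "n - 1 + 1 = n"
    using assms by simp
  ultimately show ?thesis
    unfolding hoch_bd_def chain_class_def[of "n - 1", symmetric]
    by (metis (no_types, lifting) SUP_eq_const chain_class_def empty_iff)
qed

lemma bd_words:
  assumes "x \<in> carrier (words (n + 2))"
  shows "bd x \<in> carrier (words (n + 1))"
proof -
  have "length w = n + 1" if "w \<in> Poly_Mapping.keys (face u i)" "length u = n + 2" for u i w
    using that keys_frag_extend[of "\<lambda>c. frag_of (take i u @ c # drop (i + 2) u)" "dual_mul (u ! i) (u ! Suc i)"]
      keys_frag_extend[of "\<lambda>c. frag_of (c # tl (butlast u))" "dual_mul (last u) (hd u)"]
    by (auto simp: face_def keys_frag_of split: if_splits)
  then have "Poly_Mapping.keys (hoch_word dual_numbers u) \<subseteq> {w. length w = n + 1}" if "length u = n + 2" for u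
    using that keys_sum[of "\<lambda>i. frag_cmul ((- 1) ^ i) (face u i)" "{..<length u}"]
      hoch_word_faces[of u] by (cases "u = []") fastforce+
  then show ?thesis
    using assms keys_frag_extend[of "hoch_word dual_numbers" x] by (fastforce simp: words_def)
qed

lemma hoch_boundaries_eq: "hoch_boundaries dual_numbers n = (\<lambda>x :: dual_basis list \<Rightarrow>\<^sub>0 int. chain_class n (bd x)) ` carrier (words (n + 2))"
  by (simp add: hoch_boundaries_def hoch_carrier image_image hoch_bd_chain_class)

lemma hoch_boundaries_subgroup: "subgroup (hoch_boundaries dual_numbers n) (hoch dual_numbers n)"
proof -
  have "(\<lambda>x :: dual_basis list \<Rightarrow>\<^sub>0 int. chain_class n (bd x)) \<in> hom (words (n + 2)) (hoch dual_numbers n)"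
  proof (rule homI)
    fix x y :: "dual_basis list \<Rightarrow>\<^sub>0 int"
    assume xy: "x \<in> carrier (words (n + 2))" "y \<in> carrier (words (n + 2))"
    then have bd: "bd x \<in> carrier (words (n + 1))" "bd y \<in> carrier (words (n + 1))"
      using bd_words by blast+
    then show "chain_class n (bd x) \<in> carrier (hoch dual_numbers n)"
      by (simp add: hoch_carrier)
    show "chain_class n (bd (x \<otimes>\<^bsub>words (n + 2)\<^esub> y)) = chain_class n (bd x) \<otimes>\<^bsub>hoch dual_numbers n\<^esub> chain_class n (bd y)"
      using hom_mult[OF chain_class_hom bd] by (simp add: words_def frag_extend_add)
  qed
  then have "group_hom (words (n + 2)) (hoch dual_numbers n) (\<lambda>x. chain_class n (bd x))"
    using comm_group.axioms(2)[OF words_comm_group[of "n + 2"]] comm_group.axioms(2)[OF hoch_comm_group[of n]]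
    by (simp add: group_hom_def group_hom_axioms_def)
  then show ?thesis
    unfolding hoch_boundaries_eq by (rule group_hom.img_is_subgroup)
qed

text \<open>
  In odd degree the factor \<open>1 + (-1)^n\<close> in the boundary of \<open>1 \<otimes> x \<otimes> \<dots> \<otimes> x\<close> is 0.
\<close>

lemma hoch_cycles_all:
  assumes "n = 0 \<or> odd n"
  shows "hoch_cycles dual_numbers n = hoch dual_numbers n"
proof -
  have "hoch_bd dual_numbers n X = \<one>\<^bsub>hoch dual_numbers (n - 1)\<^esub>" if X: "X \<in> carrier (hoch dual_numbers n)" "0 < n" for X
  proof -
    obtain x where x: "X = chain_class n x" "Poly_Mapping.keys x \<subseteq> {u. length u = n + 1}"
      using X(1) by (auto simp: hoch_carrier words_def)
    from x(2) have "bd x \<in> degen dual_numbers (n - 1)"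
      by (induction rule: frag_induction)
        (use assms X(2) in \<open>auto simp: degen_closed(1) hoch_word_odd frag_extend_diff degen_diff simp del: One_nat_def\<close>)
    then have "chain_class (n - 1) (bd x) = chain_class (n - 1) 0"
      by (simp add: chain_class_eq)
    also have "\<dots> = degen dual_numbers (n - 1)"
      by (auto simp: chain_class_iff)
    finally show ?thesis
      using X(2) by (simp add: x(1) hoch_bd_chain_class hoch_def)
  qed
  then have "{X \<in> carrier (hoch dual_numbers n). n = 0 \<or> hoch_bd dual_numbers n X = \<one>\<^bsub>hoch dual_numbers (n - 1)\<^esub>} = carrier (hoch dual_numbers n)"
    by auto
  then show ?thesis
    unfolding hoch_cycles_def by (simp add: hoch_def FactGroup_def)
qed

context
  fixes n :: nat
  assumes n: "n = 0 \<or> odd n"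
begin

lemma HH_eq: "HH dual_numbers n = hoch dual_numbers n Mod hoch_boundaries dual_numbers n"
  by (simp add: HH_def hoch_cycles_all[OF n])

lemma HH_comm_group: "comm_group (HH dual_numbers n)"
  unfolding HH_eq using hoch_comm_group hoch_boundaries_subgroup by (rule comm_group.abelian_FactGroup)

lemma HH_class_eq: "HH_class dual_numbers n = (\<lambda>X. hoch_boundaries dual_numbers n #>\<^bsub>hoch dual_numbers n\<^esub> X) \<circ> chain_class n"
  by (simp add: fun_eq_iff HH_class_def hoch_cycles_all[OF n] chain_class_def)

lemma HH_class_hom: "HH_class dual_numbers n \<in> hom (words (n + 1)) (HH dual_numbers n)"
proof -
  have "hoch_boundaries dual_numbers n \<lhd> hoch dual_numbers n"
    using hoch_boundaries_subgroup hoch_comm_group comm_group.normal_iff_subgroup by blast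
  then show ?thesis
    unfolding HH_class_eq HH_eq using chain_class_hom
    by (intro hom_compose[OF _ normal.r_coset_hom_Mod])
qed

lemma HH_carrier: "carrier (HH dual_numbers n) = HH_class dual_numbers n ` carrier (words (n + 1))"
  unfolding HH_eq HH_class_eq by (simp add: carrier_FactGroup hoch_carrier image_image)

lemma HH_class_one:
  assumes c: "c \<in> carrier (words (n + 1))" and one: "HH_class dual_numbers n c = \<one>\<^bsub>HH dual_numbers n\<^esub>"
  obtains x where "x \<in> carrier (words (n + 2))" "c - bd x \<in> degen dual_numbers n"
proof -
  have "chain_class n c \<in> hoch_boundaries dual_numbers n"
  proof (rule group.coset_join1[OF comm_group.axioms(2)[OF hoch_comm_group]])
    show "hoch_boundaries dual_numbers n #>\<^bsub>hoch dual_numbers n\<^esub> chain_class n c = hoch_boundaries dual_numbers n"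
      using one by (simp add: HH_class_eq HH_eq)
    show "chain_class n c \<in> carrier (hoch dual_numbers n)"
      using c by (simp add: hoch_carrier)
  qed (rule hoch_boundaries_subgroup)
  then show ?thesis
    using that by (auto simp: hoch_boundaries_eq chain_class_eq)
qed

text \<open>
  The invariant that detects the class of \<open>1 \<otimes> x \<otimes> \<dots> \<otimes> x\<close>: its coefficient vanishes on
  degenerate chains and on boundaries.
\<close>

lemma HH_class_one_lookup:
  assumes c: "c \<in> carrier (words (n + 1))" and one: "HH_class dual_numbers n c = \<one>\<^bsub>HH dual_numbers n\<^esub>"
  shows "Poly_Mapping.lookup c (B1 # replicate n Bx) = 0"
proof -
  let ?w = "B1 # replicate n Bx"
  obtain x where x: "x \<in> carrier (words (n + 2))" "c - bd x \<in> degen dual_numbers n"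
    using HH_class_one[OF assms] .
  have "?w \<notin> degenerate_words n"
    by (auto simp: degenerate_words_def nth_Cons split: nat.splits)
  then have "?w \<notin> Poly_Mapping.keys (c - bd x)"
    using x(2) by (auto simp: degen_dual_numbers)
  then have "Poly_Mapping.lookup c ?w = Poly_Mapping.lookup (bd x) ?w"
    by (simp add: in_keys_iff lookup_minus)
  also have "Poly_Mapping.keys x \<subseteq> {u. length u = n + 2}"
    using x(1) by (simp add: words_def)
  then have "Poly_Mapping.lookup (bd x) ?w = 0"
    by (induction rule: frag_induction) (auto simp: lookup_hoch_word frag_extend_diff lookup_minus)
  finally show ?thesis .
qed

end

text \<open>
  The algebra is commutative, so there are no boundaries in degree 0; nor are there degenerate chains.
\<close>

lemma HH_class_0_inj: "inj_on (HH_class dual_numbers 0) (carrier (words 1))"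
proof -
  have "group_hom (words 1) (HH dual_numbers 0) (HH_class dual_numbers 0)"
    using HH_class_hom[of 0] comm_group.axioms(2)[OF HH_comm_group[of 0]]
      comm_group.axioms(2)[OF words_comm_group[of 1]]
    by (simp add: group_hom_def group_hom_axioms_def)
  moreover have "c = 0" if c: "c \<in> carrier (words 1)" "HH_class dual_numbers 0 c = \<one>\<^bsub>HH dual_numbers 0\<^esub>" for c
  proof -
    obtain x where x: "x \<in> carrier (words 2)" "c - bd x \<in> degen dual_numbers 0"
      using HH_class_one[of 0 c] c by (auto simp: numeral_2_eq_2)
    have "hoch_word dual_numbers u = 0" if u: "length u = 2" for u
    proof -
      obtain a b where "u = [a, b]"
        using u by (auto simp: numeral_2_eq_2 length_Suc_conv)
      then show ?thesis
        by (cases a; cases b) (simp_all add: hoch_word_faces face_def)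
    qed
    then have "bd x = 0"
      using x(1) by (intro frag_extend_eq_0) (auto simp: words_def)
    moreover have "degenerate_words 0 = {}"
      by (auto simp: degenerate_words_def)
    ultimately show ?thesis
      using x(2) by (simp add: degen_dual_numbers)
  qed
  ultimately show ?thesis
    by (auto simp: group_hom.inj_on_one_iff words_def)
qed

section \<open>The induced map\<close>

lemma tensor_add:
  "i < length as \<Longrightarrow> tensor (as[i := a + b]) = tensor (as[i := a]) + tensor (as[i := b])"
proof (induction as arbitrary: i)
  case (Cons c as)
  show ?case
  proof (cases i)
    case 0
    then show ?thesis by (simp add: frag_extend_add)
  next
    case (Suc j)
    have "frag_extend (\<lambda>u. f u + g u) c = frag_extend f c + frag_extend g c" for f g :: "'a list \<Rightarrow> 'a list \<Rightarrow>\<^sub>0 int"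
      by (simp add: frag_extend_def frag_cmul_distrib2 sum.distrib)
    then show ?thesis
      using Suc Cons by (simp add: frag_extend_add)
  qed
qed simp

lemma multilinear_relations_subgroup:
  assumes "monoid M"
  shows "subgroup (multilinear_relations M n) (free_Abelian_group {xs. length xs = n \<and> set xs \<subseteq> carrier M})"
  unfolding multilinear_relations_def
proof (rule frag_span_subgroup)
  fix r
  assume "r \<in> {frag_of (xs[i := x \<otimes>\<^bsub>M\<^esub> y]) - frag_of (xs[i := x]) - frag_of (xs[i := y]) |xs i x y.
     length xs = n \<and> set xs \<subseteq> carrier M \<and> i < n \<and> x \<in> carrier M \<and> y \<in> carrier M}"
  then obtain xs i x y where r: "r = frag_of (xs[i := x \<otimes>\<^bsub>M\<^esub> y]) - frag_of (xs[i := x]) - frag_of (xs[i := y])"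
    and xs: "length xs = n" "set xs \<subseteq> carrier M" and xy: "x \<in> carrier M" "y \<in> carrier M"
    by blast
  have "Poly_Mapping.keys r \<subseteq> {xs[i := x \<otimes>\<^bsub>M\<^esub> y], xs[i := x], xs[i := y]}"
    unfolding r using keys_diff[of "frag_of (xs[i := x \<otimes>\<^bsub>M\<^esub> y]) - frag_of (xs[i := x])" "frag_of (xs[i := y])"]
      keys_diff[of "frag_of (xs[i := x \<otimes>\<^bsub>M\<^esub> y])" "frag_of (xs[i := x])"] by (auto simp: keys_frag_of)
  moreover have "set (xs[i := z]) \<subseteq> carrier M" if "z \<in> carrier M" for z
    using set_update_subset_insert[of xs i z] xs(2) that by auto
  ultimately show "Poly_Mapping.keys r \<subseteq> {xs. length xs = n \<and> set xs \<subseteq> carrier M}"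
    using xs(1) xy monoid.m_closed[OF assms xy] by auto
qed

text \<open>
  The universal property of the tensor power, for maps given on tensors of representatives. As
  \<open>e\<close> is bijective, lists of representatives define the map on the generators of the tensor power.
\<close>

lemma tensor_power_map:
  fixes f :: "('b list \<Rightarrow>\<^sub>0 int) \<Rightarrow> 'c"
  assumes M: "comm_group M" and H: "group H"
    and e: "e \<in> hom (words 1) M" "bij_betw e (carrier (words 1)) (carrier M)"
    and f: "\<And>x y. f (x + y) = f x \<otimes>\<^bsub>H\<^esub> f y" "\<And>x. f x \<in> carrier H"
  obtains \<Phi> where "\<Phi> \<in> hom (tensor_power M n) H"
    and "\<And>as. length as = n \<Longrightarrow> set as \<subseteq> carrier (words 1) \<Longrightarrow> \<Phi> (pure_tensor M (map e as)) = f (tensor as)"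
proof -
  let ?S = "{xs. length xs = n \<and> set xs \<subseteq> carrier M}"
  let ?F = "free_Abelian_group ?S" and ?N = "multilinear_relations M n"
  have mon: "monoid M"
    using M by (simp add: comm_group_def group.is_monoid)
  define r where "r = inv_into (carrier (words 1)) e"
  have re: "r (e a) = a" if "a \<in> carrier (words 1)" for a
    unfolding r_def using bij_betw_inv_into_left[OF e(2) that] .
  have er: "e (r x) = x" "r x \<in> carrier (words 1)" if "x \<in> carrier M" for x
    unfolding r_def using bij_betw_inv_into_right[OF e(2) that] bij_betwE[OF bij_betw_inv_into[OF e(2)]] that by auto
  have r_add: "r (x \<otimes>\<^bsub>M\<^esub> y) = r x + r y" if "x \<in> carrier M" "y \<in> carrier M" for x y
  proof -
    have "r x + r y \<in> carrier (words 1)"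
      using er(2)[OF that(1)] er(2)[OF that(2)] keys_add[of "r x" "r y"] by (auto simp: words_def)
    moreover have "e (r x + r y) = x \<otimes>\<^bsub>M\<^esub> y"
      using hom_mult[OF e(1) er(2)[OF that(1)] er(2)[OF that(2)]] that by (simp add: er(1) words_def)
    ultimately show ?thesis
      using re by metis
  qed
  let ?T = "frag_extend (\<lambda>xs. tensor (map r xs))"
  define h where "h c = f (?T c)" for c
  have "h \<in> hom ?F H"
    by (rule homI) (simp_all add: h_def f frag_extend_add)
  then have hom: "group_hom ?F H h"
    using H by (simp add: group_hom_def group_hom_axioms_def)
  \<comment> \<open>multilinear relations are sent to 0 since choosing representatives is additive\<close>
  have "?T x = 0" if "x \<in> ?N" for x
    using that unfolding multilinear_relations_def
  proof (induction rule: frag_span_induct)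
    case (base x)
    then show ?case
      by (auto simp: frag_extend_diff map_update r_add tensor_add)
  qed (simp_all add: frag_extend_diff)
  moreover have "f 0 = \<one>\<^bsub>H\<^esub>"
    using group_hom.hom_one[OF hom] by (simp add: h_def)
  moreover have N: "subgroup ?N ?F"
    using mon by (rule multilinear_relations_subgroup)
  ultimately have ker: "?N \<subseteq> kernel ?F H h"
    using subgroup.subset[OF N] by (simp add: kernel_def h_def subset_iff)
  obtain \<Phi> where \<Phi>: "\<Phi> \<in> hom (?F Mod ?N) H" "\<And>x. x \<in> carrier ?F \<Longrightarrow> \<Phi> (?N #>\<^bsub>?F\<^esub> x) = h x"
    using group_hom.FactGroup_universal_kernel[OF hom free_Abelian_normal[OF N] ker] by blast
  show ?thesis
  proof (rule that[of \<Phi>])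
    show "\<Phi> \<in> hom (tensor_power M n) H"
      using \<Phi>(1) by (simp add: tensor_power_def)
    fix as :: "('b list \<Rightarrow>\<^sub>0 int) list"
    assume as: "length as = n" "set as \<subseteq> carrier (words 1)"
    then have "set (map e as) \<subseteq> carrier M"
      using bij_betwE[OF e(2)] by auto
    then have "frag_of (map e as) \<in> carrier ?F"
      using as(1) by simp
    then have "\<Phi> (pure_tensor M (map e as)) = h (frag_of (map e as))"
      using \<Phi>(2) as(1) by (simp add: pure_tensor_def)
    also have "map r (map e as) = as"
      unfolding map_map using as(2) re by (intro map_idI) auto
    then have "h (frag_of (map e as)) = f (tensor as)"
      by (simp add: h_def del: map_map)
    finally show "\<Phi> (pure_tensor M (map e as)) = f (tensor as)" .
  qed
qed

lemma pure_tensor_carrier: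
  "set xs \<subseteq> carrier M \<Longrightarrow> pure_tensor M xs \<in> carrier (tensor_power M (length xs))"
  by (auto simp: pure_tensor_def tensor_power_def carrier_FactGroup intro!: image_eqI)

lemma state_sum_words:
  assumes "ribbon_graph G"
  shows "state_sum G w \<in> carrier (words (card (white G)))"
proof -
  have "length (white_list G) = card (white G)"
    by (simp add: white_list_def)
  then show ?thesis
    unfolding state_sum_def words_def using keys_sum by (fastforce simp: keys_frag_of)
qed

theorem corollary4p2:
  fixes g :: nat and t :: ptree and \<omega> :: orient
  assumes "g \<ge> 1" and "legs t = g" and "orientation (mu_graph t) \<omega>"
  shows "\<exists>\<Phi>. induces dual_numbers (g + 1) (2 * g + 1)
                (SD_class (g + 1) (2 * g + 1) (mu_graph t, \<omega>)) \<Phi> \<and>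
             (\<exists>\<tau>\<in>carrier (tensor_power (HH dual_numbers 0) (g + 1)).
                \<Phi> \<tau> \<noteq> \<one>\<^bsub>HH dual_numbers (2 * g + 1)\<^esub>)"
proof -
  let ?G = "mu_graph t" and ?n = "g + 1" and ?d = "2 * g + 1"
  let ?X = "(?G, \<omega>)"
  have mu: "sullivan_graph ?n ?G" "trivalent ?G" "degree ?G = ?d" "white ?G = {..<2 * g + 2}"
    using mu_sullivan[OF refl refl, of t] mu_trivalent[OF refl refl, of t] mu_degree[OF refl refl, of t]
      mu_white[OF refl refl, of t] assms(2) by simp_all
  note R = sullivan_ribbon[OF mu(1)]
  have X: "?X \<in> oriented_graphs ?n ?d"
    using mu assms(3) by (simp add: oriented_graphs_def)
  have act: "graph_act dual_numbers ?X w = frag_cmul (reorder_sign (canonical_orientation ?G) \<omega>) (state_sum ?G w)" for w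
    using graph_act_dual_numbers[OF R mu(2)] .
  define f where "f x = HH_class dual_numbers ?d (frag_extend (graph_act dual_numbers ?X) x)" for x
  have words: "frag_extend (graph_act dual_numbers ?X) x \<in> carrier (words (?d + 1))" for x
  proof -
    have "Poly_Mapping.keys (graph_act dual_numbers ?X w) \<subseteq> {u. length u = ?d + 1}" for w
      using state_sum_words[OF R, of w] keys_cmul[of _ "state_sum ?G w"] by (fastforce simp: act mu(4) words_def)
    then show ?thesis
      using keys_frag_extend[of "graph_act dual_numbers ?X" x] by (fastforce simp: words_def)
  qed
  have odd: "?d = 0 \<or> odd ?d"
    by simp
  have f: "f (x + y) = f x \<otimes>\<^bsub>HH dual_numbers ?d\<^esub> f y" "f x \<in> carrier (HH dual_numbers ?d)" for x y
    using hom_mult[OF HH_class_hom[OF odd] words words] hom_in_carrier[OF HH_class_hom[OF odd] words]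
    by (simp_all add: f_def frag_extend_add words_def)
  have bij: "bij_betw (HH_class dual_numbers 0) (carrier (words 1)) (carrier (HH dual_numbers 0))"
    using HH_class_0_inj HH_carrier[of 0] by (simp add: bij_betw_def)
  have e: "HH_class dual_numbers 0 \<in> hom (words 1) (HH dual_numbers 0)"
    using HH_class_hom[of 0] by simp
  have H: "comm_group (HH dual_numbers 0)" "group (HH dual_numbers ?d)"
    using HH_comm_group[of 0] HH_comm_group[OF odd] comm_group.axioms(2) by auto
  obtain \<Phi> where hom: "\<Phi> \<in> hom (tensor_power (HH dual_numbers 0) ?n) (HH dual_numbers ?d)"
    and \<Phi>: "\<And>as. length as = ?n \<Longrightarrow> set as \<subseteq> carrier (words 1) \<Longrightarrow>
      \<Phi> (pure_tensor (HH dual_numbers 0) (map (HH_class dual_numbers 0) as)) = f (tensor as)"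
    using tensor_power_map[OF H e bij f, of ?n] by blast
  have "SD_class ?n ?d ?X \<in> carrier (SD ?n ?d)"
    using X by (auto simp: SD_class_def SD_def carrier_FactGroup intro!: image_eqI)
  moreover have "f a = HH_class dual_numbers ?d (SD_act dual_numbers c a)" if c: "c \<in> SD_class ?n ?d ?X" for c a
  proof -
    obtain r where r: "r \<in> SD_relations ?n ?d" "c = r + frag_of ?X"
      using c by (auto simp: SD_class_def r_coset_def)
    then have "SD_act dual_numbers c a = SD_act dual_numbers r a + SD_act dual_numbers (frag_of ?X) a"
      by (simp add: SD_act_def frag_extend_add)
    then show ?thesis
      using SD_relations_act[OF r(1)] by (simp add: f_def SD_act_def)
  qed
  ultimately have induces: "induces dual_numbers ?n ?d (SD_class ?n ?d ?X) \<Phi>"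
    using hom \<Phi> unfolding induces_def by metis
  let ?as = "replicate ?n (frag_of [Bx])"
  let ?\<tau> = "pure_tensor (HH dual_numbers 0) (map (HH_class dual_numbers 0) ?as)"
  have as: "length ?as = ?n" "set ?as \<subseteq> carrier (words 1)"
    by (auto simp: words_def keys_frag_of)
  have "set (map (HH_class dual_numbers 0) ?as) \<subseteq> carrier (HH dual_numbers 0)"
    using as(2) bij_betwE[OF bij] by auto
  then have \<tau>: "?\<tau> \<in> carrier (tensor_power (HH dual_numbers 0) ?n)"
    using pure_tensor_carrier by (metis as(1) length_map)
  have "tensor ?as = frag_of (replicate ?n Bx)"
    using tensor_letters[of "replicate ?n Bx"] by simp
  then have "\<Phi> ?\<tau> = HH_class dual_numbers ?d (graph_act dual_numbers ?X (replicate ?n Bx))"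
    using \<Phi>[OF as] by (simp add: f_def del: replicate_Suc)
  moreover have "Poly_Mapping.lookup (graph_act dual_numbers ?X (replicate ?n Bx)) (B1 # replicate ?d Bx) \<noteq> 0"
  proof -
    have "reorder_sign (canonical_orientation ?G) \<omega> \<noteq> 0"
      using reorder_sign_square[OF orientation_same_entries[OF orientation_canonical[OF R mu(2)] assms(3)]] by auto
    moreover have "0 < Poly_Mapping.lookup (state_sum ?G (replicate ?n Bx)) (B1 # replicate ?d Bx)"
      using mu_state_sum_lookup[OF refl refl, of t] assms(2) by simp
    ultimately show ?thesis
      by (simp add: act)
  qed
  ultimately have "\<Phi> ?\<tau> \<noteq> \<one>\<^bsub>HH dual_numbers ?d\<^esub>"
    using HH_class_one_lookup[OF odd] words[of "frag_of (replicate ?n Bx)"] by auto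
  then show ?thesis
    using induces \<tau> by blast
qed

end
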